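(* Let $\mathbb K\subset\mathbb R^3$ be a convex body whose boundary $\partial\mathbb K$ is $C^4$ smooth and which contains the origin in its interior, so that its support function $u(x)=\max\{\langle x,y\rangle: y\in\mathbb K\}$ satisfies $u>0$ on $\mathbb S^2$. For $x\in\mathbb S^2$ let $K(x)$ denote the Gauss curvature of $\partial\mathbb K$ at the point of $\partial\mathbb K$ with unit outer normal $x$. Let $p$ be a real constant and suppose that there is a positive constant $C$ with $$\frac{u(x)^{1-p}}{K(x)}=C\quad\text{for all }x\in\mathbb S^2 .$$ Assume that either (i) $-1\le p\le 0$; or (ii) $0<p<1$, and at every point of $\partial\mathbb K$ the principal curvatures $\kappa_1\ge\kappa_2$ of $\partial\mathbb K$ satisfy $\kappa_2\ge \beta(p)\,\kappa_1$, where $$\beta(p)=2\left(\frac{1-\sqrt{1-\sqrt{1-q^2}}}{\sqrt{1-q^2}}\right)-1,\qquad q=1-p.$$ Then $\mathbb K$ is a ball; more precisely, $u$ is constant on $\mathbb S^2$, i.e. $\mathbb K$ is a ball centred at the origin.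
   Context: The support function $u$ of a convex body $\mathbb K$ is $u(x)=\max\{\langle x,y\rangle : y\in\mathbb K\}$ for $x\in\mathbb S^2$. The quantity $u^{1-p}/K$ is called the $p$-curvature function of $\mathbb K$; equivalently the hypothesis says $\det(u_{ij}+u\delta_{ij})=C\,u^{p-1}$ on $\mathbb S^2$, where $u_{ij}$ are covariant derivatives of $u$ with respect to an orthonormal frame on $\mathbb S^2$ and $\det(u_{ij}+u\delta_{ij})=1/K$. *)

theory Defs
  imports "HOL-Analysis.Analysis"
begin

definition pderiv3 :: "(real^3 \<Rightarrow> real) \<Rightarrow> 3 \<Rightarrow> real^3 \<Rightarrow> real" where
  "pderiv3 f i x = frechet_derivative f (at x) (axis i 1)"

fun Ck :: "nat \<Rightarrow> (real^3) set \<Rightarrow> (real^3 \<Rightarrow> real) \<Rightarrow> bool" where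
  "Ck 0 U f = continuous_on U f"
| "Ck (Suc k) U f = ((\<forall>x\<in>U. f differentiable (at x)) \<and> (\<forall>i. Ck k U (pderiv3 f i)))"

definition grad3 :: "(real^3 \<Rightarrow> real) \<Rightarrow> real^3 \<Rightarrow> real^3" where
  "grad3 f x = (\<chi> i. pderiv3 f i x)"

definition hess3 :: "(real^3 \<Rightarrow> real) \<Rightarrow> real^3 \<Rightarrow> real^3^3" where
  "hess3 f x = (\<chi> i j. pderiv3 (pderiv3 f j) i x)"

definition local_defining_fn ::
  "nat \<Rightarrow> (real^3) set \<Rightarrow> real^3 \<Rightarrow> (real^3) set \<Rightarrow> (real^3 \<Rightarrow> real) \<Rightarrow> bool" where
  "local_defining_fn k S y U f \<longleftrightarrow>
     open U \<and> y \<in> U \<and> Ck k U f \<and> (\<forall>z\<in>U. grad3 f z \<noteq> 0) \<and>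
     S \<inter> U = {z\<in>U. f z \<le> 0}"

definition Ck_boundary :: "nat \<Rightarrow> (real^3) set \<Rightarrow> bool" where
  "Ck_boundary k S \<longleftrightarrow> (\<forall>y\<in>frontier S. \<exists>U f. local_defining_fn k S y U f)"

definition outer_normal :: "(real^3 \<Rightarrow> real) \<Rightarrow> real^3 \<Rightarrow> real^3" where
  "outer_normal f y = grad3 f y /\<^sub>R norm (grad3 f y)"

text \<open>Second fundamental form (w.r.t. the outer normal) at y, evaluated on a tangent vector v.\<close>
definition second_ff :: "(real^3 \<Rightarrow> real) \<Rightarrow> real^3 \<Rightarrow> real^3 \<Rightarrow> real" where
  "second_ff f y v = (v \<bullet> (hess3 f y *v v)) / norm (grad3 f y)"

definition unit_tangents :: "(real^3 \<Rightarrow> real) \<Rightarrow> real^3 \<Rightarrow> (real^3) set" where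
  "unit_tangents f y = {v. norm v = 1 \<and> v \<bullet> grad3 f y = 0}"

definition kappa1 :: "(real^3 \<Rightarrow> real) \<Rightarrow> real^3 \<Rightarrow> real" where
  "kappa1 f y = Sup (second_ff f y ` unit_tangents f y)"

definition kappa2 :: "(real^3 \<Rightarrow> real) \<Rightarrow> real^3 \<Rightarrow> real" where
  "kappa2 f y = Inf (second_ff f y ` unit_tangents f y)"

definition gauss_curv :: "(real^3 \<Rightarrow> real) \<Rightarrow> real^3 \<Rightarrow> real" where
  "gauss_curv f y = kappa1 f y * kappa2 f y"

definition support_fn :: "(real^3) set \<Rightarrow> real^3 \<Rightarrow> real" where
  "support_fn S x = Sup ((\<lambda>y. x \<bullet> y) ` S)"

definition beta_p :: "real \<Rightarrow> real" where
  "beta_p p = (let q = 1 - p in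
     2 * ((1 - sqrt (1 - sqrt (1 - q\<^sup>2))) / sqrt (1 - q\<^sup>2)) - 1)"

end

theory Submission
  imports Defs
begin

text \<open>
  Put \<open>a = 1 - p\<close> and let \<open>h\<close> be the support function, extended 1-homogeneously to \<open>\<real>\<^sup>3\<close>. Inverting
  the Gauss map shows that \<open>h\<close> is of class C4 off the origin and that the restriction of its Hessian
  to the tangent planes of the sphere has determinant \<open>C h\<^sup>-\<^sup>a\<close>. Following Brendle, Choi and
  Daskalopoulos, consider
  \<open>\<Phi>(x,v) = h(x) D\<^sup>2h(x)(v,v) - (2 - a)/4 |\<nabla>h(x)|\<^sup>2\<close> on the unit tangent bundle of the sphere. At a
  maximum point of \<open>\<Phi> + \<psi>\<close>, the second derivative test along curves that move \<open>x\<close> and rotate \<open>v\<close> at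
  the same time, combined with the equation differentiated twice, gives an inequality which for
  \<open>\<psi> = 0\<close> forces the tangential gradient of \<open>h\<close> to vanish. Taking \<open>\<psi>\<close> to be a small multiple of
  \<open>exp (A \<langle>q,x\<rangle>/|x|)\<close> with \<open>A\<close> large, the inequality excludes maxima away from \<open>q\<close>; hence every unit
  vector \<open>q\<close> carries a maximum of \<open>\<Phi>\<close>, the gradient vanishes everywhere, and \<open>h\<close> is constant on
  the sphere.
\<close>

section \<open>Calculus of functions of class Ck\<close>

text \<open>The largest principal radius need not be differentiable where the radii coincide. On the
  unit tangent bundle \<open>v\<close> is an independent variable, so no eigenvalue is
  differentiated. With \<open>h\<close> of class C4, \<Phi> is C2 in \<open>x\<close>, just enough
  for a second derivative test. The homogeneous extension replaces covariant derivatives by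
  derivatives along straight lines; the curvature of the sphere survives only in powers of 1 + t^2.
  The weight (2 - a)/4 is written b/2 with b = 1 - a/2. When the two second-order conditions are
  added with weights 1/r1 and 1/r2 (the linearised determinant), exactly this weight cancels the
  terms in h^2, and 0 <= b < 1 gives the remaining terms their sign. The obstacle is global: a
  maximum point yields information at that point only. The exponential is a barrier as in Hopf's
  strong maximum principle: its second derivatives bring a factor A^2, its first derivatives only A,
  and all of them are proportional to its amplitude. So one large A serves every amplitude, and an
  arbitrarily small perturbation can push the maximum towards \<open>q\<close>.\<close>

definition dd :: "real^3 \<Rightarrow> (real^3 \<Rightarrow> real) \<Rightarrow> real^3 \<Rightarrow> real" where
  "dd v f x = frechet_derivative f (at x) v"

lemma pderiv3_eq_dd: "pderiv3 f i = dd (axis i 1) f"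
  by (simp add: fun_eq_iff pderiv3_def dd_def)

lemma dd_eqI: "(f has_derivative f') (at x) \<Longrightarrow> dd v f x = f' v"
  unfolding dd_def using frechet_derivative_at by metis

lemma has_derivative_dd:
  "f differentiable (at x) \<Longrightarrow> (f has_derivative (\<lambda>v. dd v f x)) (at x)"
  unfolding dd_def using frechet_derivative_works by (metis eta_contract_eq)

lemma linear_dd: "f differentiable (at x) \<Longrightarrow> linear (\<lambda>v. dd v f x)"
  unfolding dd_def by (simp add: linear_frechet_derivative)

lemma dd_cong:
  assumes "open U" "x \<in> U" "\<And>y. y \<in> U \<Longrightarrow> f y = g y" "f differentiable (at x)"
  shows "dd v f x = dd v g x"
  unfolding dd_def using frechet_derivative_transform_within_open assms by metis

lemma dd_expand:
  assumes "f differentiable (at x)"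
  shows "dd v f x = (\<Sum>i\<in>UNIV. v$i * pderiv3 f i x)"
proof -
  have "dd v f x = dd (\<Sum>i\<in>UNIV. v$i *\<^sub>R axis i 1) f x"
    by (simp add: basis_expansion flip: scalar_mult_eq_scaleR)
  also have "\<dots> = (\<Sum>i\<in>UNIV. v$i * dd (axis i 1) f x)"
    using linear_sum[OF linear_dd[OF assms], of "\<lambda>i. v$i *\<^sub>R axis i 1" UNIV]
      linear_cmul[OF linear_dd[OF assms]] by simp
  finally show ?thesis by (simp add: pderiv3_eq_dd)
qed

lemma differentiable_cong_open:
  fixes f :: "'a::real_normed_vector \<Rightarrow> 'b::real_normed_vector"
  assumes "open U" "x \<in> U" "\<And>y. y \<in> U \<Longrightarrow> f y = g y" "f differentiable (at x)"
  shows "g differentiable (at x)"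
  using assms has_derivative_transform_within_open unfolding differentiable_def by metis

text \<open>Derivative formulas such as the product rule hold on \<open>U\<close> only, whereas
  \<open>Ck\<close> refers to the total functions \<open>pderiv3 f i\<close>. The closure lemmas
  below compute a partial derivative on \<open>U\<close> and transfer its class with this
  lemma.\<close>

lemma Ck_cong:
  assumes "open U" "\<And>x. x \<in> U \<Longrightarrow> f x = g x" "Ck k U f"
  shows "Ck k U g"
  using assms(2,3)
proof (induction k arbitrary: f g)
  case 0
  then show ?case using continuous_on_cong by fastforce
next
  case (Suc k)
  have "Ck k U (pderiv3 g i)" for i
    using Suc.IH[of "pderiv3 f i" "pderiv3 g i"] Suc.prems dd_cong[OF assms(1), of _ f g]
    by (simp add: pderiv3_eq_dd)
  then show ?case
    using Suc.prems differentiable_cong_open[OF assms(1)] by (metis Ck.simps(2))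
qed

lemma Ck_subset: "Ck k U f \<Longrightarrow> V \<subseteq> U \<Longrightarrow> Ck k V f"
  by (induction k arbitrary: f) (auto intro: continuous_on_subset)

lemma Ck_continuous_on: "Ck k U f \<Longrightarrow> continuous_on U f"
  by (cases k)
    (auto intro!: continuous_at_imp_continuous_on differentiable_imp_continuous_within)

lemma Ck_SucD: "Ck (Suc k) U f \<Longrightarrow> Ck k U f"
proof (induction k arbitrary: f)
  case 0
  then show ?case using Ck_continuous_on[of "Suc 0"] by simp
qed auto

lemma Ck_mono: "Ck k U f \<Longrightarrow> j \<le> k \<Longrightarrow> Ck j U f"
  by (induction k) (auto simp: le_Suc_eq dest: Ck_SucD simp del: Ck.simps)

lemma Ck_differentiable_at: "Ck k U g \<Longrightarrow> k > 0 \<Longrightarrow> x \<in> U \<Longrightarrow> g differentiable (at x)"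
  by (cases k) auto

lemma Ck_local:
  assumes "\<And>x. x \<in> U \<Longrightarrow> \<exists>V. open V \<and> x \<in> V \<and> Ck k V f"
  shows "Ck k U f"
  using assms
proof (induction k arbitrary: f)
  case 0
  then show ?case
    by (fastforce simp: continuous_on_eq_continuous_at intro!: continuous_at_imp_continuous_on)
next
  case (Suc k)
  then show ?case by (metis Ck.simps(2))
qed

lemma Ck_const [simp]: "Ck k U (\<lambda>x. c)"
proof (induction k arbitrary: c)
  case (Suc k)
  have "pderiv3 (\<lambda>x. c) i = (\<lambda>x. 0)" for i
    by (auto simp: fun_eq_iff pderiv3_eq_dd intro!: dd_eqI)
  then show ?case using Suc by auto
qed auto

lemma Ck_bounded_linear:
  assumes "bounded_linear f" shows "Ck k U f"
proof (cases k)
  case 0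
  then show ?thesis by (simp add: assms linear_continuous_on)
next
  case (Suc j)
  have "pderiv3 f i = (\<lambda>x. f (axis i 1))" for i
    by (auto simp: fun_eq_iff pderiv3_eq_dd intro!: dd_eqI bounded_linear_imp_has_derivative assms)
  then show ?thesis using Suc bounded_linear_imp_differentiable[OF assms] by auto
qed

lemma Ck_component [simp]: "Ck k U (\<lambda>x. x$i)"
  by (rule Ck_bounded_linear) (rule bounded_linear_vec_nth)

lemma Ck_add:
  assumes "open U" "Ck k U f" "Ck k U g"
  shows "Ck k U (\<lambda>x. f x + g x)"
  using assms(2,3)
proof (induction k arbitrary: f g)
  case 0
  then show ?case by (auto intro: continuous_on_add)
next
  case (Suc k)
  have "Ck k U (pderiv3 (\<lambda>x. f x + g x) i)" for i
  proof (rule Ck_cong[OF assms(1)])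
    show "Ck k U (\<lambda>x. pderiv3 f i x + pderiv3 g i x)"
      using Suc by auto
    show "pderiv3 f i x + pderiv3 g i x = pderiv3 (\<lambda>x. f x + g x) i x" if "x \<in> U" for x
      using Suc.prems that unfolding pderiv3_eq_dd
      by (intro dd_eqI[symmetric] has_derivative_add has_derivative_dd) auto
  qed
  then show ?case using Suc.prems by auto
qed

lemma Ck_mult:
  assumes "open U" "Ck k U f" "Ck k U g"
  shows "Ck k U (\<lambda>x. f x * g x)"
  using assms(2,3)
proof (induction k arbitrary: f g)
  case 0
  then show ?case by (auto intro: continuous_on_mult)
next
  case (Suc k)
  have "Ck k U (pderiv3 (\<lambda>x. f x * g x) i)" for i
  proof (rule Ck_cong[OF assms(1)])
    show "Ck k U (\<lambda>x. f x * pderiv3 g i x + pderiv3 f i x * g x)"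
      using Suc.prems Ck_SucD[OF Suc.prems(1)] Ck_SucD[OF Suc.prems(2)]
      by (intro Ck_add assms(1) Suc.IH) auto
    show "f x * pderiv3 g i x + pderiv3 f i x * g x = pderiv3 (\<lambda>x. f x * g x) i x" if "x \<in> U" for x
      using Suc.prems that unfolding pderiv3_eq_dd
      by (intro dd_eqI[symmetric] has_derivative_mult has_derivative_dd) auto
  qed
  then show ?case using Suc.prems by (auto intro!: differentiable_mult)
qed

lemma Ck_minus: "open U \<Longrightarrow> Ck k U f \<Longrightarrow> Ck k U (\<lambda>x. - f x)"
  using Ck_mult[of U k "\<lambda>x. -1" f] by simp

lemma Ck_diff: "open U \<Longrightarrow> Ck k U f \<Longrightarrow> Ck k U g \<Longrightarrow> Ck k U (\<lambda>x. f x - g x)"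
  using Ck_add[of U k f "\<lambda>x. - g x"] Ck_minus by simp

lemma Ck_sum:
  "open U \<Longrightarrow> (\<And>i. i \<in> I \<Longrightarrow> Ck k U (f i)) \<Longrightarrow> Ck k U (\<lambda>x. \<Sum>i\<in>I. f i x)"
  by (induction I rule: infinite_finite_induct) (auto intro: Ck_add)

text \<open>The derivative of 1/f contains 1/f again, but with one order of smoothness less to
  prove, so an induction on \<open>k\<close> with \<open>f\<close> fixed suffices.\<close>

lemma Ck_inverse:
  assumes "open U" "Ck k U f" "\<And>x. x \<in> U \<Longrightarrow> f x \<noteq> 0"
  shows "Ck k U (\<lambda>x. inverse (f x))"
  using assms(2)
proof (induction k)
  case 0
  then show ?case using assms(3) by (auto intro: continuous_on_inverse)
next
  case (Suc k)
  have IH: "Ck k U (\<lambda>x. inverse (f x))"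
    using Suc.IH Ck_SucD[OF Suc.prems] by simp
  have "Ck k U (pderiv3 (\<lambda>x. inverse (f x)) i)" for i
  proof (rule Ck_cong[OF assms(1)])
    show "Ck k U (\<lambda>x. - (inverse (f x) * pderiv3 f i x * inverse (f x)))"
      using Suc.prems by (intro Ck_minus Ck_mult assms(1) IH) auto
    show "- (inverse (f x) * pderiv3 f i x * inverse (f x)) = pderiv3 (\<lambda>x. inverse (f x)) i x"
      if "x \<in> U" for x
      using Suc.prems that assms(3) unfolding pderiv3_eq_dd
      by (intro dd_eqI[symmetric] Deriv.has_derivative_inverse has_derivative_dd) auto
  qed
  then show ?case using Suc.prems assms(3) by (auto intro!: differentiable_inverse)
qed

lemma Ck_divide:
  "open U \<Longrightarrow> Ck k U f \<Longrightarrow> Ck k U g \<Longrightarrow> (\<And>x. x \<in> U \<Longrightarrow> g x \<noteq> 0) \<Longrightarrow> Ck k U (\<lambda>x. f x / g x)"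
  unfolding divide_inverse by (intro Ck_mult Ck_inverse) auto

lemma has_derivative_vec3:
  fixes g :: "real^3 \<Rightarrow> real^3"
  assumes "\<And>j. (\<lambda>x. g x $ j) differentiable (at x)"
  shows "(g has_derivative (\<lambda>v. \<chi> j. dd v (\<lambda>x. g x $ j) x)) (at x)"
proof (subst has_derivative_componentwise_within, intro ballI)
  fix b :: "real^3" assume "b \<in> Basis"
  then obtain j where b: "b = axis j 1" by (auto simp: Basis_vec_def)
  show "((\<lambda>x. g x \<bullet> b) has_derivative (\<lambda>v. (\<chi> j. dd v (\<lambda>x. g x $ j) x) \<bullet> b)) (at x)"
    unfolding b inner_axis using has_derivative_dd[OF assms, of j] by simp
qed

text \<open>Induction on \<open>k\<close> with \<open>f\<close> arbitrary and \<open>g\<close>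
  fixed: by the chain rule a partial derivative consists of partials of \<open>g\<close> times
  compositions of \<open>pderiv3 f j\<close> with \<open>g\<close>, to which the induction
  hypothesis applies.\<close>

lemma Ck_compose:
  fixes g :: "real^3 \<Rightarrow> real^3"
  assumes "open U" "open V" "Ck k V f" "\<And>j. Ck k U (\<lambda>x. g x $ j)" "g ` U \<subseteq> V"
  shows "Ck k U (\<lambda>x. f (g x))"
  using assms(3,4)
proof (induction k arbitrary: f)
  case 0
  have "continuous_on U g"
    using 0 continuous_on_componentwise[of U g] by (auto simp: Basis_vec_def inner_axis)
  then show ?case using 0 continuous_on_compose2 assms(5) by fastforce
next
  case (Suc k)
  have fd: "f differentiable (at (g x))" if "x \<in> U" for x
    using that Suc.prems assms(5) by auto
  have gd: "(g has_derivative (\<lambda>v. \<chi> j. dd v (\<lambda>x. g x $ j) x)) (at x)" if "x \<in> U" for x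
    using that Suc.prems by (intro has_derivative_vec3) auto
  have fg: "((\<lambda>x. f (g x)) has_derivative (\<lambda>v. dd (\<chi> j. dd v (\<lambda>x. g x $ j) x) f (g x))) (at x)"
    if "x \<in> U" for x
    using has_derivative_compose[OF gd[OF that] has_derivative_dd[OF fd[OF that]]] .
  have "Ck k U (pderiv3 (\<lambda>x. f (g x)) i)" for i
  proof (rule Ck_cong[OF assms(1)])
    show "Ck k U (\<lambda>x. \<Sum>j\<in>UNIV. pderiv3 (\<lambda>x. g x $ j) i x * pderiv3 f j (g x))"
    proof (intro Ck_sum Ck_mult assms(1))
      fix j
      show "Ck k U (pderiv3 (\<lambda>x. g x $ j) i)" using Suc.prems by auto
      show "Ck k U (\<lambda>x. pderiv3 f j (g x))"
        using Suc.prems Ck_SucD[OF Suc.prems(2)] by (intro Suc.IH[of "pderiv3 f j"]) auto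
    qed
    show "(\<Sum>j\<in>UNIV. pderiv3 (\<lambda>x. g x $ j) i x * pderiv3 f j (g x)) = pderiv3 (\<lambda>x. f (g x)) i x"
      if "x \<in> U" for x
      unfolding pderiv3_eq_dd[of "\<lambda>x. f (g x)"] dd_eqI[OF fg[OF that]] dd_expand[OF fd[OF that]]
      by (simp add: pderiv3_eq_dd)
  qed
  moreover have "(\<lambda>x. f (g x)) differentiable (at x)" if "x \<in> U" for x
    using fg[OF that] by (rule differentiableI)
  ultimately show ?case by auto
qed

lemma Ck_dd:
  assumes "open U" "Ck (Suc k) U f"
  shows "Ck k U (dd v f)"
proof (rule Ck_cong[OF assms(1)])
  show "Ck k U (\<lambda>x. \<Sum>i\<in>UNIV. v$i * pderiv3 f i x)"
    using assms by (intro Ck_sum Ck_mult) auto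
  show "(\<Sum>i\<in>UNIV. v$i * pderiv3 f i x) = dd v f x" if "x \<in> U" for x
    using assms that by (simp add: dd_expand)
qed

lemma Ck_det:
  fixes M :: "real^3 \<Rightarrow> real^3^3"
  assumes "open U" "\<And>i j. Ck k U (\<lambda>x. M x $ i $ j)"
  shows "Ck k U (\<lambda>x. det (M x))"
  unfolding det_3 by (intro Ck_add Ck_diff Ck_mult assms)

section \<open>Regularity of local inverses\<close>

definition jac3 :: "(real^3 \<Rightarrow> real^3) \<Rightarrow> real^3 \<Rightarrow> real^3^3" where
  "jac3 G y = (\<chi> i j. pderiv3 (\<lambda>y. G y $ i) j y)"

lemma has_derivative_jac3:
  fixes G :: "real^3 \<Rightarrow> real^3"
  assumes "\<And>j. (\<lambda>x. G x $ j) differentiable (at x)"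
  shows "(G has_derivative (\<lambda>v. jac3 G x *v v)) (at x)"
proof -
  have "(\<chi> j. dd v (\<lambda>x. G x $ j) x) = jac3 G x *v v" for v
    using assms by (simp add: vec_eq_iff jac3_def matrix_vector_mult_def dd_expand mult.commute)
  then show ?thesis using has_derivative_vec3[OF assms] by simp
qed

lemma matrix_inv_inverse:
  assumes "invertible A"
  shows "matrix_inv A ** A = mat 1" "A ** matrix_inv A = mat 1"
  using someI_ex[OF assms[unfolded invertible_def]] unfolding matrix_inv_def by auto

text \<open>Bootstrapping: the derivative of \<open>g\<close> is the inverse Jacobian of
  \<open>G\<close> taken at \<open>g\<close>, so class j of \<open>g\<close> improves itself to j +
  1 as long as \<open>G\<close> is smooth enough. Continuity of \<open>g\<close> starts the
  induction.\<close>

lemma Ck_inverse_function: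
  fixes G g :: "real^3 \<Rightarrow> real^3"
  assumes "open U" "open V" "\<And>i. Ck (Suc k) U (\<lambda>y. G y $ i)"
    and inv: "\<And>y. y \<in> U \<Longrightarrow> det (jac3 G y) \<noteq> 0"
    and "g ` V \<subseteq> U" "continuous_on V g" "\<And>z. z \<in> V \<Longrightarrow> G (g z) = z"
  shows "\<And>i. Ck (Suc k) V (\<lambda>z. g z $ i)"
    and "\<And>z. z \<in> V \<Longrightarrow> (g has_derivative (\<lambda>v. matrix_inv (jac3 G (g z)) *v v)) (at z)"
proof -
  have der: "(g has_derivative (\<lambda>v. matrix_inv (jac3 G (g z)) *v v)) (at z)" if "z \<in> V" for z
  proof (rule has_derivative_inverse_basic)
    have gz: "g z \<in> U" using that assms(5) by auto
    show "(G has_derivative (\<lambda>v. jac3 G (g z) *v v)) (at (g z))"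
      using assms(3) gz by (intro has_derivative_jac3) auto
    show "bounded_linear (\<lambda>v. matrix_inv (jac3 G (g z)) *v v)" by (simp add: matrix_vector_mul_bounded_linear)
    have "invertible (jac3 G (g z))" using inv[OF gz] by (simp add: invertible_det_nz)
    then have "matrix_inv (jac3 G (g z)) ** jac3 G (g z) = mat 1" by (rule matrix_inv_inverse(1))
    then show "(\<lambda>v. matrix_inv (jac3 G (g z)) *v v) \<circ> (\<lambda>v. jac3 G (g z) *v v) = id"
      by (simp add: fun_eq_iff matrix_vector_mul_assoc)
    show "continuous (at z) g" using assms(2,6) that by (simp add: continuous_on_eq_continuous_at)
  qed (use assms that in auto)
  then show "\<And>z. z \<in> V \<Longrightarrow> (g has_derivative (\<lambda>v. matrix_inv (jac3 G (g z)) *v v)) (at z)" .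
  \<comment> \<open>Entry (m, n) of the inverse Jacobian by Cramer's rule. Being a quotient of
    determinants, it falls under the closure rules for \<open>Ck\<close>, which do not speak about
    \<open>matrix_inv\<close>.\<close>
  let ?c = "\<lambda>m n y. det (\<chi> i j. if j = m then (axis n 1 :: real^3) $ i else jac3 G y $ i $ j) / det (jac3 G y)"
  have pd: "pderiv3 (\<lambda>z. g z $ m) n z = ?c m n (g z)" if "z \<in> V" for z m n
  proof -
    have gz: "g z \<in> U" using that assms(5) by auto
    have "((\<lambda>z. g z $ m) has_derivative (\<lambda>v. (matrix_inv (jac3 G (g z)) *v v) $ m)) (at z)"
      by (rule bounded_linear.has_derivative[OF bounded_linear_vec_nth der[OF that]])
    then have 1: "pderiv3 (\<lambda>z. g z $ m) n z = (matrix_inv (jac3 G (g z)) *v axis n 1) $ m"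
      unfolding pderiv3_eq_dd by (rule dd_eqI)
    have "invertible (jac3 G (g z))" using inv[OF gz] by (simp add: invertible_det_nz)
    then have "jac3 G (g z) *v (matrix_inv (jac3 G (g z)) *v axis n 1) = axis n 1"
      by (simp add: matrix_vector_mul_assoc matrix_inv_inverse(2))
    then have "matrix_inv (jac3 G (g z)) *v axis n 1 =
        (\<chi> k. det (\<chi> i j. if j = k then (axis n 1 :: real^3) $ i else jac3 G (g z) $ i $ j) / det (jac3 G (g z)))"
      by (subst (asm) cramer[OF inv[OF gz]])
    then show ?thesis unfolding 1 by simp
  qed
  have main: "j \<le> Suc k \<Longrightarrow> Ck j V (\<lambda>z. g z $ i)" for j i
  proof (induction j arbitrary: i)
    case 0
    then show ?case using assms(6) by (auto intro: continuous_intros)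
  next
    case (Suc j)
    have jC: "Ck j U (\<lambda>y. jac3 G y $ m $ n)" for m n
      using assms(3)[of m] Suc.prems unfolding jac3_def by (auto intro: Ck_mono)
    have c: "Ck j U (?c m n)" for m n
    proof (intro Ck_divide Ck_det assms(1))
      fix i l show "Ck j U (\<lambda>y. (\<chi> i l. if l = m then (axis n 1 :: real^3) $ i else jac3 G y $ i $ l) $ i $ l)"
        using jC by (cases "l = m") auto
    qed (use inv jC in auto)
    have "Ck j V (pderiv3 (\<lambda>z. g z $ i) n)" for n
    proof (rule Ck_cong[OF assms(2)])
      show "Ck j V (\<lambda>z. ?c i n (g z))"
        by (rule Ck_compose[OF assms(2,1) c _ assms(5)]) (use Suc in auto)
    qed (simp add: pd)
    moreover have "(\<lambda>z. g z $ i) differentiable (at z)" if "z \<in> V" for z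
      using bounded_linear.has_derivative[OF bounded_linear_vec_nth der[OF that]] by (rule differentiableI)
    ultimately show ?case by auto
  qed
  show "\<And>i. Ck (Suc k) V (\<lambda>z. g z $ i)" using main by blast
qed

section \<open>Second-order jets along lines\<close>

lemma has_real_derivative_line:
  assumes "f differentiable (at (x + t *\<^sub>R e))"
  shows "((\<lambda>t. f (x + t *\<^sub>R e)) has_real_derivative dd e f (x + t *\<^sub>R e)) (at t)"
proof -
  have "((\<lambda>t. x + t *\<^sub>R e) has_derivative (\<lambda>s. s *\<^sub>R e)) (at t)"
    by (auto intro!: derivative_eq_intros)
  from has_derivative_compose[OF this has_derivative_dd[OF assms]]
  have "((\<lambda>t. f (x + t *\<^sub>R e)) has_derivative (\<lambda>s. dd (s *\<^sub>R e) f (x + t *\<^sub>R e))) (at t)" .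
  then show ?thesis
    using linear_cmul[OF linear_dd[OF assms]] by (simp add: has_field_derivative_def mult_commute_abs)
qed

text \<open>The mean value theorem is applied twice: in direction \<open>b\<close> to the increment
  along \<open>a\<close>, then in direction \<open>a\<close> to \<open>dd b f\<close>. The left side
  is symmetric in \<open>a\<close> and \<open>b\<close>, which is how the symmetry of mixed
  derivatives arises.\<close>

lemma second_difference_dd:
  assumes "Ck 2 U f" "s > 0"
    and U: "\<And>\<eta> \<xi>. 0 \<le> \<eta> \<Longrightarrow> \<eta> \<le> s \<Longrightarrow> 0 \<le> \<xi> \<Longrightarrow> \<xi> \<le> s \<Longrightarrow> x + \<eta> *\<^sub>R a + \<xi> *\<^sub>R b \<in> U"
    and "open U"
  obtains \<eta> \<xi> where "0 < \<eta>" "\<eta> < s" "0 < \<xi>" "\<xi> < s"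
    "f (x + s *\<^sub>R a + s *\<^sub>R b) - f (x + s *\<^sub>R a) - f (x + s *\<^sub>R b) + f x =
      s\<^sup>2 * dd a (dd b f) (x + \<eta> *\<^sub>R a + \<xi> *\<^sub>R b)"
proof -
  have f: "\<And>y. y \<in> U \<Longrightarrow> f differentiable (at y)"
    using assms(1) by (simp add: numeral_2_eq_2)
  have "Ck 1 U (dd b f)" using assms(1,4) by (intro Ck_dd) (simp_all add: numeral_2_eq_2)
  then have f': "\<And>y. y \<in> U \<Longrightarrow> dd b f differentiable (at y)" by simp
  define g where "g t = f (x + s *\<^sub>R a + t *\<^sub>R b) - f (x + t *\<^sub>R b)" for t
  have "(g has_real_derivative dd b f (x + s *\<^sub>R a + t *\<^sub>R b) - dd b f (x + t *\<^sub>R b)) (at t)"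
    if "0 \<le> t" "t \<le> s" for t
    unfolding g_def using U[of s t] U[of 0 t] that assms(2)
    by (intro DERIV_diff has_real_derivative_line f) auto
  then obtain \<xi> where \<xi>: "0 < \<xi>" "\<xi> < s"
    "g s - g 0 = (s - 0) * (dd b f (x + s *\<^sub>R a + \<xi> *\<^sub>R b) - dd b f (x + \<xi> *\<^sub>R b))"
    using MVT2[OF assms(2), of g "\<lambda>t. dd b f (x + s *\<^sub>R a + t *\<^sub>R b) - dd b f (x + t *\<^sub>R b)"] by blast
  have "((\<lambda>t. dd b f ((x + \<xi> *\<^sub>R b) + t *\<^sub>R a)) has_real_derivative
      dd a (dd b f) ((x + \<xi> *\<^sub>R b) + t *\<^sub>R a)) (at t)" if "0 \<le> t" "t \<le> s" for t
    using U[of t \<xi>] that \<xi> by (intro has_real_derivative_line f') (auto simp: algebra_simps)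
  then obtain \<eta> where \<eta>: "0 < \<eta>" "\<eta> < s"
    "dd b f ((x + \<xi> *\<^sub>R b) + s *\<^sub>R a) - dd b f ((x + \<xi> *\<^sub>R b) + 0 *\<^sub>R a) =
      (s - 0) * dd a (dd b f) ((x + \<xi> *\<^sub>R b) + \<eta> *\<^sub>R a)"
    using MVT2[OF assms(2), of "\<lambda>t. dd b f ((x + \<xi> *\<^sub>R b) + t *\<^sub>R a)"
        "\<lambda>t. dd a (dd b f) ((x + \<xi> *\<^sub>R b) + t *\<^sub>R a)"] by blast
  have c: "(x + \<xi> *\<^sub>R b) + t *\<^sub>R a = x + t *\<^sub>R a + \<xi> *\<^sub>R b" for t by simp
  show thesis
    using \<xi> \<eta> by (intro that[of \<eta> \<xi>]) (auto simp: g_def power2_eq_square c)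
qed

lemma dd_swap:
  assumes "open U" "Ck 2 U f" "x \<in> U"
  shows "dd a (dd b f) x = dd b (dd a f) x"
proof (rule ccontr)
  let ?p = "dd a (dd b f)" and ?q = "dd b (dd a f)"
  assume ne: "?p x \<noteq> ?q x"
  define e where "e = \<bar>?p x - ?q x\<bar> / 2"
  have e: "e > 0" using ne by (simp add: e_def)
  have "Ck (Suc 1) U f" using assms(2) by (simp add: numeral_2_eq_2)
  then have "Ck 0 U (dd v (dd w f))" for v w
    by (intro Ck_dd assms(1)) auto
  then have "isCont ?p x" "isCont ?q x"
    using assms(1,3) by (auto simp: continuous_on_eq_continuous_at)
  then have "\<exists>d>0. \<forall>z. dist z x < d \<longrightarrow> dist (?p z) (?p x) < e"
    "\<exists>d>0. \<forall>z. dist z x < d \<longrightarrow> dist (?q z) (?q x) < e"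
    using e unfolding continuous_within_eps_delta by auto
  then obtain d1 d2 where d: "d1 > 0" "\<And>z. dist z x < d1 \<Longrightarrow> dist (?p z) (?p x) < e"
    "d2 > 0" "\<And>z. dist z x < d2 \<Longrightarrow> dist (?q z) (?q x) < e"
    by auto
  obtain d3 where d3: "d3 > 0" "ball x d3 \<subseteq> U" using assms(1,3) open_contains_ball by metis
  define d where "d = min d1 (min d2 d3)"
  have d0: "d > 0" using d d3 by (simp add: d_def)
  \<comment> \<open>Small enough that the parallelogram spanned at \<open>x\<close> by s a and s b
    stays within distance \<open>d\<close>; the summand 1 keeps the denominator positive when both
    directions are zero.\<close>
  define s where "s = d / (norm a + norm b + 1)"
  have s: "s > 0" using d0 by (simp add: s_def add_nonneg_pos)
  have near: "dist (x + \<eta> *\<^sub>R v + \<xi> *\<^sub>R w) x < d"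
    if "0 \<le> \<eta>" "\<eta> \<le> s" "0 \<le> \<xi>" "\<xi> \<le> s" "norm v + norm w = norm a + norm b" for \<eta> \<xi> v w
  proof -
    have "dist (x + \<eta> *\<^sub>R v + \<xi> *\<^sub>R w) x = norm (\<eta> *\<^sub>R v + \<xi> *\<^sub>R w)" by (simp add: dist_norm)
    also have "\<dots> \<le> \<eta> * norm v + \<xi> * norm w"
      using norm_triangle_ineq[of "\<eta> *\<^sub>R v" "\<xi> *\<^sub>R w"] that by simp
    also have "\<dots> \<le> s * norm v + s * norm w"
      using that by (intro add_mono mult_right_mono) auto
    also have "\<dots> = s * (norm a + norm b)" using that by (simp add: distrib_left flip: that(5))
    also have "\<dots> < s * (norm a + norm b + 1)" using s by simp
    also have "\<dots> = d" unfolding s_def by (simp add: add_nonneg_pos less_imp_neq[symmetric])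
    finally show ?thesis .
  qed
  have inU: "z \<in> U" if "dist z x < d" for z
    using that d3 by (auto simp: d_def dist_commute)
  obtain \<eta> \<xi> where 1: "0 < \<eta>" "\<eta> < s" "0 < \<xi>" "\<xi> < s"
    "f (x + s *\<^sub>R a + s *\<^sub>R b) - f (x + s *\<^sub>R a) - f (x + s *\<^sub>R b) + f x =
      s\<^sup>2 * ?p (x + \<eta> *\<^sub>R a + \<xi> *\<^sub>R b)"
    using second_difference_dd[OF assms(2) s _ assms(1), of x a b] near inU by metis
  obtain \<eta>' \<xi>' where 2: "0 < \<eta>'" "\<eta>' < s" "0 < \<xi>'" "\<xi>' < s"
    "f (x + s *\<^sub>R b + s *\<^sub>R a) - f (x + s *\<^sub>R b) - f (x + s *\<^sub>R a) + f x =
      s\<^sup>2 * ?q (x + \<eta>' *\<^sub>R b + \<xi>' *\<^sub>R a)"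
    using second_difference_dd[OF assms(2) s _ assms(1), of x b a] near inU by (metis add.commute)
  have c: "x + s *\<^sub>R b + s *\<^sub>R a = x + s *\<^sub>R a + s *\<^sub>R b" by simp
  have "s\<^sup>2 * ?p (x + \<eta> *\<^sub>R a + \<xi> *\<^sub>R b) = s\<^sup>2 * ?q (x + \<eta>' *\<^sub>R b + \<xi>' *\<^sub>R a)"
    using 1(5) 2(5) unfolding c by linarith
  then have eq: "?p (x + \<eta> *\<^sub>R a + \<xi> *\<^sub>R b) = ?q (x + \<eta>' *\<^sub>R b + \<xi>' *\<^sub>R a)"
    using s by simp
  have "dist (?p (x + \<eta> *\<^sub>R a + \<xi> *\<^sub>R b)) (?p x) < e"
    using d(2) near[of \<eta> \<xi> a b] 1 by (simp add: d_def)
  moreover have "dist (?q (x + \<eta>' *\<^sub>R b + \<xi>' *\<^sub>R a)) (?q x) < e"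
    using d(4) near[of \<eta>' \<xi>' b a] 2 by (simp add: d_def)
  ultimately show False
    using dist_triangle_half_r[of _ "?p x" "2 * e" "?q x"] unfolding eq e_def by (simp add: dist_real_def)
qed

text \<open>A 2-jet at 0 as a relation with explicit values, so that second-order expansions become
  arithmetic on triples. A derivative near 0 that is itself differentiable at 0 is all that the
  second derivative test needs.\<close>

definition jet2 :: "(real \<Rightarrow> real) \<Rightarrow> real \<Rightarrow> real \<Rightarrow> real \<Rightarrow> bool" where
  "jet2 f f0 f1 f2 \<longleftrightarrow> f 0 = f0 \<and> (\<exists>f'. (\<forall>\<^sub>F t in nhds 0. (f has_real_derivative f' t) (at t)) \<and>
     f' 0 = f1 \<and> (f' has_real_derivative f2) (at 0))"

lemma jet2_value: "jet2 f f0 f1 f2 \<Longrightarrow> f 0 = f0"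
  by (simp add: jet2_def)

lemma jet2_eqI:
  "jet2 f f0 f1 f2 \<Longrightarrow> g0 = f0 \<Longrightarrow> g1 = f1 \<Longrightarrow> g2 = f2 \<Longrightarrow> jet2 f g0 g1 g2"
  by simp

lemma jet2_const [simp]: "jet2 (\<lambda>t. c) c 0 0"
  unfolding jet2_def by (auto intro!: exI[of _ "\<lambda>t. 0"] always_eventually)

lemma jet2_ident [simp]: "jet2 (\<lambda>t. t) 0 1 0"
  unfolding jet2_def by (auto intro!: exI[of _ "\<lambda>t. 1"] always_eventually)

lemma jet2_add:
  assumes "jet2 f f0 f1 f2" "jet2 g g0 g1 g2"
  shows "jet2 (\<lambda>t. f t + g t) (f0 + g0) (f1 + g1) (f2 + g2)"
proof -
  from assms obtain f' g' where *: "f 0 = f0" "g 0 = g0" "f' 0 = f1" "g' 0 = g1"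
    "\<forall>\<^sub>F t in nhds 0. (f has_real_derivative f' t) (at t)" "(f' has_real_derivative f2) (at 0)"
    "\<forall>\<^sub>F t in nhds 0. (g has_real_derivative g' t) (at t)" "(g' has_real_derivative g2) (at 0)"
    unfolding jet2_def by blast
  show ?thesis unfolding jet2_def
    using * eventually_elim2[OF *(5,7), of "\<lambda>t. ((\<lambda>t. f t + g t) has_real_derivative f' t + g' t) (at t)"]
    by (auto intro!: exI[of _ "\<lambda>t. f' t + g' t"] DERIV_add)
qed

lemma jet2_mult:
  assumes "jet2 f f0 f1 f2" "jet2 g g0 g1 g2"
  shows "jet2 (\<lambda>t. f t * g t) (f0 * g0) (f1 * g0 + f0 * g1) (f2 * g0 + 2 * f1 * g1 + f0 * g2)"
proof -
  from assms obtain f' g' where *: "f 0 = f0" "g 0 = g0" "f' 0 = f1" "g' 0 = g1"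
    "\<forall>\<^sub>F t in nhds 0. (f has_real_derivative f' t) (at t)" "(f' has_real_derivative f2) (at 0)"
    "\<forall>\<^sub>F t in nhds 0. (g has_real_derivative g' t) (at t)" "(g' has_real_derivative g2) (at 0)"
    unfolding jet2_def by blast
  have **: "(f has_real_derivative f1) (at 0)" "(g has_real_derivative g1) (at 0)"
    using eventually_nhds_x_imp_x[OF *(5)] eventually_nhds_x_imp_x[OF *(7)] *(3,4) by auto
  have "\<forall>\<^sub>F t in nhds 0. ((\<lambda>t. f t * g t) has_real_derivative f' t * g t + g' t * f t) (at t)"
    using *(5,7) by (rule eventually_elim2) (rule DERIV_mult)
  moreover have "((\<lambda>t. f' t * g t + g' t * f t) has_real_derivative
     f2 * g0 + 2 * f1 * g1 + f0 * g2) (at 0)"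
    using DERIV_add[OF DERIV_mult[OF *(6) **(2)] DERIV_mult[OF *(8) **(1)]] *(1-4)
    by (simp add: algebra_simps)
  ultimately show ?thesis
    using * unfolding jet2_def by (auto intro!: exI[of _ "\<lambda>t. f' t * g t + g' t * f t"] simp: mult.commute)
qed

lemma jet2_compose:
  assumes "jet2 f f0 f1 f2" "open S" "f0 \<in> S"
    and F: "\<And>y. y \<in> S \<Longrightarrow> (F has_real_derivative F' y) (at y)"
    and F': "(F' has_real_derivative F2) (at f0)"
  shows "jet2 (\<lambda>t. F (f t)) (F f0) (F' f0 * f1) (F2 * f1\<^sup>2 + F' f0 * f2)"
proof -
  from assms obtain f' where *: "f 0 = f0" "f' 0 = f1"
    "\<forall>\<^sub>F t in nhds 0. (f has_real_derivative f' t) (at t)" "(f' has_real_derivative f2) (at 0)"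
    unfolding jet2_def by blast
  have f: "(f has_real_derivative f1) (at 0)"
    using eventually_nhds_x_imp_x[OF *(3)] *(2) by auto
  have "(f \<longlongrightarrow> f0) (nhds 0)"
    using DERIV_isCont[OF f, unfolded isCont_def tendsto_at_iff_tendsto_nhds] * by simp
  then have "\<forall>\<^sub>F t in nhds 0. f t \<in> S" using assms(2,3) topological_tendstoD by blast
  with *(3) have "\<forall>\<^sub>F t in nhds 0. ((\<lambda>t. F (f t)) has_real_derivative F' (f t) * f' t) (at t)"
    by (rule eventually_elim2) (rule DERIV_chain2[OF F])
  moreover have "((\<lambda>t. F' (f t) * f' t) has_real_derivative F2 * f1\<^sup>2 + F' f0 * f2) (at 0)"
    using DERIV_mult[OF DERIV_chain2[of F' F2 f 0, OF _ f] *(4)] F' *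
    by (simp add: power2_eq_square mult.commute mult.left_commute)
  ultimately show ?thesis
    using * unfolding jet2_def by (auto intro!: exI[of _ "\<lambda>t. F' (f t) * f' t"])
qed

lemma jet2_exp:
  "jet2 f f0 f1 f2 \<Longrightarrow> jet2 (\<lambda>t. exp (f t)) (exp f0) (exp f0 * f1) (exp f0 * f1\<^sup>2 + exp f0 * f2)"
  by (rule jet2_compose[where S = UNIV]) auto

lemma jet2_powr:
  assumes "jet2 f f0 f1 f2" "f0 > 0"
  shows "jet2 (\<lambda>t. f t powr c) (f0 powr c) (c * f0 powr (c - 1) * f1)
    (c * ((c - 1) * f0 powr (c - 2)) * f1\<^sup>2 + c * f0 powr (c - 1) * f2)"
proof (rule jet2_compose[where S = "{0<..}"])
  show "((\<lambda>y. y powr c) has_real_derivative c * y powr (c - 1)) (at y)" if "y \<in> {0<..}" for y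
    using that by (auto intro!: derivative_eq_intros)
  show "((\<lambda>y. c * y powr (c - 1)) has_real_derivative c * ((c - 1) * f0 powr (c - 2))) (at f0)"
    using assms(2) by (auto intro!: derivative_eq_intros)
qed (use assms in auto)

text \<open>This is how an identity is differentiated twice: the jets of its two sides, computed
  separately by the rules above, must agree.\<close>

lemma jet2_unique:
  assumes "jet2 f f0 f1 f2" "jet2 f g0 g1 g2"
  shows "f0 = g0" "f1 = g1" "f2 = g2"
proof -
  from assms obtain f' g' where *: "f 0 = f0" "f 0 = g0" "f' 0 = f1" "g' 0 = g1"
    "\<forall>\<^sub>F t in nhds 0. (f has_real_derivative f' t) (at t)" "(f' has_real_derivative f2) (at 0)"
    "\<forall>\<^sub>F t in nhds 0. (f has_real_derivative g' t) (at t)" "(g' has_real_derivative g2) (at 0)"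
    unfolding jet2_def by blast
  have ev: "\<forall>\<^sub>F t in nhds 0. f' t = g' t"
    using *(5,7) by (rule eventually_elim2) (rule DERIV_unique)
  show "f0 = g0" using * by simp
  show "f1 = g1" using eventually_nhds_x_imp_x[OF ev] * by simp
  show "f2 = g2" using DERIV_cong_ev[OF refl ev refl] *(6,8) DERIV_unique by blast
qed

text \<open>If \<open>f2\<close> were positive, the first derivative would be positive just to the
  right of 0, and the mean value theorem would produce a value above \<open>f 0\<close>.\<close>

lemma jet2_max:
  assumes "jet2 f f0 f1 f2" "\<And>t. f t \<le> f 0"
  shows "f1 = 0" "f2 \<le> 0"
proof -
  from assms obtain f' where *: "f' 0 = f1"
    "\<forall>\<^sub>F t in nhds 0. (f has_real_derivative f' t) (at t)" "(f' has_real_derivative f2) (at 0)"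
    unfolding jet2_def by blast
  have f: "(f has_real_derivative f1) (at 0)"
    using eventually_nhds_x_imp_x[OF *(2)] *(1) by auto
  show f1: "f1 = 0"
    using DERIV_local_max[OF f, of 1] assms(2) by auto
  show "f2 \<le> 0"
  proof (rule ccontr)
    assume "\<not> f2 \<le> 0"
    then obtain d where d: "d > 0" "\<And>t. 0 < t \<Longrightarrow> t < d \<Longrightarrow> f' t > 0"
      using DERIV_pos_inc_right[OF *(3)] *(1) f1 by auto
    from *(2) obtain d' where d': "d' > 0" "\<And>t. dist t 0 < d' \<Longrightarrow> (f has_real_derivative f' t) (at t)"
      unfolding eventually_nhds_metric by blast
    define s where "s = min d d' / 2"
    have s: "0 < s" "s < d" "s < d'" using d d' by (auto simp: s_def)
    have "\<exists>z. 0 < z \<and> z < s \<and> f s - f 0 = (s - 0) * f' z"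
      using s d' by (intro MVT2) auto
    then obtain z where "0 < z" "z < s" "f s - f 0 = s * f' z" by auto
    then have "f s - f 0 > 0" using s d(2)[of z] by simp
    then show False using assms(2)[of s] by simp
  qed
qed

section \<open>The inequality at a maximum point\<close>

text \<open>
  Here \<open>r1 \<ge> r2\<close> are the principal radii and indices denote derivatives in the principal directions.
  The optimal rotation speed would be \<open>\<theta> = h112/(r1 - r2)\<close>, which is unbounded near umbilic points;
  enlarging the denominator by \<open>(1 - b) r1\<close> loses little and keeps the estimate uniform.
\<close>

lemma maximum_condition_reduction:
  fixes u r1 r2 u1 u2 h111 h112 h122 h222 h1111 h1122 \<eta>1 \<eta>2 z1 z2 a b :: real
  assumes a: "a = 2 - 2*b" and b: "0 \<le> b" "b < 1" and pos: "u > 0" "r2 > 0" "r2 \<le> r1"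
    and fo1: "u*h111 = (b - 1)*u1*r1 - \<eta>1"
    and fo2: "u*h112 = (b*r2 - r1)*u2 - \<eta>2"
    and so1: "\<And>\<theta>. 2*u*r1 + r1\<^sup>2 + 2*u1*h111 + u*h1111 + 4*\<theta>*u*h112 - 2*\<theta>\<^sup>2*u*(r1 - r2)
        - b*(r1\<^sup>2 + u1*h111 + u2*h112 - u*r1) + z1 \<le> 0"
    and so2: "r1*r2 + 2*u2*h112 + u*h1122 - b*(r2\<^sup>2 + u1*h122 + u2*h222 - u*r2) + z2 \<le> 0"
    and eq1: "r2*h111 + r1*h122 = - a*(r1*r2)*u1/u"
    and eq2: "r2*h112 + r1*h222 = - a*(r1*r2)*u2/u"
    and eq11: "r2*h1111 + 2*h111*h122 + r1*h1122 - 2*h112\<^sup>2 =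
        (r1*r2)*(a*(a+1)*u1\<^sup>2/u\<^sup>2 - a*r1/u + a - 4)"
  shows "u*b*(r1 - r2) + u*(z1/r1 + z2/r2) + a*u1\<^sup>2 - 2*u1*\<eta>1/r1 + (1 - b)\<^sup>2*u2\<^sup>2
      - \<bar>\<eta>2\<bar>*\<bar>u2\<bar>*(2/r2 + 4/((1 - b)*r1)) \<le> 0"
proof -
  have r1: "r1 > 0" using pos by simp
  define E where "E = \<bar>\<eta>2\<bar>*\<bar>u2\<bar>*(2/r2 + 4/((1 - b)*r1))"
  \<comment> \<open>The rotation speed \<theta> = h112/(r1 - r2 + (1 - b) r1) equals k h112/r1, with
    a scale-free \<open>k\<close> between 1/2 and 1/(1 - b). In the same spirit \<open>c\<close>
    abbreviates the factor in the first-order condition u h112 = -(c u2 + \<eta>2).\<close>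
  define k where "k = r1/(r1 - r2 + (1 - b)*r1)"
  define c where "c = r1 - b*r2"
  have den: "r1 - r2 + (1 - b)*r1 > 0" using pos b r1 by (simp add: add_nonneg_pos)
  have k: "k > 0" "k*(r1 - r2 + (1 - b)*r1) = r1" using den r1 by (simp_all add: k_def)
  have "b*r2 \<le> r2" using b pos by (simp add: mult_left_le_one_le)
  then have c: "c \<ge> 0" "c \<le> r1" using pos b r1 mult_nonneg_nonneg[of b r2] unfolding c_def by linarith+
  have kc: "k*c \<le> r1/(1 - b)"
  proof -
    have "(k*(1 - b))*c \<le> (k*(1 - b))*r1" using k c b by (intro mult_left_mono) auto
    moreover have "k*((1-b)*r1) \<le> r1" using k(2) k(1) pos(3) by (smt (verit) distrib_left mult_nonneg_nonneg)
    ultimately show ?thesis using b by (simp add: pos_le_divide_eq mult_ac)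
  qed
  \<comment> \<open>Rotation gains a term linear in \<theta> and costs a quadratic one. Since k (r1
    - r2) <= r1, the cost is at most half of the gain, and 2 k u h112^2/r1 is left over.\<close>
  have so1': "2*u*r1 + r1\<^sup>2 + 2*u1*h111 + u*h1111 + 2*k*u*h112\<^sup>2/r1
        - b*(r1\<^sup>2 + u1*h111 + u2*h112 - u*r1) + z1 \<le> 0"
  proof -
    have "k*(r1 - r2) \<le> r1" using k b r1 by (smt (verit) distrib_left mult_nonneg_nonneg)
    then have 1: "(2*k*u*h112\<^sup>2/r1\<^sup>2)*(k*(r1 - r2)) \<le> (2*k*u*h112\<^sup>2/r1\<^sup>2)*r1"
      using k pos by (intro mult_left_mono) auto
    have "2*k*u*h112\<^sup>2/r1 = 4*k*u*h112\<^sup>2/r1 - (2*k*u*h112\<^sup>2/r1\<^sup>2)*r1"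
      using r1 by (simp add: power2_eq_square)
    also have "\<dots> \<le> 4*k*u*h112\<^sup>2/r1 - (2*k*u*h112\<^sup>2/r1\<^sup>2)*(k*(r1 - r2))"
      using 1 by (rule diff_left_mono)
    also have "\<dots> = 4*(k*h112/r1)*u*h112 - 2*(k*h112/r1)\<^sup>2*u*(r1 - r2)"
      by (simp add: power2_eq_square mult_ac)
    finally have "2*k*u*h112\<^sup>2/r1 \<le> 4*(k*h112/r1)*u*h112 - 2*(k*h112/r1)\<^sup>2*u*(r1 - r2)" .
    then show ?thesis using so1[of "k*h112/r1"] by smt
  qed
  let ?X1 = "2*u*r1 + r1\<^sup>2 + 2*u1*h111 + u*h1111 + 2*k*u*h112\<^sup>2/r1
        - b*(r1\<^sup>2 + u1*h111 + u2*h112 - u*r1) + z1"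
  let ?X2 = "r1*r2 + 2*u2*h112 + u*h1122 - b*(r2\<^sup>2 + u1*h122 + u2*h222 - u*r2) + z2"
  \<comment> \<open>With the weights 1/r1 and 1/r2 of the linearised determinant the fourth
    derivatives enter as h1111/r1 + h1122/r2, the combination that the twice differentiated equation
    expresses through lower order terms.\<close>
  have sum: "u*(?X1/r1 + ?X2/r2) \<le> 0"
    using divide_nonpos_pos[OF so1' r1] divide_nonpos_pos[OF so2 pos(2)] pos(1)
    by (intro mult_nonneg_nonpos add_nonpos_nonpos) simp_all
  have h111: "h111 = ((b - 1)*u1*r1 - \<eta>1)/u" using fo1 pos by (simp add: field_simps)
  have h112: "h112 = - (c*u2 + \<eta>2)/u" using fo2 pos by (simp add: field_simps c_def)
  have h122: "h122 = r2*((b - 1)*u1 + \<eta>1/r1)/u"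
  proof -
    have "r1*h122 = - a*(r1*r2)*u1/u - r2*h111" using eq1 by simp
    then have "h122 = (- a*(r1*r2)*u1/u - r2*h111)/r1" using r1 by (simp add: field_simps)
    also have "\<dots> = r2*((b - 1)*u1 + \<eta>1/r1)/u"
      using r1 pos unfolding h111 a by (simp add: divide_simps) (simp add: algebra_simps)
    finally show ?thesis .
  qed
  have h222: "u2*h112/r1 + u2*h222/r2 = - a*u2\<^sup>2/u"
  proof -
    have "u2*h112/r1 + u2*h222/r2 = u2*(r2*h112 + r1*h222)/(r1*r2)"
      using r1 pos by (simp add: field_simps)
    then show ?thesis unfolding eq2 using r1 pos by (simp add: power2_eq_square)
  qed
  have h4: "h1111/r1 + h1122/r2 = 2*h112\<^sup>2/(r1*r2) - 2*(h111/r1)*(h122/r2)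
      + a*(a+1)*u1\<^sup>2/u\<^sup>2 - a*r1/u + a - 4"
  proof -
    have "h1111/r1 + h1122/r2 = (r2*h1111 + r1*h1122)/(r1*r2)" using r1 pos by (simp add: field_simps)
    also have "r2*h1111 + r1*h1122 = 2*h112\<^sup>2 - 2*h111*h122
        + (r1*r2)*(a*(a+1)*u1\<^sup>2/u\<^sup>2 - a*r1/u + a - 4)" using eq11 by linarith
    finally show ?thesis using r1 pos by (simp add: add_divide_distrib diff_divide_distrib)
  qed
  have split: "u*(?X1/r1 + ?X2/r2) = u*(2*u + r1 + r1 - b*(r1 + r2 - 2*u)) + u*(z1/r1 + z2/r2)
     + 2*u*u1*h111/r1 - b*u*u1*(h111/r1 + h122/r2) + 2*u*u2*h112/r2 - b*u*(u2*h112/r1 + u2*h222/r2)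
     + 2*k*u\<^sup>2*h112\<^sup>2/r1\<^sup>2 + u\<^sup>2*(h1111/r1 + h1122/r2)"
    using r1 pos by (simp add: field_simps power2_eq_square)
  \<comment> \<open>Here a = 2 - 2 b pays off: the coefficient 2 b + a - 2 of u^2 vanishes, the
    terms in u r1 and u r2 combine to u b (r1 - r2), and the coefficient a^2 + a - 4 (1 - b)^2 of
    u1^2 collapses to a.\<close>
  have "u*(?X1/r1 + ?X2/r2) = u*b*(r1 - r2) + u*(z1/r1 + z2/r2)
     + a*u1\<^sup>2 - 2*u1*\<eta>1/r1 + 2*(\<eta>1/r1)\<^sup>2
     + (a*b*u2\<^sup>2 - 2*u2*(c*u2 + \<eta>2)/r2 + 2*(c*u2 + \<eta>2)\<^sup>2/(r1*r2) + 2*k*(c*u2 + \<eta>2)\<^sup>2/r1\<^sup>2)"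
    unfolding split h222 h4 unfolding h111 h112 h122 a
    using r1 pos by (simp add: field_simps power2_eq_square)
  moreover have "a*b*u2\<^sup>2 - 2*u2*(c*u2 + \<eta>2)/r2 + 2*(c*u2 + \<eta>2)\<^sup>2/(r1*r2) + 2*k*(c*u2 + \<eta>2)\<^sup>2/r1\<^sup>2
     = (a*b - 2*b*c/r1 + 2*k*c\<^sup>2/r1\<^sup>2)*u2\<^sup>2 + \<eta>2*u2*(2/r2 - 4*b/r1 + 4*(k*c)/r1\<^sup>2)
      + (2/(r1*r2) + 2*k/r1\<^sup>2)*\<eta>2\<^sup>2"
    using r1 pos unfolding c_def by (simp add: field_simps power2_eq_square)
  moreover have "a*b - 2*b*c/r1 + 2*k*c\<^sup>2/r1\<^sup>2 \<ge> (1 - b)\<^sup>2"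
  proof -
    \<comment> \<open>In terms of the relative gap \<open>d\<close> of the radii, c/r1 = (1 - b) + b
      d and k (d + (1 - b)) = 1. Multiplying the negative term by this 1 lets \<open>k\<close> be
      factored out; what remains has nonnegative summands, and k >= 1/2 finishes.\<close>
    define d where "d = 1 - r2/r1"
    have d: "0 \<le> d" "d \<le> 1" using pos r1 by (auto simp: d_def)
    have c': "c/r1 = (1 - b) + b*d" using r1 by (simp add: c_def d_def field_simps)
    have "d + (1 - b) = (r1 - r2 + (1 - b)*r1)/r1" using r1 by (simp add: d_def field_simps)
    then have kd: "k*(d + (1 - b)) = 1" using k(2) r1 by simp
    have k2: "k \<ge> 1/2"
    proof -
      have "k*(d + (1 - b)) \<le> k*2" using k(1) d b by (intro mult_left_mono) auto
      then show ?thesis using kd by simp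
    qed
    have "a*b - 2*b*c/r1 + 2*k*c\<^sup>2/r1\<^sup>2 = a*b - 2*b*(c/r1) + 2*k*(c/r1)\<^sup>2"
      by (simp add: power_divide)
    also have "\<dots> = 2*k*((1 - b) + b*d)\<^sup>2 - 2*b\<^sup>2*d*(k*(d + (1 - b)))"
      unfolding c' kd a by (simp add: algebra_simps power2_eq_square)
    also have "\<dots> = 2*k*((1-b)\<^sup>2 + (1 - b)*b*d*(2 - b))"
      by (simp add: algebra_simps power2_eq_square)
    also have "\<dots> \<ge> 2*k*(1-b)\<^sup>2" using k(1) b d by simp
    moreover have "2*k*(1-b)\<^sup>2 \<ge> 1*(1-b)\<^sup>2" using k2 by (intro mult_right_mono) auto
    ultimately show ?thesis by simp
  qed
  then have "(a*b - 2*b*c/r1 + 2*k*c\<^sup>2/r1\<^sup>2)*u2\<^sup>2 \<ge> (1 - b)\<^sup>2*u2\<^sup>2" by (rule mult_right_mono) simp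
  moreover have "- E \<le> \<eta>2*u2*(2/r2 - 4*b/r1 + 4*(k*c)/r1\<^sup>2)"
  proof -
    have 1: "4*(k*c)/r1\<^sup>2 \<le> 4/((1 - b)*r1)"
    proof -
      have "4*(k*c)/r1\<^sup>2 \<le> 4*(r1/(1-b))/r1\<^sup>2" using kc r1 by (intro divide_right_mono) auto
      then show ?thesis using r1 by (simp add: power2_eq_square)
    qed
    have 2: "0 \<le> 4*(k*c)/r1\<^sup>2" using k c by simp
    have "b*(1-b) \<le> 1" using b by (simp add: mult_le_one)
    then have "4*b \<le> 4/(1 - b)" using b by (simp add: pos_le_divide_eq)
    then have 3: "4*b/r1 \<le> 4/((1 - b)*r1)" "0 \<le> 4*b/r1"
      using divide_right_mono[of "4*b" "4/(1 - b)" r1] b r1 by simp_all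
    have 4: "2/r2 > 0" using pos by simp
    have "\<bar>2/r2 - 4*b/r1 + 4*(k*c)/r1\<^sup>2\<bar> \<le> 2/r2 + 4/((1 - b)*r1)" using 1 2 3 4 by linarith
    then have "\<bar>\<eta>2*u2*(2/r2 - 4*b/r1 + 4*(k*c)/r1\<^sup>2)\<bar> \<le> \<bar>\<eta>2\<bar>*\<bar>u2\<bar>*(2/r2 + 4/((1 - b)*r1))"
      unfolding abs_mult by (intro mult_left_mono) auto
    from abs_le_D2[OF this] show ?thesis unfolding E_def by (subst minus_le_iff)
  qed
  moreover have "(2/(r1*r2) + 2*k/r1\<^sup>2)*\<eta>2\<^sup>2 \<ge> 0" using r1 pos k by simp
  moreover have "2*(\<eta>1/r1)\<^sup>2 \<ge> 0" by simp
  ultimately show ?thesis using sum unfolding E_def[symmetric] by linarith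
qed

section \<open>Homogeneous solutions of the curvature equation\<close>

lemma jet2_line:
  assumes "open U" "x \<in> U" "Ck 2 U g"
  shows "jet2 (\<lambda>t. g (x + t *\<^sub>R e)) (g x) (dd e g x) (dd e (dd e g) x)"
proof -
  have g: "\<And>y. y \<in> U \<Longrightarrow> g differentiable (at y)"
    using assms(3) by (simp add: numeral_2_eq_2)
  have "Ck 1 U (dd e g)" using assms(1,3) by (intro Ck_dd) (simp_all add: numeral_2_eq_2)
  then have g': "\<And>y. y \<in> U \<Longrightarrow> dd e g differentiable (at y)" by simp
  have "((\<lambda>t. x + t *\<^sub>R e) \<longlongrightarrow> x + 0 *\<^sub>R e) (nhds 0)"
    by (intro tendsto_intros filterlim_ident)
  then have "\<forall>\<^sub>F t in nhds 0. x + t *\<^sub>R e \<in> U"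
    using assms(1,2) topological_tendstoD by fastforce
  then have "\<forall>\<^sub>F t in nhds 0. ((\<lambda>t. g (x + t *\<^sub>R e)) has_real_derivative dd e g (x + t *\<^sub>R e)) (at t)"
    by (rule eventually_mono) (intro has_real_derivative_line g)
  moreover have "((\<lambda>t. dd e g (x + t *\<^sub>R e)) has_real_derivative dd e (dd e g) x) (at 0)"
    using has_real_derivative_line[of "dd e g" x 0 e] g' assms(2) by simp
  ultimately show ?thesis
    unfolding jet2_def by (auto intro!: exI[of _ "\<lambda>t. dd e g (x + t *\<^sub>R e)"])
qed

lemma dd_homogeneous:
  assumes "open U" "x \<in> U" "t *\<^sub>R x \<in> U" "f differentiable (at x)" "f differentiable (at (t *\<^sub>R x))"
    and "\<And>y. y \<in> U \<Longrightarrow> f (t *\<^sub>R y) = c * f y"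
  shows "t * dd v f (t *\<^sub>R x) = c * dd v f x"
proof -
  have "((\<lambda>y. t *\<^sub>R y) has_derivative (\<lambda>v. t *\<^sub>R v)) (at x)" by (auto intro!: derivative_eq_intros)
  from has_derivative_compose[OF this has_derivative_dd[OF assms(5)]]
  have 1: "((\<lambda>y. f (t *\<^sub>R y)) has_derivative (\<lambda>v. dd (t *\<^sub>R v) f (t *\<^sub>R x))) (at x)" .
  have "((\<lambda>y. c * f y) has_derivative (\<lambda>v. c * dd v f x)) (at x)"
    using has_derivative_dd[OF assms(4)] by (rule has_derivative_mult_right)
  then have "((\<lambda>y. f (t *\<^sub>R y)) has_derivative (\<lambda>v. c * dd v f x)) (at x)"
    by (rule has_derivative_transform_within_open[OF _ assms(1,2)]) (simp add: assms(6))
  from has_derivative_unique[OF 1 this] show ?thesis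
    using linear_cmul[OF linear_dd[OF assms(5)]] by (metis real_scaleR_def)
qed

lemma dd_eq_grad3: "f differentiable (at x) \<Longrightarrow> dd v f x = v \<bullet> grad3 f x"
  by (simp add: dd_expand grad3_def inner_vec_def)

section \<open>Orthonormal frames and homogeneous solutions\<close>

definition frame3 :: "real^3 \<Rightarrow> real^3 \<Rightarrow> real^3 \<Rightarrow> bool" where
  "frame3 x e f \<longleftrightarrow> norm x = 1 \<and> norm e = 1 \<and> norm f = 1 \<and> x \<bullet> e = 0 \<and> x \<bullet> f = 0 \<and> e \<bullet> f = 0"

lemma frame3_inner:
  assumes "frame3 x e f"
  shows "x \<bullet> x = 1" "e \<bullet> e = 1" "f \<bullet> f = 1" "x \<bullet> e = 0" "e \<bullet> x = 0" "x \<bullet> f = 0" "f \<bullet> x = 0"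
    "e \<bullet> f = 0" "f \<bullet> e = 0"
  using assms unfolding frame3_def by (auto simp: norm_eq_1 inner_commute)

lemma frame3_swap: "frame3 x e f \<Longrightarrow> frame3 x f e"
  by (auto simp: frame3_def inner_commute)

text \<open>A nonzero remainder would be orthogonal to \<open>x\<close>, \<open>e\<close> and
  \<open>f\<close>, giving four independent vectors in dimension 3.\<close>

lemma frame3_expansion:
  assumes "frame3 x e f"
  shows "v = (x \<bullet> v) *\<^sub>R x + (e \<bullet> v) *\<^sub>R e + (f \<bullet> v) *\<^sub>R f"
proof (rule ccontr)
  assume ne: "\<not> ?thesis"
  note i = frame3_inner[OF assms]
  define w where "w = v - (x \<bullet> v) *\<^sub>R x - (e \<bullet> v) *\<^sub>R e - (f \<bullet> v) *\<^sub>R f"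
  have w: "x \<bullet> w = 0" "e \<bullet> w = 0" "f \<bullet> w = 0"
    by (simp_all add: w_def inner_diff_right i)
  have w0: "w \<noteq> 0" using ne by (auto simp: w_def algebra_simps)
  let ?B = "{x, e, f, w}"
  have d: "x \<noteq> e" "x \<noteq> f" "e \<noteq> f" "w \<noteq> x" "w \<noteq> e" "w \<noteq> f" using i w by auto
  have "pairwise orthogonal ?B" using i w by (auto simp: pairwise_def orthogonal_def inner_commute)
  moreover have "0 \<notin> ?B" using i w0 by auto
  ultimately have "independent ?B" by (rule pairwise_orthogonal_independent)
  then have "card ?B \<le> 3" using independent_bound[of ?B] by simp
  moreover have "card ?B = 4" using d by (auto simp: card_insert_if)
  ultimately show False by simp
qed

lemma frame3_norm_sq:
  assumes "frame3 x e f"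
  shows "(norm v)\<^sup>2 = (x \<bullet> v)\<^sup>2 + (e \<bullet> v)\<^sup>2 + (f \<bullet> v)\<^sup>2"
proof -
  define p q r where "p = x \<bullet> v" "q = e \<bullet> v" "r = f \<bullet> v"
  have "v = p *\<^sub>R x + q *\<^sub>R e + r *\<^sub>R f" using frame3_expansion[OF assms] by (simp add: p_q_r_def)
  then have "v \<bullet> v = p\<^sup>2 + q\<^sup>2 + r\<^sup>2"
    by (simp add: inner_add_left inner_add_right frame3_inner[OF assms] power2_eq_square)
  then show ?thesis by (simp add: power2_norm_eq_inner p_q_r_def)
qed

text \<open>The analytic problem detached from the convex body. For 1-homogeneous \<open>h\<close>
  with restriction u to the sphere, the Hessian on a tangent plane is u_ij + u \<delta>_ij, so
  \<open>eqn\<close> is the prescribed curvature equation. The parameter \<open>b\<close> is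
  determined by \<open>a\<close>, and 0 < a <= 2 amounts to 0 <= b < 1.\<close>

locale lp_solution =
  fixes h :: "real^3 \<Rightarrow> real" and a b C :: real
  assumes a: "0 < a" "a \<le> 2" and b: "a = 2 - 2 * b" and C: "C > 0"
    and smooth: "Ck 4 (- {0}) h"
    and pos: "x \<noteq> 0 \<Longrightarrow> h x > 0"
    and hom: "t > 0 \<Longrightarrow> h (t *\<^sub>R x) = t * h x"
    and eqn: "frame3 x e f \<Longrightarrow> dd e (dd e h) x * dd f (dd f h) x - (dd f (dd e h) x)\<^sup>2 = C * h x powr (- a)"
    and psd: "x \<noteq> 0 \<Longrightarrow> dd v (dd v h) x \<ge> 0"
begin

abbreviation "P \<equiv> - {0 :: real^3}"

lemma open_P: "open P" by (intro open_Compl closed_singleton)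

lemma smooth_dd: "Ck 3 P (dd v h)" "Ck 2 P (dd w (dd v h))" "Ck 1 P (dd z (dd w (dd v h)))"
proof -
  show 1: "Ck 3 P (dd v h)" for v using Ck_dd[OF open_P, of 3] smooth by (simp del: Ck.simps)
  show 2: "Ck 2 P (dd w (dd v h))" for v w using Ck_dd[OF open_P, of 2] 1 by (simp del: Ck.simps)
  show "Ck 1 P (dd z (dd w (dd v h)))"
    using Ck_dd[OF open_P, of 1] 2 by (simp del: Ck.simps add: numeral_2_eq_2)
qed

lemma differentiable_h [simp]:
  "x \<noteq> 0 \<Longrightarrow> h differentiable (at x)"
  "x \<noteq> 0 \<Longrightarrow> dd v h differentiable (at x)"
  "x \<noteq> 0 \<Longrightarrow> dd w (dd v h) differentiable (at x)"
  "x \<noteq> 0 \<Longrightarrow> dd z (dd w (dd v h)) differentiable (at x)"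
  using Ck_differentiable_at[OF smooth] Ck_differentiable_at[OF smooth_dd(1)]
    Ck_differentiable_at[OF smooth_dd(2)] Ck_differentiable_at[OF smooth_dd(3)] by simp_all

lemma swap:
  "x \<noteq> 0 \<Longrightarrow> dd v (dd w h) x = dd w (dd v h) x"
  "x \<noteq> 0 \<Longrightarrow> dd v (dd w (dd z h)) x = dd w (dd v (dd z h)) x"
  "x \<noteq> 0 \<Longrightarrow> dd v (dd w (dd z (dd y h))) x = dd w (dd v (dd z (dd y h))) x"
  using dd_swap[OF open_P] Ck_mono[OF smooth, of 2] Ck_mono[OF smooth_dd(1), of 2] smooth_dd(2) by auto

text \<open>An identity valid on the whole open set \<open>P\<close> may be differentiated. Together
  with \<open>swap\<close> this permutes all derivatives up to order four.\<close>

lemma swap_inner: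
  "x \<noteq> 0 \<Longrightarrow> dd y (dd v (dd w h)) x = dd y (dd w (dd v h)) x"
  "x \<noteq> 0 \<Longrightarrow> dd y (dd v (dd w (dd z h))) x = dd y (dd w (dd v (dd z h))) x"
  "x \<noteq> 0 \<Longrightarrow> dd u (dd y (dd v (dd w h))) x = dd u (dd y (dd w (dd v h))) x"
proof -
  show 1: "x \<noteq> 0 \<Longrightarrow> dd y (dd v (dd w h)) x = dd y (dd w (dd v h)) x" for x y v w
    by (rule dd_cong[OF open_P]) (auto intro: swap)
  show "x \<noteq> 0 \<Longrightarrow> dd y (dd v (dd w (dd z h))) x = dd y (dd w (dd v (dd z h))) x"
    by (rule dd_cong[OF open_P]) (auto intro: swap)
  show "x \<noteq> 0 \<Longrightarrow> dd u (dd y (dd v (dd w h))) x = dd u (dd y (dd w (dd v h))) x"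
    by (rule dd_cong[OF open_P]) (auto intro: 1)
qed

lemma dd_h_homogeneous: "t > 0 \<Longrightarrow> x \<noteq> 0 \<Longrightarrow> dd v h (t *\<^sub>R x) = dd v h x"
  using dd_homogeneous[OF open_P, of x t h t v] hom by simp

lemma dd_dd_h_homogeneous: "t > 0 \<Longrightarrow> x \<noteq> 0 \<Longrightarrow> dd w (dd v h) (t *\<^sub>R x) = dd w (dd v h) x / t"
  using dd_homogeneous[OF open_P, of x t "dd v h" 1 w] dd_h_homogeneous by (simp add: field_simps)

lemma dd_self:
  assumes "x \<noteq> 0" shows "dd x h x = h x" "dd x (dd v h) x = 0" "dd v (dd x h) x = 0"
proof -
  have ev: "\<forall>\<^sub>F s in nhds (0::real). 1 + s > 0"
    using eventually_gt_at_top
    by (intro eventually_nhds_in_open[of "{-1<..}" 0, THEN eventually_mono]) auto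
  have l: "x + s *\<^sub>R x = (1 + s) *\<^sub>R x" for s by (simp add: scaleR_add_left)
  have "((\<lambda>s. h (x + s *\<^sub>R x)) has_real_derivative h x) (at 0)"
    by (rule DERIV_cong_ev[OF refl, THEN iffD2, of _ "\<lambda>s. (1 + s) * h x"])
      (auto intro!: derivative_eq_intros eventually_mono[OF ev] simp: l hom)
  with has_real_derivative_line[of h x 0 x] show "dd x h x = h x"
    using assms DERIV_unique by fastforce
  have "((\<lambda>s. dd v h (x + s *\<^sub>R x)) has_real_derivative 0) (at 0)"
    by (rule DERIV_cong_ev[OF refl, THEN iffD2, of _ "\<lambda>s. dd v h x"])
      (auto intro!: eventually_mono[OF ev] simp: l dd_h_homogeneous assms)
  with has_real_derivative_line[of "dd v h" x 0 x] show "dd x (dd v h) x = 0"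
    using assms DERIV_unique by fastforce
  then show "dd v (dd x h) x = 0" using swap(1) assms by simp
qed

lemma hess_linear:
  assumes "x \<noteq> 0"
  shows "dd (u + v) (dd w h) x = dd u (dd w h) x + dd v (dd w h) x"
    "dd (s *\<^sub>R v) (dd w h) x = s * dd v (dd w h) x"
    "dd w (dd (u + v) h) x = dd w (dd u h) x + dd w (dd v h) x"
    "dd w (dd (s *\<^sub>R v) h) x = s * dd w (dd v h) x"
proof -
  show 1: "dd (u + v) (dd w h) x = dd u (dd w h) x + dd v (dd w h) x" for u v w
    using linear_add[OF linear_dd] assms by simp
  show 2: "dd (s *\<^sub>R v) (dd w h) x = s * dd v (dd w h) x" for v w
    using linear_cmul[OF linear_dd] assms by simp
  show "dd w (dd (u + v) h) x = dd w (dd u h) x + dd w (dd v h) x"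
    "dd w (dd (s *\<^sub>R v) h) x = s * dd w (dd v h) x"
    using 1 2 swap(1)[OF assms] by metis+
qed

lemma line_nonzero: "frame3 x e f \<Longrightarrow> x + t *\<^sub>R e \<noteq> 0"
proof
  assume *: "frame3 x e f" "x + t *\<^sub>R e = 0"
  then have "x \<bullet> (x + t *\<^sub>R e) = 0" by simp
  then show False using frame3_inner[OF *(1)] by (simp add: inner_add_right)
qed

text \<open>\<open>eqn\<close> speaks of unit base points only. With n^2 = 1 + t^2 the point is n y
  for a unit vector \<open>y\<close>, and e = g/n + (t/n) y with \<open>g\<close> tangent at
  \<open>y\<close>. The radial part drops out, so the entries ee and ef carry 1/n^2 and 1/n;
  homogeneity of degree -1 adds 1/n to each entry. The determinant thus carries n^-4, while passing
  from \<open>h y\<close> to \<open>h (z t)\<close> contributes n^a.\<close>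

lemma eqn_line:
  assumes F: "frame3 x e f"
  defines "z \<equiv> \<lambda>t. x + t *\<^sub>R e"
  shows "dd e (dd e h) (z t) * dd f (dd f h) (z t) - (dd e (dd f h) (z t))\<^sup>2 =
    C * (h (z t) powr (- a) * (1 + t * t) powr ((a - 4) / 2))"
proof -
  note i = frame3_inner[OF F]
  define n where "n = sqrt (1 + t\<^sup>2)"
  have n: "n > 0" "n\<^sup>2 = 1 + t\<^sup>2" by (simp_all add: n_def add_pos_nonneg)
  have zz: "z t \<bullet> z t = n\<^sup>2" unfolding z_def n by (simp add: inner_add_left inner_add_right i power2_eq_square)
  define y where "y = (1/n) *\<^sub>R z t"
  define g where "g = (1/n) *\<^sub>R (e - t *\<^sub>R x)"
  have z: "z t = n *\<^sub>R y" using n by (simp add: y_def)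
  have z0: "z t \<noteq> 0" unfolding z_def by (rule line_nonzero[OF F])
  then have y0: "y \<noteq> 0" using n by (simp add: y_def)
  have "y \<bullet> y = 1" using zz n(1) by (simp add: y_def power2_eq_square)
  moreover have "g \<bullet> g = (1 + t\<^sup>2)/n\<^sup>2"
    using i by (simp add: g_def inner_diff_left inner_diff_right power2_eq_square add_divide_distrib)
  then have "g \<bullet> g = 1" using n by (metis divide_self power_not_zero less_irrefl)
  moreover have "y \<bullet> g = 0" "y \<bullet> f = 0" "g \<bullet> f = 0"
    using i by (simp_all add: y_def g_def z_def inner_diff_left inner_diff_right inner_add_left)
  ultimately have Fy: "frame3 y g f" using F by (simp add: frame3_def norm_eq_1)
  have e: "e = (1/n) *\<^sub>R g + (t/n) *\<^sub>R y"
  proof -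
    have "(1/n) *\<^sub>R g + (t/n) *\<^sub>R y = (1/n\<^sup>2) *\<^sub>R ((1 + t\<^sup>2) *\<^sub>R e)"
      by (simp add: g_def y_def z_def algebra_simps power2_eq_square)
    then show ?thesis using n(1) by (simp flip: n(2))
  qed
  have ee: "dd e (dd e h) y = dd g (dd g h) y / n\<^sup>2" "dd e (dd f h) y = dd f (dd g h) y / n"
    unfolding e using y0 by (simp_all add: hess_linear dd_self power2_eq_square swap(1)[of y g f])
  have "dd e (dd e h) (z t) * dd f (dd f h) (z t) - (dd e (dd f h) (z t))\<^sup>2
     = (dd g (dd g h) y * dd f (dd f h) y - (dd f (dd g h) y)\<^sup>2) / n^4"
    unfolding z using n(1) y0
    by (simp add: dd_dd_h_homogeneous ee diff_divide_distrib power_divide) (simp add: eval_nat_numeral mult_ac)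
  also have "\<dots> = C * h y powr (- a) / n^4" by (simp add: eqn[OF Fy])
  also have "h y = h (z t) / n" unfolding y_def using hom[of "1/n" "z t"] n by simp
  also have "(h (z t) / n) powr (- a) = h (z t) powr (- a) * n powr a"
    using n pos[OF z0] by (simp add: powr_divide powr_minus field_simps)
  also have "C * (h (z t) powr (- a) * n powr a) / n^4 = C * (h (z t) powr (- a) * n powr (a - 4))"
    using n(1) by (simp add: powr_diff)
  also have "n powr (a - 4) = (1 + t * t) powr ((a - 4) / 2)"
  proof -
    have "n = (1 + t * t) powr (1/2)" by (simp add: n_def powr_half_sqrt power2_eq_square)
    then show ?thesis by (simp add: powr_powr)
  qed
  finally show ?thesis .
qed

text \<open>The full gradient is taken because it is homogeneous of degree 0; on the sphere its
  square is the squared tangential gradient plus u^2.\<close>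

definition gradsq :: "real^3 \<Rightarrow> real" where
  "gradsq x = (norm (grad3 h x))\<^sup>2"

definition \<Phi> :: "real^3 \<Rightarrow> real^3 \<Rightarrow> real" where
  "\<Phi> x v = h x * dd v (dd v h) x - b / 2 * gradsq x"

lemma gradsq_frame:
  "frame3 x e f \<Longrightarrow> z \<noteq> 0 \<Longrightarrow> gradsq z = (dd x h z)\<^sup>2 + (dd e h z)\<^sup>2 + (dd f h z)\<^sup>2"
  by (simp add: gradsq_def frame3_norm_sq dd_eq_grad3)

lemma gradsq_homogeneous:
  assumes "t > 0" "x \<noteq> 0" shows "gradsq (t *\<^sub>R x) = gradsq x"
  using assms dd_h_homogeneous by (simp add: gradsq_def grad3_def pderiv3_eq_dd)

definition is_upper :: "(real^3 \<Rightarrow> real) \<Rightarrow> real \<Rightarrow> bool" where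
  "is_upper \<psi> M \<longleftrightarrow> (\<forall>x v. norm x = 1 \<and> norm v = 1 \<and> x \<bullet> v = 0 \<longrightarrow> \<Phi> x v + \<psi> x \<le> M)"

text \<open>The bound on the unit tangent bundle, freed from normalisation so that it can be tested
  along straight lines. \<open>Q\<close> is the Gram determinant of \<open>z\<close> and
  \<open>v\<close>, and Q/|z|^2 is the squared length of the part of \<open>v\<close> orthogonal to
  \<open>z\<close>; the radial part does not affect the Hessian. Clearing denominators leaves sums
  and products for the jet rules.\<close>

lemma is_upperD_homogeneous:
  assumes "is_upper \<psi> M" and \<psi>: "\<And>t x. t > 0 \<Longrightarrow> x \<noteq> 0 \<Longrightarrow> \<psi> (t *\<^sub>R x) = \<psi> x"
    and "z \<noteq> 0" and Q: "Q = (z \<bullet> z) * (v \<bullet> v) - (z \<bullet> v)\<^sup>2" "Q > 0"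
  shows "(z \<bullet> z) * (h z * dd v (dd v h) z) \<le> Q * (M + b / 2 * gradsq z - \<psi> z)"
proof -
  define n where "n = norm z"
  have n: "n > 0" "z \<bullet> z = n\<^sup>2" using assms(3) by (simp_all add: n_def power2_norm_eq_inner)
  define x where "x = (1/n) *\<^sub>R z"
  have z: "z = n *\<^sub>R x" using n by (simp add: x_def)
  have x: "norm x = 1" using n by (simp add: x_def n_def)
  then have xx: "x \<bullet> x = 1" by (simp add: norm_eq_1)
  have x0: "x \<noteq> 0" using x by auto
  define w where "w = v + (- (x \<bullet> v)) *\<^sub>R x"
  have xw: "x \<bullet> w = 0" by (simp add: w_def inner_diff_right xx)
  have "w \<bullet> w = v \<bullet> v - (x \<bullet> v)\<^sup>2"
    by (simp add: w_def inner_add_left inner_add_right xx inner_commute power2_eq_square algebra_simps)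
  also have "\<dots> = Q / n\<^sup>2" using n(1) unfolding Q(1) n(2) by (simp add: z power_mult_distrib field_simps)
  finally have ww: "w \<bullet> w = Q / n\<^sup>2" .
  define m where "m = norm w"
  have m2: "m\<^sup>2 = Q / n\<^sup>2" using ww by (simp add: m_def power2_norm_eq_inner)
  have "w \<noteq> 0" using ww n Q by auto
  then have m: "m > 0" by (simp add: m_def)
  have "norm ((1/m) *\<^sub>R w) = 1" "x \<bullet> ((1/m) *\<^sub>R w) = 0" using m xw by (simp_all add: m_def)
  with assms(1) x have "\<Phi> x ((1/m) *\<^sub>R w) + \<psi> x \<le> M" unfolding is_upper_def by blast
  moreover have "dd w (dd w h) x = dd v (dd v h) x"
    unfolding w_def by (simp only: hess_linear[OF x0] dd_self[OF x0] mult_zero_right mult_zero_left add_0_right)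
  moreover have "dd v (dd v h) z = dd v (dd v h) x / n" "h z = n * h x" "\<psi> z = \<psi> x" "gradsq z = gradsq x"
    unfolding z using n x0 by (simp_all add: dd_dd_h_homogeneous hom \<psi> gradsq_homogeneous)
  ultimately have *: "h z * dd v (dd v h) z / m\<^sup>2 \<le> M + b / 2 * gradsq z - \<psi> z"
    using n(1) x0 by (simp add: \<Phi>_def hess_linear power2_eq_square)
  have "Q * (h z * dd v (dd v h) z / m\<^sup>2) \<le> Q * (M + b / 2 * gradsq z - \<psi> z)"
    using * Q(2) by (intro mult_left_mono) auto
  also have "Q * (h z * dd v (dd v h) z / m\<^sup>2) = n\<^sup>2 * (h z * dd v (dd v h) z)"
    using m2 Q(2) n(1) by simp
  finally show ?thesis using n(2) by simp
qed

text \<open>At a maximum (x, e) the vector \<open>e\<close> is a principal direction, since it also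
  maximises the Hessian among unit tangent vectors at the fixed base point. Moving the base point
  along each principal direction gives first and second order conditions; the equation, restricted
  to the same lines, supplies the remaining hypotheses of
  \<open>maximum_condition_reduction\<close>.\<close>

lemma local_maximum:
  assumes F: "frame3 x e f" and M: "is_upper \<psi> M" "\<Phi> x e + \<psi> x = M"
    and \<psi>: "\<And>t x. t > 0 \<Longrightarrow> x \<noteq> 0 \<Longrightarrow> \<psi> (t *\<^sub>R x) = \<psi> x"
    and j1: "jet2 (\<lambda>t. \<psi> (x + t *\<^sub>R e)) (\<psi> x) \<eta>1 z1"
    and j2: "jet2 (\<lambda>t. \<psi> (x + t *\<^sub>R f)) (\<psi> x) \<eta>2 z2"
  defines "u \<equiv> h x" and "u1 \<equiv> dd e h x" and "u2 \<equiv> dd f h x"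
    and "r1 \<equiv> dd e (dd e h) x" and "r2 \<equiv> dd f (dd f h) x"
  shows "0 < r2" "r2 \<le> r1" "r1 * r2 = C * u powr (- a)"
    "u*b*(r1 - r2) + u*(z1/r1 + z2/r2) + a*u1\<^sup>2 - 2*u1*\<eta>1/r1 + (1 - b)\<^sup>2*u2\<^sup>2
      - \<bar>\<eta>2\<bar>*\<bar>u2\<bar>*(2/r2 + 4/((1 - b)*r1)) \<le> 0"
proof -
  note i = frame3_inner[OF F]
  have x0: "x \<noteq> 0" using F by (auto simp: frame3_def)
  have u: "u > 0" using pos[OF x0] by (simp add: u_def)
  define h12 where "h12 = dd e (dd f h) x"
  define h111 where "h111 = dd e (dd e (dd e h)) x"
  define h112 where "h112 = dd e (dd e (dd f h)) x"
  define h122 where "h122 = dd e (dd f (dd f h)) x"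
  define h222 where "h222 = dd f (dd f (dd f h)) x"
  define h1111 where "h1111 = dd e (dd e (dd e (dd e h))) x"
  define h1122 where "h1122 = dd e (dd e (dd f (dd f h))) x"
  have vv: "dd (e + s *\<^sub>R f) (dd (e + s *\<^sub>R f) h) z =
      dd e (dd e h) z + 2 * s * dd e (dd f h) z + s * s * dd f (dd f h) z" if "z \<noteq> 0" for s z
    using that by (simp add: hess_linear swap(1)[of z f e] algebra_simps)
  have B0: "M + b / 2 * gradsq x - \<psi> x = u * r1"
    using M(2) by (simp add: \<Phi>_def u_def r1_def)
  have dir: "r1 + 2 * s * h12 + s * s * r2 \<le> (1 + s\<^sup>2) * r1" for s
  proof -
    have "(x \<bullet> x) * (h x * dd (e + s *\<^sub>R f) (dd (e + s *\<^sub>R f) h) x)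
        \<le> (1 + s\<^sup>2) * (M + b / 2 * gradsq x - \<psi> x)"
      by (rule is_upperD_homogeneous[OF M(1) \<psi> x0])
        (auto simp: inner_add_left inner_add_right i power2_eq_square intro: add_pos_nonneg)
    then have "u * (r1 + 2 * s * h12 + s * s * r2) \<le> u * ((1 + s\<^sup>2) * r1)"
      unfolding B0 vv[OF x0] by (simp add: i u_def r1_def r2_def h12_def mult_ac)
    then show ?thesis using u by simp
  qed
  have r21: "r2 \<le> r1"
  proof -
    have "(x \<bullet> x) * (h x * dd f (dd f h) x) \<le> 1 * (M + b / 2 * gradsq x - \<psi> x)"
      by (rule is_upperD_homogeneous[OF M(1) \<psi> x0]) (auto simp: i)
    then show ?thesis unfolding B0 using u by (simp add: i u_def r2_def)
  qed
  have h12: "h12 = 0"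
  proof (rule ccontr)
    assume ne: "h12 \<noteq> 0"
    \<comment> \<open>The inequality below, valid for every q, is tested at q = h12/d. The added 1
      avoids dividing by zero when the radii coincide.\<close>
    define d where "d = r1 - r2 + 1"
    have d: "d \<ge> 1" using r21 by (simp add: d_def)
    have "2 * h12 * q \<le> q\<^sup>2 * (r1 - r2)" for q
      using dir[of q] by (simp add: algebra_simps power2_eq_square)
    then have "2 * h12 * (h12/d) \<le> (h12/d)\<^sup>2 * (r1 - r2)" .
    also have "\<dots> \<le> (h12/d)\<^sup>2 * d" by (intro mult_left_mono) (auto simp: d_def)
    also have "\<dots> = h12 * (h12/d)" using d by (simp add: power2_eq_square)
    finally have "h12 * h12 \<le> 0" using d by (simp add: field_simps)
    then show False using ne by (auto simp: mult_le_0_iff)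
  qed
  have R: "r1 * r2 = C * u powr (- a)"
    using eqn[OF F] h12 by (simp add: r1_def r2_def u_def h12_def swap(1)[OF x0, of f e])
  show "r1 * r2 = C * u powr (- a)" by (rule R)
  have Rpos: "r1 * r2 > 0" unfolding R using C u by simp
  have r2: "r2 > 0" using psd[OF x0, of f] Rpos by (cases "r2 = 0") (auto simp: r2_def)
  show "0 < r2" "r2 \<le> r1" by fact+
  have r1: "r1 > 0" using r2 r21 by simp

  note jl = jet2_line[OF open_P, of x]
  have C2: "Ck 2 P h" "\<And>v. Ck 2 P (dd v h)" "\<And>v w. Ck 2 P (dd v (dd w h))"
    using Ck_mono[OF smooth] Ck_mono[OF smooth_dd(1)] smooth_dd(2) by simp_all
  have J: "jet2 (\<lambda>t. h (x + t *\<^sub>R k)) (h x) (dd k h x) (dd k (dd k h) x)"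
    "jet2 (\<lambda>t. dd v h (x + t *\<^sub>R k)) (dd v h x) (dd k (dd v h) x) (dd k (dd k (dd v h)) x)"
    "jet2 (\<lambda>t. dd v (dd w h) (x + t *\<^sub>R k)) (dd v (dd w h) x) (dd k (dd v (dd w h)) x)
      (dd k (dd k (dd v (dd w h))) x)" for k v w
    using x0 by (auto intro!: jl C2)
  have K1: "jet2 (\<lambda>t. h (x + t *\<^sub>R e)) u u1 r1"
    "jet2 (\<lambda>t. dd e h (x + t *\<^sub>R e)) u1 r1 h111"
    "jet2 (\<lambda>t. dd f h (x + t *\<^sub>R e)) u2 0 h112"
    "jet2 (\<lambda>t. dd e (dd e h) (x + t *\<^sub>R e)) r1 h111 h1111"
    "jet2 (\<lambda>t. dd e (dd f h) (x + t *\<^sub>R e)) 0 h112 (dd e (dd e (dd e (dd f h))) x)"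
    "jet2 (\<lambda>t. dd f (dd f h) (x + t *\<^sub>R e)) r2 h122 h1122"
    using J(1)[of e] J(2)[of e e] J(2)[of f e] J(3)[of e e e] J(3)[of e f e] J(3)[of f f e] h12
    by (simp_all add: u_def u1_def u2_def r1_def r2_def h12_def h111_def h112_def h122_def h1111_def h1122_def)
  have e2: "dd f (dd e h) x = 0" "dd f (dd e (dd e h)) x = h112" "dd f (dd f (dd e h)) x = h122"
    "dd f (dd e (dd f h)) x = h122" "dd f (dd f (dd e (dd e h))) x = h1122"
  proof -
    show "dd f (dd e h) x = 0" using swap(1)[OF x0, of f e] h12 by (simp add: h12_def)
    show "dd f (dd e (dd e h)) x = h112"
      using swap(2)[OF x0, of f e e] swap_inner(1)[OF x0, of e f e] by (simp add: h112_def)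
    show "dd f (dd e (dd f h)) x = h122" using swap(2)[OF x0, of f e f] by (simp add: h122_def)
    then show "dd f (dd f (dd e h)) x = h122" using swap_inner(1)[OF x0, of f f e] by simp
    have "dd f (dd f (dd e (dd e h))) x = dd f (dd e (dd f (dd e h))) x" by (rule swap_inner(2)[OF x0])
    also have "\<dots> = dd e (dd f (dd f (dd e h))) x" by (rule swap(3)[OF x0])
    also have "\<dots> = dd e (dd f (dd e (dd f h))) x" by (rule swap_inner(3)[OF x0])
    also have "\<dots> = h1122" unfolding h1122_def by (rule swap_inner(2)[OF x0])
    finally show "dd f (dd f (dd e (dd e h))) x = h1122" .
  qed
  have K2: "jet2 (\<lambda>t. h (x + t *\<^sub>R f)) u u2 r2"
    "jet2 (\<lambda>t. dd e h (x + t *\<^sub>R f)) u1 0 h122"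
    "jet2 (\<lambda>t. dd f h (x + t *\<^sub>R f)) u2 r2 h222"
    "jet2 (\<lambda>t. dd e (dd e h) (x + t *\<^sub>R f)) r1 h112 h1122"
    "jet2 (\<lambda>t. dd e (dd f h) (x + t *\<^sub>R f)) 0 h122 (dd f (dd f (dd e (dd f h))) x)"
    "jet2 (\<lambda>t. dd f (dd f h) (x + t *\<^sub>R f)) r2 h222 (dd f (dd f (dd f (dd f h))) x)"
    using J(1)[of f] J(2)[of e f] J(2)[of f f] J(3)[of e e f] J(3)[of e f f] J(3)[of f f f] h12 e2
    by (simp_all add: u_def u1_def u2_def r1_def r2_def h12_def h222_def)

  note T = jet2_ident
  note TT = jet2_mult[OF T T]
  have W: "jet2 (\<lambda>t. 1 + t * t :: real) 1 0 2" using jet2_add[OF jet2_const[of 1] TT] by simp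
  have sc: "jet2 g g0 g1 g2 \<Longrightarrow> jet2 (\<lambda>t. c * g t) (c * g0) (c * g1) (c * g2)" for c g g0 g1 g2
    using jet2_mult[OF jet2_const[of c]] by simp
  have pw: "u powr (- a - 1) = u powr (- a) / u" "u powr (- a - 2) = u powr (- a) / u\<^sup>2"
    using u powr_diff[of u "-a" 1] powr_diff[of u "-a" 2] by simp_all
  \<comment> \<open>The right side of \<open>eqn_line\<close>. The factor (1 + t^2)^((a - 4)/2) has
    jet (1, 0, a - 4), the source of the constant a - 4; the value C u^(-a) is written as r1 r2 at
    once.\<close>
  have rhs: "jet2 (\<lambda>t. C * (k t powr (- a) * (1 + t * t) powr ((a - 4) / 2)))
     (r1*r2) (- a*(r1*r2)*k1/u) ((r1*r2)*(a*(a+1)*k1\<^sup>2/u\<^sup>2 - a*k2/u + a - 4))"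
    if "jet2 k u k1 k2" for k k1 k2
    by (rule jet2_eqI[OF sc[OF jet2_mult[OF jet2_powr[OF that u] jet2_powr[OF W zero_less_one]]]])
      (use u in \<open>simp_all add: R pw field_simps power2_eq_square\<close>)
  \<comment> \<open>The mixed entry vanishes at t = 0, so its square contributes only -2 s1^2 to the
    second derivative.\<close>
  have lhs: "jet2 (\<lambda>t. p t * q t - (s t)\<^sup>2) (r1*r2) (p1*r2 + r1*q1) (p2*r2 + 2*p1*q1 + r1*q2 - 2 * s1\<^sup>2)"
    if "jet2 p r1 p1 p2" "jet2 q r2 q1 q2" "jet2 s 0 s1 s2" for p q s p1 p2 q1 q2 s1 s2
    using jet2_add[OF jet2_mult[OF that(1,2)] sc[where c="-1", OF jet2_mult[OF that(3,3)]]]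
    by (simp add: power2_eq_square mult.assoc)
  note l1 = lhs[OF K1(4,6,5)] and l2 = lhs[OF K2(4,6,5)]
  have eq: "r2*h111 + r1*h122 = - a*(r1*r2)*u1/u"
    "r2*h1111 + 2*h111*h122 + r1*h1122 - 2*h112\<^sup>2 = (r1*r2)*(a*(a+1)*u1\<^sup>2/u\<^sup>2 - a*r1/u + a - 4)"
    using jet2_unique(2,3)[OF l1[unfolded eqn_line[OF F]] rhs[OF K1(1)]] by (simp_all add: mult_ac)
  have l2': "(\<lambda>t. dd e (dd e h) (x + t *\<^sub>R f) * dd f (dd f h) (x + t *\<^sub>R f) - (dd e (dd f h) (x + t *\<^sub>R f))\<^sup>2)
     = (\<lambda>t. C * (h (x + t *\<^sub>R f) powr (- a) * (1 + t * t) powr ((a - 4) / 2)))"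
    using eqn_line[OF frame3_swap[OF F]] swap(1)[OF line_nonzero[OF frame3_swap[OF F]]]
    by (simp add: fun_eq_iff mult.commute)
  have eq': "r2*h112 + r1*h222 = - a*(r1*r2)*u2/u"
    using jet2_unique(2)[OF l2[unfolded l2'] rhs[OF K2(1)]] by (simp add: mult_ac)

  have M': "M = u * r1 + \<psi> x - b / 2 * (u1\<^sup>2 + u2\<^sup>2 + u\<^sup>2)"
    using B0 gradsq_frame[OF F x0] by (simp add: dd_self x0 u_def u1_def u2_def algebra_simps)
  have gradsq_line: "gradsq (x + t *\<^sub>R e) = (dd e h (x + t *\<^sub>R e))\<^sup>2 + (dd f h (x + t *\<^sub>R e))\<^sup>2
       + (h (x + t *\<^sub>R e) - t * dd e h (x + t *\<^sub>R e))\<^sup>2" if F: "frame3 x e f" for e f t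
  proof -
    have z: "x + t *\<^sub>R e \<noteq> 0" by (rule line_nonzero[OF F])
    have "dd (x + t *\<^sub>R e) h (x + t *\<^sub>R e) = dd x h (x + t *\<^sub>R e) + t * dd e h (x + t *\<^sub>R e)"
      using linear_add[OF linear_dd] linear_cmul[OF linear_dd] z by simp
    then have "dd x h (x + t *\<^sub>R e) = h (x + t *\<^sub>R e) - t * dd e h (x + t *\<^sub>R e)"
      using dd_self(1)[OF z] by simp
    then show ?thesis using gradsq_frame[OF F z] by simp
  qed
  \<comment> \<open>The curves are \<open>x + t e\<close> and \<open>x + t f\<close> with \<open>v = e + \<theta> t f\<close>; denominators are cleared, and
    the derivative of \<open>h\<close> in direction \<open>x\<close> is eliminated by Euler's relation.\<close>
  define B where "B g g1 g2 \<psi>' t = M + ((b / 2) * (g1 * g1 + (g2 * g2 + (g + - 1 * (t * g1)) * (g + - 1 * (t * g1)))) + - 1 * \<psi>')"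
    for g g1 g2 \<psi>' t :: real
  define A where "A \<theta> g g11 g12 g22 t = g * (g11 + ((2 * \<theta>) * (t * g12) + (\<theta> * \<theta>) * ((t * t) * g22)))"
    for \<theta> g g11 g12 g22 t :: real
  \<comment> \<open>1 + \<theta>^2 (t^2 + t^4) here and 1 + (1 + \<theta>^2) t^2 in
    \<open>\<phi>2\<close> are the Gram determinants of the base point and e + \<theta> t f.
    Everything is spelled with sums, products and factors - 1 so that the jet rules match
    syntactically.\<close>
  define \<phi>1 where "\<phi>1 \<theta> t = (1 + t * t) * A \<theta> (h (x + t *\<^sub>R e)) (dd e (dd e h) (x + t *\<^sub>R e))
        (dd e (dd f h) (x + t *\<^sub>R e)) (dd f (dd f h) (x + t *\<^sub>R e)) t
     + - 1 * ((1 + (\<theta> * \<theta>) * (t * t + (t * t) * (t * t))) *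
        B (h (x + t *\<^sub>R e)) (dd e h (x + t *\<^sub>R e)) (dd f h (x + t *\<^sub>R e)) (\<psi> (x + t *\<^sub>R e)) t)" for \<theta> t
  define \<phi>2 where "\<phi>2 \<theta> t = (1 + t * t) * A \<theta> (h (x + t *\<^sub>R f)) (dd e (dd e h) (x + t *\<^sub>R f))
        (dd e (dd f h) (x + t *\<^sub>R f)) (dd f (dd f h) (x + t *\<^sub>R f)) t
     + - 1 * ((1 + (1 + \<theta> * \<theta>) * (t * t)) *
        B (h (x + t *\<^sub>R f)) (dd f h (x + t *\<^sub>R f)) (dd e h (x + t *\<^sub>R f)) (\<psi> (x + t *\<^sub>R f)) t)" for \<theta> t
  have AH: "A s (h z) (dd e (dd e h) z) (dd e (dd f h) z) (dd f (dd f h) z) t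
      = h z * dd (e + (s * t) *\<^sub>R f) (dd (e + (s * t) *\<^sub>R f) h) z" if "z \<noteq> 0" for s z t
    unfolding vv[OF that] A_def by (simp add: algebra_simps)
  have \<phi>1: "\<phi>1 \<theta> t \<le> 0" for \<theta> t
  proof -
    let ?z = "x + t *\<^sub>R e"
    have z: "?z \<noteq> 0" by (rule line_nonzero[OF F])
    have zz: "?z \<bullet> ?z = 1 + t * t" by (simp add: inner_add_left inner_add_right i)
    have "(?z \<bullet> ?z) * (h ?z * dd (e + (\<theta> * t) *\<^sub>R f) (dd (e + (\<theta> * t) *\<^sub>R f) h) ?z)
       \<le> (1 + (\<theta> * \<theta>) * (t * t + (t * t) * (t * t))) * (M + b / 2 * gradsq ?z - \<psi> ?z)"
    proof (rule is_upperD_homogeneous[OF M(1) \<psi> z])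
      show "1 + (\<theta> * \<theta>) * (t * t + (t * t) * (t * t)) =
        ?z \<bullet> ?z * ((e + (\<theta> * t) *\<^sub>R f) \<bullet> (e + (\<theta> * t) *\<^sub>R f)) - (?z \<bullet> (e + (\<theta> * t) *\<^sub>R f))\<^sup>2"
        by (simp add: inner_add_left inner_add_right i power2_eq_square algebra_simps)
      show "1 + (\<theta> * \<theta>) * (t * t + (t * t) * (t * t)) > 0" by (intro add_pos_nonneg) auto
    qed
    moreover have "B (h ?z) (dd e h ?z) (dd f h ?z) (\<psi> ?z) t = M + b / 2 * gradsq ?z - \<psi> ?z"
      unfolding B_def gradsq_line[OF F] by (simp add: power2_eq_square)
    ultimately show ?thesis unfolding \<phi>1_def AH[OF z] zz by simp
  qed
  have \<phi>2: "\<phi>2 \<theta> t \<le> 0" for \<theta> t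
  proof -
    let ?z = "x + t *\<^sub>R f"
    have z: "?z \<noteq> 0" by (rule line_nonzero[OF frame3_swap[OF F]])
    have zz: "?z \<bullet> ?z = 1 + t * t" by (simp add: inner_add_left inner_add_right i)
    have "(?z \<bullet> ?z) * (h ?z * dd (e + (\<theta> * t) *\<^sub>R f) (dd (e + (\<theta> * t) *\<^sub>R f) h) ?z)
       \<le> (1 + (1 + \<theta> * \<theta>) * (t * t)) * (M + b / 2 * gradsq ?z - \<psi> ?z)"
    proof (rule is_upperD_homogeneous[OF M(1) \<psi> z])
      show "1 + (1 + \<theta> * \<theta>) * (t * t) =
        ?z \<bullet> ?z * ((e + (\<theta> * t) *\<^sub>R f) \<bullet> (e + (\<theta> * t) *\<^sub>R f)) - (?z \<bullet> (e + (\<theta> * t) *\<^sub>R f))\<^sup>2"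
        by (simp add: inner_add_left inner_add_right i power2_eq_square algebra_simps)
      show "1 + (1 + \<theta> * \<theta>) * (t * t) > 0" by (intro add_pos_nonneg) auto
    qed
    moreover have "B (h ?z) (dd f h ?z) (dd e h ?z) (\<psi> ?z) t = M + b / 2 * gradsq ?z - \<psi> ?z"
      unfolding B_def gradsq_line[OF frame3_swap[OF F]] by (simp add: power2_eq_square)
    ultimately show ?thesis unfolding \<phi>2_def AH[OF z] zz by simp
  qed
  have jA: "jet2 (\<lambda>t. A \<theta> (g t) (p t) (q t) (s t) t) (u*r1) (g1*r1 + u*p1)
      (g2*r1 + 2*g1*p1 + u*(p2 + 4*\<theta>*q1 + 2*\<theta>\<^sup>2*r2))"
    if "jet2 g u g1 g2" "jet2 p r1 p1 p2" "jet2 q 0 q1 q2" "jet2 s r2 s1 s2" for \<theta> g p q s g1 g2 p1 p2 q1 q2 s1 s2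
    unfolding A_def
    by (rule jet2_eqI[OF jet2_mult[OF that(1) jet2_add[OF that(2) jet2_add[OF sc[OF jet2_mult[OF T that(3)]]
        sc[OF jet2_mult[OF TT that(4)]]]]]]) (simp_all add: algebra_simps power2_eq_square)
  have jB: "jet2 (\<lambda>t. B (g t) (p t) (q t) (s t) t) (u*r1) (b*(p0*p1 + q0*q1 + u*(g1 - p0)) - s1)
      (b*(p1\<^sup>2 + p0*p2 + q1\<^sup>2 + q0*q2 + (g1 - p0)\<^sup>2 + u*(g2 - 2*p1)) - s2)"
    if "jet2 g u g1 g2" "jet2 p p0 p1 p2" "jet2 q q0 q1 q2" "jet2 s (\<psi> x) s1 s2" "p0\<^sup>2 + q0\<^sup>2 = u1\<^sup>2 + u2\<^sup>2"
    for g p q s g1 g2 p0 p1 p2 q0 q1 q2 s1 s2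
  proof -
    note gt = jet2_add[OF that(1) sc[where c="-1", OF jet2_mult[OF T that(2)]]]
    have M'': "M = u * r1 + \<psi> x - b / 2 * (p0\<^sup>2 + q0\<^sup>2 + u\<^sup>2)" using M' that(5) by simp
    show ?thesis
      unfolding B_def
      by (rule jet2_eqI[OF jet2_add[OF jet2_const jet2_add[OF sc[OF jet2_add[OF jet2_mult[OF that(2,2)]
        jet2_add[OF jet2_mult[OF that(3,3)] jet2_mult[OF gt gt]]]] sc[OF that(4)]]]])
        (simp_all add: M'' algebra_simps power2_eq_square)
  qed
  have fs1: "u1*r1 + u*h111 = b*u1*r1 - \<eta>1"
    "2*u*r1 + r1*r1 + 2*u1*h111 + u*(h1111 + 4*\<theta>*h112 + 2*\<theta>\<^sup>2*r2) - 2*\<theta>\<^sup>2*u*r1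
      - (b*(r1\<^sup>2 + u1*h111 + u2*h112 - u*r1) - z1) \<le> 0" for \<theta>
  proof -
    note j = jet2_add[OF jet2_mult[OF W jA[OF K1(1,4,5,6)]] sc[where c="-1", OF jet2_mult[OF
       jet2_add[OF jet2_const[of 1] sc[where c="\<theta> * \<theta>", OF jet2_add[OF TT jet2_mult[OF TT TT]]]]
       jB[OF K1(1,2,3) j1]]], of \<theta>, folded \<phi>1_def, simplified]
    have 0: "\<phi>1 \<theta> 0 = 0" using jet2_value[OF j] by simp
    note m = jet2_max[OF j, unfolded 0, OF \<phi>1]
    show "u1*r1 + u*h111 = b*u1*r1 - \<eta>1" using m(1) by (simp add: algebra_simps)
    show "2*u*r1 + r1*r1 + 2*u1*h111 + u*(h1111 + 4*\<theta>*h112 + 2*\<theta>\<^sup>2*r2) - 2*\<theta>\<^sup>2*u*r1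
      - (b*(r1\<^sup>2 + u1*h111 + u2*h112 - u*r1) - z1) \<le> 0"
      using m(2) by (simp add: algebra_simps power2_eq_square)
  qed
  have fs2: "u2*r1 + u*h112 = b*u2*r2 - \<eta>2"
    "r2*r1 + 2*u2*h112 + u*h1122 - (b*(r2\<^sup>2 + u2*h222 + u1*h122 - u*r2) - z2) \<le> 0"
  proof -
    \<comment> \<open>Along \<open>f\<close> the test vector is not rotated, \<theta> = 0; the
      constant is spelled \<open>1 + 0 * 0\<close> so that folding \<open>\<phi>2_def\<close>
      succeeds before simplification.\<close>
    note j = jet2_add[OF jet2_mult[OF W jA[OF K2(1,4,5,6)]] sc[where c="-1", OF jet2_mult[OF
       jet2_add[OF jet2_const[of 1] sc[where c="1 + 0 * 0", OF TT]]
       jB[OF K2(1,3,2) j2]]], of 0, folded \<phi>2_def, simplified]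
    have 0: "\<phi>2 0 0 = 0" using jet2_value[OF j] by simp
    note m = jet2_max[OF j, unfolded 0, OF \<phi>2]
    show "u2*r1 + u*h112 = b*u2*r2 - \<eta>2" using m(1) by (simp add: algebra_simps)
    show "r2*r1 + 2*u2*h112 + u*h1122 - (b*(r2\<^sup>2 + u2*h222 + u1*h122 - u*r2) - z2) \<le> 0"
      using m(2) by (simp add: algebra_simps power2_eq_square)
  qed
  show "u*b*(r1 - r2) + u*(z1/r1 + z2/r2) + a*u1\<^sup>2 - 2*u1*\<eta>1/r1 + (1 - b)\<^sup>2*u2\<^sup>2
      - \<bar>\<eta>2\<bar>*\<bar>u2\<bar>*(2/r2 + 4/((1 - b)*r1)) \<le> 0"
  proof (rule maximum_condition_reduction[OF b _ _ u r2 r21 _ _ _ _ eq(1) eq' eq(2)])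
    show "0 \<le> b" "b < 1" using a b by auto
    show "u*h111 = (b - 1)*u1*r1 - \<eta>1" "u*h112 = (b*r2 - r1)*u2 - \<eta>2"
      using fs1(1) fs2(1) by (simp_all add: algebra_simps)
    show "2*u*r1 + r1\<^sup>2 + 2*u1*h111 + u*h1111 + 4*\<theta>*u*h112 - 2*\<theta>\<^sup>2*u*(r1 - r2)
        - b*(r1\<^sup>2 + u1*h111 + u2*h112 - u*r1) + z1 \<le> 0" for \<theta>
      using fs1(2)[of \<theta>] by (simp add: algebra_simps power2_eq_square)
    show "r1*r2 + 2*u2*h112 + u*h1122 - b*(r2\<^sup>2 + u1*h122 + u2*h222 - u*r2) + z2 \<le> 0"
      using fs2(2) by (simp add: algebra_simps)
  qed
qed

end

section \<open>The exponential barrier and the spreading of maxima\<close>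

lemma perturbation_rate:
  fixes \<alpha> \<beta> \<gamma> K \<delta> :: real
  assumes pos: "\<alpha> > 0" "\<beta> > 0" "\<gamma> > 0" "0 < \<delta>" "\<delta> \<le> 1"
  obtains A where "A > 0"
    "\<And>g l s. g\<^sup>2 + l\<^sup>2 = 1 \<Longrightarrow> l \<le> 1 - \<delta> \<Longrightarrow> \<gamma> \<le> s \<Longrightarrow> s \<le> \<beta> \<Longrightarrow> \<alpha> * A * g\<^sup>2 - l * s > 2 * K * g"
proof
  \<comment> \<open>The error 2 K g is split by Young's inequality. The first summand of
    \<open>A\<close> makes the remainder 2 K^2/(\<alpha> A) smaller than \<gamma>/4. The second
    serves the region l > -1/2, where g^2 >= \<delta>/2 and half of the quadratic term reaches
    \<beta> + \<gamma>. Near the antipode of \<open>q\<close>, where g may vanish, -l s >=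
    \<gamma>/2 is already positive.\<close>
  define A where "A = 16 * (K\<^sup>2 + 1) / (\<alpha> * \<gamma>) + 4 * (\<beta> + \<gamma>) / (\<alpha> * \<delta>)"
  have s0: "16 * (K\<^sup>2 + 1) / (\<alpha> * \<gamma>) > 0" "4 * (\<beta> + \<gamma>) / (\<alpha> * \<delta>) > 0"
    using pos by (simp_all add: add_nonneg_pos add_pos_pos)
  then show A: "A > 0" by (simp add: A_def)
  have "16 * (K\<^sup>2 + 1) / (\<alpha> * \<gamma>) \<le> A" "4 * (\<beta> + \<gamma>) / (\<alpha> * \<delta>) \<le> A"
    using s0 by (simp_all add: A_def)
  then have A1: "\<alpha> * A * \<gamma> \<ge> 16 * (K\<^sup>2 + 1)" and A2: "\<alpha> * A * \<delta> \<ge> 4 * (\<beta> + \<gamma>)"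
    using pos by (simp_all only: pos_divide_le_eq mult_pos_pos mult_ac)
  have AA: "\<alpha> * A > 0" using A pos by simp
  fix g l s :: real
  assume gl: "g\<^sup>2 + l\<^sup>2 = 1" and l: "l \<le> 1 - \<delta>" and s: "\<gamma> \<le> s" "s \<le> \<beta>"
  have "2 * K * g \<le> \<alpha> * A * g\<^sup>2 / 2 + 2 * K\<^sup>2 / (\<alpha> * A)"
  proof -
    have "0 \<le> (\<alpha> * A * g - 2 * K)\<^sup>2 / (2 * (\<alpha> * A))" using AA by simp
    also have "\<dots> = \<alpha> * A * g\<^sup>2 / 2 + 2 * K\<^sup>2 / (\<alpha> * A) - 2 * K * g"
      using A pos by (simp add: power2_eq_square field_simps)
    finally show ?thesis by simp
  qed
  moreover have "2 * K\<^sup>2 / (\<alpha> * A) < \<gamma> / 4"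
  proof -
    have "2 * K\<^sup>2 * 4 < 16 * (K\<^sup>2 + 1)" by (simp add: algebra_simps add_pos_nonneg)
    also note A1
    finally have "2 * K\<^sup>2 * 4 < \<alpha> * A * \<gamma>" .
    then show ?thesis using AA by (simp add: divide_simps mult_ac)
  qed
  moreover have "\<alpha> * A * g\<^sup>2 / 2 - l * s \<ge> \<gamma> / 2"
  proof (cases "l \<le> - 1/2")
    case True
    have "(- l) * s \<ge> (1/2) * \<gamma>" using True s pos by (intro mult_mono) auto
    moreover have "\<alpha> * A * g\<^sup>2 \<ge> 0" using AA by simp
    ultimately show ?thesis by linarith
  next
    case False
    have "g\<^sup>2 = (1 - l) * (1 + l)" using gl by (simp add: algebra_simps power2_eq_square)
    moreover have "(1 - l) * (1 + l) \<ge> \<delta> * (1/2)" using False l pos by (intro mult_mono) auto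
    ultimately have "\<alpha> * A * g\<^sup>2 \<ge> \<alpha> * A * (\<delta> * (1/2))" using AA by (intro mult_left_mono) auto
    moreover have "\<alpha> * A * (\<delta> * (1/2)) = \<alpha> * A * \<delta> / 2" by simp
    ultimately have "\<alpha> * A * g\<^sup>2 / 2 \<ge> \<beta> + \<gamma>" using A2 by simp
    moreover have "l * s \<le> 1 * \<beta>"
    proof (cases "l \<ge> 0")
      case True then show ?thesis using l s pos by (intro mult_mono) auto
    next
      case False then have "l * s \<le> 0" using s pos by (simp add: mult_nonpos_nonneg)
      then show ?thesis using pos by simp
    qed
    ultimately show ?thesis using pos by linarith
  qed
  ultimately show "\<alpha> * A * g\<^sup>2 - l * s > 2 * K * g" using pos by linarith
qed

lemma frame3_exists:
  assumes "norm x = 1" "norm e = 1" "x \<bullet> e = 0"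
  obtains f where "frame3 x e f"
proof
  have "(norm (cross3 x e))\<^sup>2 = 1" using assms by (simp add: norm_cross)
  then have "norm (cross3 x e) = 1" by (simp add: power2_eq_1_iff) (smt (verit) norm_ge_zero)
  then show "frame3 x e (cross3 x e)" using assms by (simp add: frame3_def dot_cross_self)
qed

lemma unit_orthogonal_exists:
  fixes x :: "real^3"
  obtains e where "norm e = 1" "x \<bullet> e = 0"
proof -
  obtain y :: "real^3" where "y \<noteq> 0" "orthogonal x y"
    using orthogonal_to_vector_exists[of x] by auto
  then show thesis by (intro that[of "(1 / norm y) *\<^sub>R y"]) (auto simp: orthogonal_def)
qed

lemma norm_frame3_line:
  assumes "frame3 x e f"
  shows "norm (x + t *\<^sub>R e) = (1 + t * t) powr (1/2)"
proof -
  have "norm (x + t *\<^sub>R e) = sqrt (1 + t * t)"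
    unfolding norm_eq_sqrt_inner by (simp add: inner_add_left inner_add_right frame3_inner[OF assms])
  then show ?thesis by (simp add: powr_half_sqrt)
qed

text \<open>Along the line the norm is sqrt(1 + t^2), which gives q . x/|x| the second derivative
  -(q . x), as for a linear function restricted to the sphere. The exponential adds the square of
  the first derivative, with the factor A^2.\<close>

lemma jet2_spherical_exp:
  assumes "frame3 x e f"
  shows "jet2 (\<lambda>t. \<epsilon> * exp (A * (q \<bullet> (x + t *\<^sub>R e) / norm (x + t *\<^sub>R e))))
    (\<epsilon> * exp (A * (q \<bullet> x))) (\<epsilon> * exp (A * (q \<bullet> x)) * (A * (q \<bullet> e)))
    (\<epsilon> * exp (A * (q \<bullet> x)) * (A\<^sup>2 * (q \<bullet> e)\<^sup>2 - A * (q \<bullet> x)))"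
proof -
  have W: "jet2 (\<lambda>t. 1 + t * t :: real) 1 0 2"
    using jet2_add[OF jet2_const[of 1] jet2_mult[OF jet2_ident jet2_ident]] by simp
  have p: "jet2 (\<lambda>t. (1 + t * t) powr (- (1/2)) :: real) 1 0 (-1)"
    using jet2_powr[OF W, of "-(1/2)"] by simp
  have n: "jet2 (\<lambda>t. q \<bullet> x + t * (q \<bullet> e)) (q \<bullet> x) (q \<bullet> e) 0"
    using jet2_add[OF jet2_const jet2_mult[OF jet2_ident jet2_const]] by simp
  have eq: "(\<lambda>t. q \<bullet> (x + t *\<^sub>R e) / norm (x + t *\<^sub>R e)) = (\<lambda>t. (q \<bullet> x + t * (q \<bullet> e)) * (1 + t * t) powr (- (1/2)))"
    unfolding norm_frame3_line[OF assms] by (simp add: fun_eq_iff inner_add_right powr_minus_divide)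
  have "jet2 (\<lambda>t. q \<bullet> (x + t *\<^sub>R e) / norm (x + t *\<^sub>R e)) (q \<bullet> x) (q \<bullet> e) (- (q \<bullet> x))"
    unfolding eq using jet2_mult[OF n p] by simp
  note j = jet2_mult[OF jet2_const[of \<epsilon>] jet2_exp[OF jet2_mult[OF jet2_const[of A] this]]]
  show ?thesis by (rule jet2_eqI[OF j]) (simp_all add: algebra_simps power2_eq_square)
qed

context lp_solution
begin

abbreviation "unit_tangent_bundle \<equiv> {(x, v). norm x = 1 \<and> norm v = 1 \<and> x \<bullet> v = (0::real)} :: ((real^3) \<times> (real^3)) set"

lemma compact_utb: "compact unit_tangent_bundle"
proof -
  have "closed unit_tangent_bundle"
    unfolding case_prod_unfold by (intro closed_Collect_conj closed_Collect_eq continuous_intros)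
  moreover have "unit_tangent_bundle \<subseteq> sphere 0 1 \<times> sphere 0 1" by auto
  moreover have "compact (sphere 0 1 \<times> sphere 0 1 :: ((real^3) \<times> (real^3)) set)"
    by (intro compact_Times compact_sphere)
  ultimately show ?thesis using compact_Int_closed[of "sphere 0 1 \<times> sphere 0 1" unit_tangent_bundle]
    by (simp add: Int_absorb1)
qed

text \<open>Reduces joint continuity in (x, v) to continuity of finitely many coefficients in
  \<open>x\<close>.\<close>

lemma hess_expand:
  assumes "x \<noteq> 0"
  shows "dd v (dd v h) x = (\<Sum>i\<in>UNIV. \<Sum>j\<in>UNIV. v$i * v$j * dd (axis i 1) (dd (axis j 1) h) x)"
proof -
  have 1: "dd v (dd w h) x = (\<Sum>i\<in>UNIV. v$i * dd (axis i 1) (dd w h) x)" for v w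
    by (subst dd_expand[OF differentiable_h(2)[OF assms]]) (simp only: pderiv3_eq_dd)
  have "dd (axis i 1) (dd v h) x = (\<Sum>j\<in>UNIV. v$j * dd (axis i 1) (dd (axis j 1) h) x)" for i
  proof -
    have "dd (axis i 1) (dd v h) x = dd v (dd (axis i 1) h) x" by (rule swap(1)[OF assms])
    also have "\<dots> = (\<Sum>j\<in>UNIV. v$j * dd (axis j 1) (dd (axis i 1) h) x)" by (rule 1)
    also have "\<dots> = (\<Sum>j\<in>UNIV. v$j * dd (axis i 1) (dd (axis j 1) h) x)"
      by (intro sum.cong refl arg_cong2[where f = "(*)"] swap(1)[OF assms])
    finally show ?thesis .
  qed
  then have "dd v (dd v h) x = (\<Sum>i\<in>UNIV. v$i * (\<Sum>j\<in>UNIV. v$j * dd (axis i 1) (dd (axis j 1) h) x))"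
    by (subst 1) (simp only:)
  then show ?thesis by (simp only: sum_distrib_left mult.assoc)
qed

lemma continuous_on_fst_P:
  assumes "continuous_on P g" "S \<subseteq> P \<times> UNIV"
  shows "continuous_on S (\<lambda>p. g (fst p))"
  using assms by (intro continuous_on_compose2[OF assms(1)] continuous_intros) auto

lemma continuous_on_hess:
  assumes "S \<subseteq> P \<times> UNIV"
  shows "continuous_on S (\<lambda>p. dd (snd p) (dd (snd p) h) (fst p))"
proof -
  have "continuous_on S (\<lambda>p. \<Sum>i\<in>UNIV. \<Sum>j\<in>UNIV. snd p$i * snd p$j * dd (axis i 1) (dd (axis j 1) h) (fst p))"
    by (intro continuous_intros continuous_on_fst_P[OF _ assms] Ck_continuous_on[OF smooth_dd(2)])
  moreover have "\<And>p. p \<in> S \<Longrightarrow> fst p \<noteq> 0" using assms by auto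
  ultimately show ?thesis by (simp add: hess_expand cong: continuous_on_cong)
qed

lemma continuous_on_gradsq: "continuous_on P gradsq"
  unfolding gradsq_def grad3_def pderiv3_eq_dd
  by (intro continuous_intros Ck_continuous_on[OF smooth_dd(1)])

lemma continuous_on_\<Phi>:
  assumes "S \<subseteq> P \<times> UNIV"
  shows "continuous_on S (\<lambda>p. \<Phi> (fst p) (snd p))"
  unfolding \<Phi>_def
  by (intro continuous_intros continuous_on_hess continuous_on_fst_P[OF _ assms] assms
      continuous_on_gradsq Ck_continuous_on[OF smooth])

lemma utb_subset: "unit_tangent_bundle \<subseteq> P \<times> UNIV"
  by auto

lemma sphere_subset: "sphere 0 1 \<subseteq> P"
  by auto

lemma uniform_bounds:
  obtains c0 c1 c2 c3 where "c0 > 0" "c1 > 0" "c2 > 0" "c3 > 0"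
    "\<And>x. norm x = 1 \<Longrightarrow> c0 \<le> h x" "\<And>x. norm x = 1 \<Longrightarrow> h x \<le> c1"
    "\<And>x v. norm x = 1 \<Longrightarrow> norm v = 1 \<Longrightarrow> dd v (dd v h) x \<le> c2"
    "\<And>x v. norm x = 1 \<Longrightarrow> norm v = 1 \<Longrightarrow> \<bar>dd v h x\<bar> \<le> c3"
proof -
  let ?S = "sphere 0 1 :: (real^3) set"
  have ne: "?S \<noteq> {}" by simp
  have ch: "continuous_on ?S h"
    using Ck_continuous_on[OF smooth] sphere_subset by (rule continuous_on_subset)
  obtain x0 where x0: "x0 \<in> ?S" "\<And>x. x \<in> ?S \<Longrightarrow> h x0 \<le> h x"
    using continuous_attains_inf[OF compact_sphere ne ch] by blast
  obtain x1 where x1: "x1 \<in> ?S" "\<And>x. x \<in> ?S \<Longrightarrow> h x \<le> h x1"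
    using continuous_attains_sup[OF compact_sphere ne ch] by blast
  have p: "h x0 > 0" "h x1 > 0" using x0(1) x1(1) by (auto intro!: pos)
  have "compact (?S \<times> ?S)" "?S \<times> ?S \<noteq> {}" by (auto intro!: compact_Times)
  moreover have "?S \<times> ?S \<subseteq> P \<times> UNIV" by auto
  ultimately obtain p2 where p2: "\<And>p. p \<in> ?S \<times> ?S \<Longrightarrow>
      dd (snd p) (dd (snd p) h) (fst p) \<le> dd (snd p2) (dd (snd p2) h) (fst p2)"
    using continuous_attains_sup[OF _ _ continuous_on_hess, of "?S \<times> ?S"] by blast
  have "continuous_on ?S (\<lambda>x. norm (grad3 h x))"
    unfolding grad3_def pderiv3_eq_dd
    by (intro continuous_intros continuous_on_subset[OF Ck_continuous_on[OF smooth_dd(1)] sphere_subset])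
  then obtain x3 where x3: "\<And>x. x \<in> ?S \<Longrightarrow> norm (grad3 h x) \<le> norm (grad3 h x3)"
    using continuous_attains_sup[OF compact_sphere ne] by blast
  show thesis
  proof (rule that[of "h x0" "h x1" "\<bar>dd (snd p2) (dd (snd p2) h) (fst p2)\<bar> + 1" "norm (grad3 h x3) + 1"])
    show "dd v (dd v h) x \<le> \<bar>dd (snd p2) (dd (snd p2) h) (fst p2)\<bar> + 1" if "norm x = 1" "norm v = 1" for x v
      using p2[of "(x, v)"] that by simp
    show "\<bar>dd v h x\<bar> \<le> norm (grad3 h x3) + 1" if "norm x = 1" "norm v = 1" for x v
    proof -
      have "x \<noteq> 0" using that by auto
      then have "\<bar>dd v h x\<bar> \<le> norm v * norm (grad3 h x)" by (simp add: dd_eq_grad3 Cauchy_Schwarz_ineq2)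
      also have "\<dots> \<le> norm (grad3 h x3) + 1" using that x3[of x] by simp
      finally show ?thesis .
    qed
  qed (use x0 x1 p in \<open>auto simp: add_nonneg_pos\<close>)
qed

text \<open>With \<psi> = 0 the inequality of \<open>local_maximum\<close> bounds a sum of three
  nonnegative terms by 0, and a > 0 and b < 1 make both gradient coefficients positive.\<close>

lemma gradient_vanishes_at_maximum:
  assumes F: "frame3 x e f" and M: "is_upper (\<lambda>x. 0) M" "\<Phi> x e = M"
  shows "dd e h x = 0" "dd f h x = 0"
proof -
  have x0: "x \<noteq> 0" using F by (auto simp: frame3_def)
  note l = local_maximum[OF F M(1) _ _ jet2_const jet2_const, simplified]
  have "h x * b * (dd e (dd e h) x - dd f (dd f h) x) \<ge> 0"
    using l(2) M(2) pos[OF x0] a b by simp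
  moreover have "a * (dd e h x)\<^sup>2 \<ge> 0" "(1 - b)\<^sup>2 * (dd f h x)\<^sup>2 \<ge> 0" using a by simp_all
  ultimately have "a * (dd e h x)\<^sup>2 = 0" "(1 - b)\<^sup>2 * (dd f h x)\<^sup>2 = 0" using l(4) M(2) by linarith+
  then show "dd e h x = 0" "dd f h x = 0" using a b by auto
qed

text \<open>Every contribution of the perturbation to \<open>local_maximum\<close> carries the
  common factor E A with E = \<epsilon> exp(A l0), so \<epsilon> drops out of the comparison. This
  is why \<open>A\<close> can be fixed before \<epsilon>, as the application requires.\<close>

lemma no_perturbed_maximum:
  assumes \<delta>: "0 < \<delta>" "\<delta> \<le> 1" and q: "norm q = 1"
  obtains A where "A > 0" "\<And>\<epsilon> x e M. \<epsilon> > 0 \<Longrightarrow> norm x = 1 \<Longrightarrow> norm e = 1 \<Longrightarrow> x \<bullet> e = 0 \<Longrightarrow> q \<bullet> x \<le> 1 - \<delta> \<Longrightarrow>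
     is_upper (\<lambda>x. \<epsilon> * exp (A * (q \<bullet> x / norm x))) M \<Longrightarrow> \<Phi> x e + \<epsilon> * exp (A * (q \<bullet> x)) \<noteq> M"
proof -
  obtain c0 c1 c2 c3 where c: "c0 > 0" "c1 > 0" "c2 > 0" "c3 > 0"
    "\<And>x. norm x = 1 \<Longrightarrow> c0 \<le> h x" "\<And>x. norm x = 1 \<Longrightarrow> h x \<le> c1"
    "\<And>x v. norm x = 1 \<Longrightarrow> norm v = 1 \<Longrightarrow> dd v (dd v h) x \<le> c2"
    "\<And>x v. norm x = 1 \<Longrightarrow> norm v = 1 \<Longrightarrow> \<bar>dd v h x\<bar> \<le> c3"
    by (rule uniform_bounds) (rule that)
  \<comment> \<open>Lower bound for both radii: their product is C u^(-a) >= C c1^(-a), and neither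
    exceeds \<open>c2\<close>.\<close>
  define \<rho> where "\<rho> = C * c1 powr (- a) / c2"
  have \<rho>: "\<rho> > 0" using C c by (simp add: \<rho>_def)
  have b1: "0 \<le> b" "b < 1" using a b by auto
  \<comment> \<open>Dominates both 2/r1 and 2/r2 + 4/((1 - b) r1); hence each of the two first-order
    error terms is at most E A K g, together the 2 K g of \<open>perturbation_rate\<close>.\<close>
  define k0 where "k0 = 2/\<rho> + 4/((1 - b)*\<rho>)"
  have k0: "k0 \<ge> 0" using \<rho> b1 by (simp add: k0_def)
  define K where "K = c3 * k0"
  obtain A where A: "A > 0"
    "\<And>g l s. g\<^sup>2 + l\<^sup>2 = 1 \<Longrightarrow> l \<le> 1 - \<delta> \<Longrightarrow> c0 * (2/c2) \<le> s \<Longrightarrow> s \<le> c1 * (2/\<rho>) \<Longrightarrow>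
      c0 / c2 * A * g\<^sup>2 - l * s > 2 * K * g"
    using perturbation_rate[of "c0/c2" "c1*(2/\<rho>)" "c0*(2/c2)" \<delta> K] c \<rho> \<delta> by auto
  show thesis
  proof (rule that[OF A(1)], rule notI)
    fix \<epsilon> x e M
    assume \<epsilon>: "\<epsilon> > 0" and x: "norm x = 1" "norm e = 1" "x \<bullet> e = 0" "q \<bullet> x \<le> 1 - \<delta>"
      and up: "is_upper (\<lambda>x. \<epsilon> * exp (A * (q \<bullet> x / norm x))) M"
      and eq: "\<Phi> x e + \<epsilon> * exp (A * (q \<bullet> x)) = M"
    obtain f where F: "frame3 x e f" using frame3_exists x by blast
    then have nf: "norm f = 1" by (simp add: frame3_def)
    define u u1 u2 r1 r2 where "u = h x" "u1 = dd e h x" "u2 = dd f h x"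
      "r1 = dd e (dd e h) x" "r2 = dd f (dd f h) x"
    note ds = u_u1_u2_r1_r2_def
    define l0 l1 l2 where "l0 = q \<bullet> x" "l1 = q \<bullet> e" "l2 = q \<bullet> f"
    note ls = l0_l1_l2_def
    define E where "E = \<epsilon> * exp (A * l0)"
    have E: "E > 0" using \<epsilon> by (simp add: E_def)
    have j1: "jet2 (\<lambda>t. \<epsilon> * exp (A * (q \<bullet> (x + t *\<^sub>R e) / norm (x + t *\<^sub>R e))))
        (\<epsilon> * exp (A * (q \<bullet> x / norm x))) (E * (A * l1)) (E * (A\<^sup>2 * l1\<^sup>2 - A * l0))"
      using jet2_spherical_exp[OF F, of \<epsilon> A q] x by (simp add: E_def ls)
    have j2: "jet2 (\<lambda>t. \<epsilon> * exp (A * (q \<bullet> (x + t *\<^sub>R f) / norm (x + t *\<^sub>R f))))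
        (\<epsilon> * exp (A * (q \<bullet> x / norm x))) (E * (A * l2)) (E * (A\<^sup>2 * l2\<^sup>2 - A * l0))"
      using jet2_spherical_exp[OF frame3_swap[OF F], of \<epsilon> A q] x by (simp add: E_def ls)
    have hom0: "\<epsilon> * exp (A * (q \<bullet> (t *\<^sub>R x) / norm (t *\<^sub>R x))) = \<epsilon> * exp (A * (q \<bullet> x / norm x))"
      if "t > 0" for t x using that by simp
    have eq': "\<Phi> x e + \<epsilon> * exp (A * (q \<bullet> x / norm x)) = M" using eq x by simp
    note L = local_maximum[OF F up eq' hom0 j1 j2, folded ds]
    have r: "r2 > 0" "r2 \<le> r1" "r1 * r2 = C * u powr (- a)" using L(1-3) by simp_all
    have u: "c0 \<le> u" "u \<le> c1" "u > 0" using c(1,5,6) x by (auto simp: ds intro: less_le_trans)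
    have r1: "r1 \<le> c2" "r1 > 0" using c(7) x r by (auto simp: ds)
    have r2: "\<rho> \<le> r2"
    proof -
      have "u powr (- a) \<ge> c1 powr (- a)" using u a by (intro powr_mono2') auto
      then have "C * c1 powr (- a) \<le> r1 * r2" unfolding r(3) using C by simp
      also have "\<dots> \<le> c2 * r2" using r1 r(1) by (intro mult_right_mono) auto
      finally show ?thesis using c(3) by (simp add: \<rho>_def field_simps)
    qed
    have r1': "\<rho> \<le> r1" using r2 r by simp
    have r2': "r2 \<le> c2" using r1 r by simp
    have u12: "\<bar>u1\<bar> \<le> c3" "\<bar>u2\<bar> \<le> c3" using c(8) x nf by (auto simp: ds)
    define g where "g = sqrt (l1\<^sup>2 + l2\<^sup>2)"
    have g2: "g\<^sup>2 = l1\<^sup>2 + l2\<^sup>2" by (simp add: g_def)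
    have gl: "g\<^sup>2 + l0\<^sup>2 = 1" unfolding g2 using frame3_norm_sq[OF F, of q] q by (simp add: ls inner_commute)
    have lg: "\<bar>l1\<bar> \<le> g" "\<bar>l2\<bar> \<le> g" unfolding g_def by (simp_all add: real_le_rsqrt)
    define s where "s = u * (1/r1 + 1/r2)"
    have i1: "1/c2 \<le> 1/r1" "1/c2 \<le> 1/r2" "1/r1 \<le> 1/\<rho>" "1/r2 \<le> 1/\<rho>"
      using r1 r2 r1' r2' r \<rho> c(3) by (simp_all add: frac_le)
    have s: "c0 * (2/c2) \<le> s" "s \<le> c1 * (2/\<rho>)"
    proof -
      have "2/c2 = 1/c2 + 1/c2" "2/\<rho> = 1/\<rho> + 1/\<rho>" by simp_all
      then have "2/c2 \<le> 1/r1 + 1/r2" "1/r1 + 1/r2 \<le> 2/\<rho>" using i1 by linarith+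
      then show "c0 * (2/c2) \<le> s" "s \<le> c1 * (2/\<rho>)"
        unfolding s_def using u(1,2,3) c(1,2,3) r(1) r1(2) by (intro mult_mono; simp)+
    qed
    have main: "c0 / c2 * A * g\<^sup>2 - l0 * s > 2 * K * g"
      by (rule A(2)[OF gl _ s]) (use x ls in auto)
    have k1: "2/r1 \<le> k0"
      unfolding k0_def using r1' \<rho> b1 by (intro add_increasing2 frac_le) auto
    have k2: "2/r2 + 4/((1 - b)*r1) \<le> k0"
      unfolding k0_def using i1 \<rho> b1 r1' r2 by (intro add_mono frac_le mult_left_mono) auto
    have "2*u1*(E*(A*l1))/r1 \<le> \<bar>2*u1*(E*(A*l1))/r1\<bar>" by (rule abs_ge_self)
    also have "\<dots> = E*A*(\<bar>u1\<bar>*(2/r1)*\<bar>l1\<bar>)" using E A r1 by (simp add: abs_mult)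
    also have "\<dots> \<le> E*A*(K*g)"
      unfolding K_def using E A u12 lg k1 k0 r1(2) c(4) by (intro mult_left_mono mult_mono) auto
    finally have t1: "2*u1*(E*(A*l1))/r1 \<le> E*A*(K*g)" .
    have "\<bar>E*(A*l2)\<bar>*\<bar>u2\<bar>*(2/r2 + 4/((1 - b)*r1)) = E*A*(\<bar>u2\<bar>*(2/r2 + 4/((1 - b)*r1))*\<bar>l2\<bar>)"
      using E A by (simp add: abs_mult)
    also have "\<dots> \<le> E*A*(K*g)"
      unfolding K_def using E A u12 lg k2 k0 r(1) r1(2) c(4) b1
      by (intro mult_left_mono mult_mono) (auto intro!: add_nonneg_nonneg)
    finally have t2: "\<bar>E*(A*l2)\<bar>*\<bar>u2\<bar>*(2/r2 + 4/((1 - b)*r1)) \<le> E*A*(K*g)" .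
    have "u*((E*(A\<^sup>2*l1\<^sup>2 - A*l0))/r1 + (E*(A\<^sup>2*l2\<^sup>2 - A*l0))/r2) =
        E*A*(A*(u*(l1\<^sup>2*(1/r1) + l2\<^sup>2*(1/r2))) - l0 * s)"
      by (simp add: s_def algebra_simps power2_eq_square diff_divide_distrib)
    also have "\<dots> \<ge> E*A*(c0 / c2 * A * g\<^sup>2 - l0 * s)"
    proof (intro mult_left_mono diff_right_mono)
      have "c0/c2*g\<^sup>2 = c0*(l1\<^sup>2*(1/c2) + l2\<^sup>2*(1/c2))" by (simp add: g2 add_divide_distrib algebra_simps)
      also have "\<dots> \<le> u*(l1\<^sup>2*(1/r1) + l2\<^sup>2*(1/r2))"
        using u i1 c by (intro mult_mono add_mono mult_left_mono) auto
      finally have "A*(c0/c2*g\<^sup>2) \<le> A*(u*(l1\<^sup>2*(1/r1) + l2\<^sup>2*(1/r2)))" using A by (intro mult_left_mono) auto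
      then show "c0 / c2 * A * g\<^sup>2 \<le> A*(u*(l1\<^sup>2*(1/r1) + l2\<^sup>2*(1/r2)))" by (simp add: mult_ac)
    qed (use E A in auto)
    finally have t3: "u*((E*(A\<^sup>2*l1\<^sup>2 - A*l0))/r1 + (E*(A\<^sup>2*l2\<^sup>2 - A*l0))/r2)
        \<ge> E*A*(c0 / c2 * A * g\<^sup>2 - l0 * s)" .
    have t4: "E*A*(c0 / c2 * A * g\<^sup>2 - l0 * s) > E*A*(2 * K * g)"
      using main E A by simp
    have t5: "u*b*(r1 - r2) \<ge> 0" "a*u1\<^sup>2 \<ge> 0" "(1 - b)\<^sup>2*u2\<^sup>2 \<ge> 0" using u b1 r a by simp_all
    have t6: "E*A*(2 * K * g) = E*A*(K*g) + E*A*(K*g)" by simp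
    show False using L(4) t1 t2 t3 t4 t5 t6 by linarith
  qed
qed

lemma utb_nonempty: "\<exists>v. (q, v) \<in> unit_tangent_bundle" if "norm q = 1" for q
  using unit_orthogonal_exists[of q] that by auto

text \<open>If no maximum of \<Phi> lay over \<open>q\<close>, a cap around \<open>q\<close> would
  avoid all base points of maxima, and \<Phi> <= M - \<tau> there for some \<tau> > 0. A barrier
  bounded by \<tau> cannot lift the cap above M, but lifts a true maximum strictly above it. So the
  perturbed maximum lies outside the cap, where \<open>no_perturbed_maximum\<close> forbids
  it.\<close>

lemma maximum_attained_everywhere:
  obtains M where "is_upper (\<lambda>x. 0) M" "\<And>q. norm q = 1 \<Longrightarrow> \<exists>v. norm v = 1 \<and> q \<bullet> v = 0 \<and> \<Phi> q v = M"
proof -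
  let ?U = "unit_tangent_bundle"
  have "norm (axis 1 1 :: real^3) = 1" by simp
  then have une: "?U \<noteq> {}" using utb_nonempty by blast
  note c\<Phi> = continuous_on_\<Phi>[OF utb_subset]
  obtain p0 where p0: "p0 \<in> ?U" "\<And>p. p \<in> ?U \<Longrightarrow> \<Phi> (fst p) (snd p) \<le> \<Phi> (fst p0) (snd p0)"
    using continuous_attains_sup[OF compact_utb une c\<Phi>] by blast
  define M where "M = \<Phi> (fst p0) (snd p0)"
  have up: "is_upper (\<lambda>x. 0) M" unfolding is_upper_def M_def using p0(2) by force
  show thesis
  proof (rule that[OF up], rule ccontr)
    fix q assume q: "norm q = 1" and no: "\<not> (\<exists>v. norm v = 1 \<and> q \<bullet> v = 0 \<and> \<Phi> q v = M)"
    have strict: "\<Phi> q v < M" if "(q, v) \<in> ?U" for v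
      using p0(2)[OF that] no that by (auto simp: M_def order_less_le)
    define T where "T = {p \<in> ?U. \<Phi> (fst p) (snd p) = M}"
    have T: "compact T"
    proof -
      have "closedin (top_of_set ?U) (?U \<inter> (\<lambda>p. \<Phi> (fst p) (snd p)) -` {M})"
        by (intro continuous_closedin_preimage[OF c\<Phi>]) simp
      moreover have "?U \<inter> (\<lambda>p. \<Phi> (fst p) (snd p)) -` {M} = T" by (auto simp: T_def)
      ultimately show ?thesis using closedin_compact[OF compact_utb] by simp
    qed
    have "p0 \<in> T" using p0(1) by (simp add: T_def M_def)
    then have "T \<noteq> {}" by blast
    moreover have "continuous_on T (\<lambda>p. q \<bullet> fst p)" by (intro continuous_intros)
    ultimately obtain p1 where p1: "p1 \<in> T" "\<And>p. p \<in> T \<Longrightarrow> q \<bullet> fst p \<le> q \<bullet> fst p1"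
      using continuous_attains_sup[OF T] by blast
    have n1: "norm (fst p1) = 1" using p1(1) by (auto simp: T_def)
    have "q \<bullet> fst p1 \<noteq> 1"
    proof
      assume "q \<bullet> fst p1 = 1"
      then have "q = fst p1" using norm_cauchy_schwarz_eq[of q "fst p1"] q n1 by simp
      then show False using strict[of "snd p1"] p1(1) by (auto simp: T_def)
    qed
    moreover have "q \<bullet> fst p1 \<le> 1" using norm_cauchy_schwarz[of q "fst p1"] q n1 by simp
    ultimately have lt: "q \<bullet> fst p1 < 1" by simp
    \<comment> \<open>Half the gap between 1 and the largest q . x over base points of maxima, so
      the cap q . x >= 1 - \<delta> contains none of them; \<open>max 0\<close> keeps \<delta> <=
      1.\<close>
    define \<delta> where "\<delta> = (1 - max 0 (q \<bullet> fst p1)) / 2"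
    have \<delta>: "0 < \<delta>" "\<delta> \<le> 1" "q \<bullet> fst p1 < 1 - \<delta>" 
      using lt by (simp_all add: \<delta>_def max_def field_simps)
    define S where "S = {p \<in> ?U. q \<bullet> fst p \<ge> 1 - \<delta>}"
    have S: "compact S"
    proof -
      have "S = ?U \<inter> {p. q \<bullet> fst p \<ge> 1 - \<delta>}" by (auto simp: S_def)
      moreover have "closed {p :: (real^3) \<times> (real^3). q \<bullet> fst p \<ge> 1 - \<delta>}"
        by (intro closed_Collect_le continuous_intros)
      ultimately show ?thesis using compact_Int_closed[OF compact_utb] by simp
    qed
    obtain v0 where "(q, v0) \<in> ?U" using utb_nonempty[OF q] by blast
    then have "(q, v0) \<in> S" using q \<delta>(1) by (simp add: S_def norm_eq_1)
    then have "S \<noteq> {}" by auto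
    moreover have "continuous_on S (\<lambda>p. \<Phi> (fst p) (snd p))"
      using c\<Phi> by (rule continuous_on_subset) (auto simp: S_def)
    ultimately obtain p2 where p2: "p2 \<in> S" "\<And>p. p \<in> S \<Longrightarrow> \<Phi> (fst p) (snd p) \<le> \<Phi> (fst p2) (snd p2)"
      using continuous_attains_sup[OF S] by blast
    define \<tau> where "\<tau> = M - \<Phi> (fst p2) (snd p2)"
    have \<tau>: "\<tau> > 0"
    proof -
      have "\<Phi> (fst p2) (snd p2) \<le> M" using p2(1) p0(2) by (auto simp: S_def M_def)
      moreover have "\<Phi> (fst p2) (snd p2) \<noteq> M"
      proof
        assume "\<Phi> (fst p2) (snd p2) = M"
        then have "p2 \<in> T" using p2(1) by (auto simp: T_def S_def)
        then show False using p1(2)[of p2] \<delta>(3) p2(1) by (auto simp: S_def)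
      qed
      ultimately show ?thesis by (simp add: \<tau>_def)
    qed
    obtain A where A: "A > 0" "\<And>\<epsilon> x e M. \<epsilon> > 0 \<Longrightarrow> norm x = 1 \<Longrightarrow> norm e = 1 \<Longrightarrow> x \<bullet> e = 0 \<Longrightarrow> q \<bullet> x \<le> 1 - \<delta> \<Longrightarrow>
     is_upper (\<lambda>x. \<epsilon> * exp (A * (q \<bullet> x / norm x))) M \<Longrightarrow> \<Phi> x e + \<epsilon> * exp (A * (q \<bullet> x)) \<noteq> M"
      using no_perturbed_maximum[OF \<delta>(1,2) q] by blast
    \<comment> \<open>On the sphere q . x <= 1, so the perturbation is at most \<epsilon> exp A =
      \<tau>.\<close>
    define \<epsilon> where "\<epsilon> = \<tau> / exp A"
    have \<epsilon>: "\<epsilon> > 0" using \<tau> by (simp add: \<epsilon>_def)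
    let ?\<psi> = "\<lambda>x. \<epsilon> * exp (A * (q \<bullet> x / norm x))"
    have "continuous_on ?U (\<lambda>p. \<Phi> (fst p) (snd p) + ?\<psi> (fst p))"
      by (intro continuous_intros c\<Phi>) auto
    then obtain p3 where p3: "p3 \<in> ?U"
      "\<And>p. p \<in> ?U \<Longrightarrow> \<Phi> (fst p) (snd p) + ?\<psi> (fst p) \<le> \<Phi> (fst p3) (snd p3) + ?\<psi> (fst p3)"
      using continuous_attains_sup[OF compact_utb une] by blast
    have up3: "is_upper ?\<psi> (\<Phi> (fst p3) (snd p3) + ?\<psi> (fst p3))"
      unfolding is_upper_def using p3(2) by force
    have n3: "norm (fst p3) = 1" "norm (snd p3) = 1" "fst p3 \<bullet> snd p3 = 0" using p3(1) by auto
    have "q \<bullet> fst p3 \<le> 1 - \<delta>"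
    proof (rule ccontr)
      assume "\<not> ?thesis"
      then have "p3 \<in> S" using p3(1) by (simp add: S_def)
      then have "\<Phi> (fst p3) (snd p3) \<le> M - \<tau>" using p2(2) by (simp add: \<tau>_def)
      moreover have "q \<bullet> fst p3 \<le> 1" using norm_cauchy_schwarz[of q "fst p3"] q n3 by simp
      then have "?\<psi> (fst p3) \<le> \<tau>" using \<tau> A(1) n3 by (simp add: \<epsilon>_def divide_simps)
      moreover have "?\<psi> (fst p0) > 0" using \<epsilon> by simp
      ultimately show False using p3(2)[OF p0(1)] by (simp add: M_def)
    qed
    then show False using A(2)[OF \<epsilon> n3 _ up3] n3 by simp
  qed
qed

lemma tangential_gradient_zero:
  assumes "norm x = 1" "x \<bullet> w = 0"
  shows "dd w h x = 0"
proof -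
  obtain M where M: "is_upper (\<lambda>x. 0) M" "\<And>q. norm q = 1 \<Longrightarrow> \<exists>v. norm v = 1 \<and> q \<bullet> v = 0 \<and> \<Phi> q v = M"
    by (rule maximum_attained_everywhere) (rule that)
  obtain e where e: "norm e = 1" "x \<bullet> e = 0" "\<Phi> x e = M" using M(2) assms(1) by blast
  obtain f where F: "frame3 x e f" using frame3_exists assms(1) e by blast
  have x0: "x \<noteq> 0" using assms by auto
  have "w = (e \<bullet> w) *\<^sub>R e + (f \<bullet> w) *\<^sub>R f" using frame3_expansion[OF F, of w] assms(2) by simp
  then have "dd w h x = dd ((e \<bullet> w) *\<^sub>R e + (f \<bullet> w) *\<^sub>R f) h x" by simp
  also have "\<dots> = (e \<bullet> w) * dd e h x + (f \<bullet> w) * dd f h x"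
    using linear_add[OF linear_dd] linear_cmul[OF linear_dd] x0 by simp
  finally show ?thesis using gradient_vanishes_at_maximum[OF F M(1) e(3)] by simp
qed

text \<open>With vanishing tangential part the gradient is radial, so h/|x| has derivative zero on
  the connected punctured space.\<close>

theorem h_eq_norm: "\<exists>r. \<forall>x. x \<noteq> 0 \<longrightarrow> h x = r * norm x"
proof -
  have dh: "dd v h x = h x * (x \<bullet> v) / (x \<bullet> x)" if x: "x \<noteq> 0" for x v
  proof -
    define n where "n = norm x"
    have n: "n > 0" using x by (simp add: n_def)
    define y where "y = (1/n) *\<^sub>R x"
    have y: "norm y = 1" "x = n *\<^sub>R y" using n by (simp_all add: y_def n_def)
    then have yy: "y \<bullet> y = 1" "y \<noteq> 0" by (auto simp: norm_eq_1)
    have "dd (v - (y \<bullet> v) *\<^sub>R y) h y = 0"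
      using y yy by (intro tangential_gradient_zero) (auto simp: inner_diff_right)
    then have "dd v h y = (y \<bullet> v) * h y"
      using linear_diff[OF linear_dd] linear_cmul[OF linear_dd] yy dd_self(1)[of y] by simp
    then show ?thesis using n yy unfolding y(2) by (simp add: dd_h_homogeneous hom)
  qed
  have der: "((\<lambda>x. h x / norm x) has_derivative (\<lambda>v. 0)) (at x)" if "x \<in> P" for x
  proof -
    have x: "x \<noteq> 0" using that by simp
    have "((\<lambda>x. h x / norm x) has_derivative
       (\<lambda>v. - h x * (inverse (norm x) * (v \<bullet> sgn x) * inverse (norm x)) + dd v h x / norm x)) (at x)"
      by (rule has_derivative_divide[OF has_derivative_dd has_derivative_norm])  (use x in auto)
    moreover have "- h x * (inverse (norm x) * (v \<bullet> sgn x) * inverse (norm x)) + dd v h x / norm x = 0" for v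
      using x unfolding dh[OF x]
      by (simp add: sgn_div_norm inner_commute power2_norm_eq_inner[symmetric] power2_eq_square field_simps)
    ultimately show ?thesis by simp
  qed
  have con: "connected P" by (intro connected_punctured_universe) simp
  show ?thesis
  proof (intro exI allI impI)
    fix x :: "real^3" assume "x \<noteq> 0"
    then have "h x / norm x = h (axis 1 1) / norm (axis 1 1 :: real^3)"
      by (intro has_derivative_zero_unique_connected[OF open_P con der]) (auto simp: axis_eq_0_iff)
    then show "h x = (h (axis 1 1) / norm (axis 1 1 :: real^3)) * norm x"
      using \<open>x \<noteq> 0\<close> by (simp add: field_simps)
  qed
qed

end

section \<open>Gauss curvature and supporting planes\<close>

text \<open>An extremal value of a quadratic form on the unit circle is an eigenvalue: the form
  minus it is semidefinite with a nontrivial zero, hence has determinant zero. Completing the square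
  shows this directly when m > \<alpha>; for m = \<alpha> semidefiniteness forces \<beta> =
  0.\<close>

lemma quadratic_form_extremum:
  fixes \<alpha> \<beta> \<gamma> m c0 s0 :: real
  assumes le: "\<And>c s. 0 \<le> (m - \<alpha>) * c\<^sup>2 - 2 * \<beta> * c * s + (m - \<gamma>) * s\<^sup>2"
    and eq: "(m - \<alpha>) * c0\<^sup>2 - 2 * \<beta> * c0 * s0 + (m - \<gamma>) * s0\<^sup>2 = 0" "c0\<^sup>2 + s0\<^sup>2 = 1"
  shows "(m - \<alpha>) * (m - \<gamma>) = \<beta>\<^sup>2"
proof -
  define A D where "A = m - \<alpha>" "D = m - \<gamma>"
  have q: "0 \<le> A * c\<^sup>2 - 2 * \<beta> * c * s + D * s\<^sup>2" for c s using le by (simp add: A_D_def)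
  have q0: "A * c0\<^sup>2 - 2 * \<beta> * c0 * s0 + D * s0\<^sup>2 = 0" using eq by (simp add: A_D_def)
  have A: "A \<ge> 0" using q[of 1 0] by simp
  show ?thesis
  proof (cases "A = 0")
    case True
    have "\<beta> = 0"
    proof (rule ccontr)
      assume "\<beta> \<noteq> 0"
      then have "2 * \<beta> * ((\<bar>D\<bar> + 1) / \<beta>) * 1 = 2 * (\<bar>D\<bar> + 1)" by simp
      then have "0 \<le> D - 2 * (\<bar>D\<bar> + 1)" using q[of "(\<bar>D\<bar> + 1) / \<beta>" 1] True by simp
      then show False using abs_ge_self[of D] abs_ge_zero[of D] by argo
    qed
    then show ?thesis using True by (simp add: A_D_def)
  next
    case False
    with A have A: "A > 0" by simp
    have "0 \<le> A * (A * D - \<beta>\<^sup>2)" using q[of \<beta> A] by (simp add: algebra_simps power2_eq_square)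
    then have ge: "0 \<le> A * D - \<beta>\<^sup>2" using A by (simp add: zero_le_mult_iff)
    have "(A * c0 - \<beta> * s0)\<^sup>2 + (A * D - \<beta>\<^sup>2) * s0\<^sup>2 = A * (A * c0\<^sup>2 - 2 * \<beta> * c0 * s0 + D * s0\<^sup>2)"
      by (simp add: algebra_simps power2_eq_square)
    then have "(A * c0 - \<beta> * s0)\<^sup>2 + (A * D - \<beta>\<^sup>2) * s0\<^sup>2 = 0" unfolding q0 by simp
    moreover have "(A * D - \<beta>\<^sup>2) * s0\<^sup>2 \<ge> 0" using ge by simp
    ultimately have *: "(A * c0 - \<beta> * s0)\<^sup>2 = 0" "(A * D - \<beta>\<^sup>2) * s0\<^sup>2 = 0"
      using zero_le_power2[of "A * c0 - \<beta> * s0"] by linarith+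
    have "s0 \<noteq> 0" using *(1) eq(2) A by auto
    then show ?thesis using *(2) by (simp add: A_D_def)
  qed
qed

text \<open>Maximum and minimum are roots of the characteristic polynomial (the minimum by negating
  the form), so Vieta gives their product as the determinant. Equal extrema do not determine both
  roots; then the form is a multiple of the identity. The unit circle is taken in the complex plane
  for its compactness.\<close>

lemma quadratic_form_Sup_Inf:
  fixes \<alpha> \<beta> \<gamma> :: real
  defines "q \<equiv> \<lambda>c s. \<alpha> * c\<^sup>2 + 2 * \<beta> * c * s + \<gamma> * s\<^sup>2"
  defines "S \<equiv> {q c s | c s. c\<^sup>2 + s\<^sup>2 = 1}"
  shows "Sup S * Inf S = \<alpha> * \<gamma> - \<beta>\<^sup>2"
proof -
  have S: "S = (\<lambda>z. q (Re z) (Im z)) ` sphere 0 1"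
  proof (intro equalityI subsetI)
    fix r assume "r \<in> S"
    then obtain c s where "r = q c s" "c\<^sup>2 + s\<^sup>2 = 1" by (auto simp: S_def)
    then show "r \<in> (\<lambda>z. q (Re z) (Im z)) ` sphere 0 1"
      by (intro image_eqI[of _ _ "Complex c s"]) (auto simp: complex_norm)
  next
    fix r assume "r \<in> (\<lambda>z. q (Re z) (Im z)) ` sphere 0 1"
    then obtain z where "r = q (Re z) (Im z)" "(Re z)\<^sup>2 + (Im z)\<^sup>2 = 1" by (auto simp: cmod_def)
    then show "r \<in> S" unfolding S_def by blast
  qed
  have cont: "continuous_on (sphere 0 1) (\<lambda>z. q (Re z) (Im z))"
    unfolding q_def by (intro continuous_intros)
  have ne: "sphere (0::complex) 1 \<noteq> {}" by simp
  obtain M where "M \<in> S" and M: "\<And>r. r \<in> S \<Longrightarrow> r \<le> M"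
    using continuous_attains_sup[OF compact_sphere ne cont] unfolding S by blast
  obtain m where "m \<in> S" and m: "\<And>r. r \<in> S \<Longrightarrow> m \<le> r"
    using continuous_attains_inf[OF compact_sphere ne cont] unfolding S by blast
  from \<open>M \<in> S\<close> obtain c0 s0 where M0: "M = q c0 s0" "c0\<^sup>2 + s0\<^sup>2 = 1" by (auto simp: S_def)
  from \<open>m \<in> S\<close> obtain c1 s1 where m0: "m = q c1 s1" "c1\<^sup>2 + s1\<^sup>2 = 1" by (auto simp: S_def)
  have scale: "\<exists>r\<in>S. q c s = (c\<^sup>2 + s\<^sup>2) * r" for c s
  proof (cases "c = 0 \<and> s = 0")
    case True then show ?thesis using \<open>M \<in> S\<close> by (auto simp: q_def)
  next
    case False
    define n where "n = sqrt (c\<^sup>2 + s\<^sup>2)"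
    have n: "n > 0" "n\<^sup>2 = c\<^sup>2 + s\<^sup>2" using False by (auto simp: n_def sum_power2_gt_zero_iff)
    have "(c/n)\<^sup>2 + (s/n)\<^sup>2 = (c\<^sup>2 + s\<^sup>2) / n\<^sup>2" by (simp add: power_divide add_divide_distrib)
    also have "\<dots> = 1" using n by (metis divide_self power_not_zero less_irrefl)
    finally have "q (c/n) (s/n) \<in> S" unfolding S_def by blast
    moreover have "q c s = n\<^sup>2 * q (c/n) (s/n)"
      using n(1) by (simp add: q_def power2_eq_square field_simps)
    ultimately show ?thesis using n by auto
  qed
  have leM: "q c s \<le> M * (c\<^sup>2 + s\<^sup>2)" for c s
  proof -
    obtain r where r: "r \<in> S" "q c s = (c\<^sup>2 + s\<^sup>2) * r" using scale by blast
    then show ?thesis using mult_left_mono[OF M[OF r(1)], of "c\<^sup>2 + s\<^sup>2"] by (simp add: mult.commute)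
  qed
  have gem: "q c s \<ge> m * (c\<^sup>2 + s\<^sup>2)" for c s
  proof -
    obtain r where r: "r \<in> S" "q c s = (c\<^sup>2 + s\<^sup>2) * r" using scale by blast
    then show ?thesis using mult_left_mono[OF m[OF r(1)], of "c\<^sup>2 + s\<^sup>2"] by (simp add: mult.commute)
  qed
  have MM: "(M - \<alpha>) * (M - \<gamma>) = \<beta>\<^sup>2"
  proof (rule quadratic_form_extremum[of _ _ _ _ c0 s0])
    show "0 \<le> (M - \<alpha>) * c\<^sup>2 - 2 * \<beta> * c * s + (M - \<gamma>) * s\<^sup>2" for c s
      using leM[of c s] by (simp add: q_def algebra_simps)
    show "(M - \<alpha>) * c0\<^sup>2 - 2 * \<beta> * c0 * s0 + (M - \<gamma>) * s0\<^sup>2 = 0"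
    proof -
      have "M * (c0\<^sup>2 + s0\<^sup>2) = q c0 s0" using M0 by simp
      then show ?thesis by (simp add: q_def algebra_simps)
    qed
  qed (rule M0)
  have mm: "(m - \<alpha>) * (m - \<gamma>) = \<beta>\<^sup>2"
  proof -
    have "(- m - - \<alpha>) * (- m - - \<gamma>) = (- \<beta>)\<^sup>2"
    proof (rule quadratic_form_extremum[of _ _ _ _ c1 s1])
      show "0 \<le> (- m - - \<alpha>) * c\<^sup>2 - 2 * - \<beta> * c * s + (- m - - \<gamma>) * s\<^sup>2" for c s
        using gem[of c s] by (simp add: q_def algebra_simps)
      show "(- m - - \<alpha>) * c1\<^sup>2 - 2 * - \<beta> * c1 * s1 + (- m - - \<gamma>) * s1\<^sup>2 = 0"
      proof -
        have "m * (c1\<^sup>2 + s1\<^sup>2) = q c1 s1" using m0 by simp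
        then show ?thesis by (simp add: q_def algebra_simps)
      qed
    qed (rule m0)
    then show ?thesis by (simp add: algebra_simps)
  qed
  have "Sup S = M" "Inf S = m"
    using \<open>M \<in> S\<close> \<open>m \<in> S\<close> M m by (auto intro!: cSup_eq_maximum cInf_eq_minimum)
  moreover have "M * m = \<alpha> * \<gamma> - \<beta>\<^sup>2"
  proof (cases "M = m")
    case True
    have "q 1 0 \<le> M" "q 1 0 \<ge> m" "q 0 1 \<le> M" "q 0 1 \<ge> m" using leM[of 1 0] gem[of 1 0] leM[of 0 1] gem[of 0 1] by simp_all
    then have "\<alpha> = M" "\<gamma> = M" using True by (simp_all add: q_def)
    then show ?thesis using MM True by (simp add: power2_eq_square)
  next
    case False
    have "(M - m) * (M + m - (\<alpha> + \<gamma>)) = 0" using MM mm by (simp add: algebra_simps)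
    then have s: "m = \<alpha> + \<gamma> - M" using False by simp
    show ?thesis using MM unfolding s by (simp add: algebra_simps)
  qed
  ultimately show ?thesis by simp
qed

lemma hess3_symmetric:
  assumes "open U" "Ck 2 U f" "x \<in> U"
  shows "hess3 f x $ i $ j = hess3 f x $ j $ i"
  using dd_swap[OF assms] by (simp add: hess3_def pderiv3_eq_dd)

text \<open>Bridges the definition of the curvature by \<open>Sup\<close> and \<open>Inf\<close>
  over tangent directions and the determinant of the second fundamental form in an arbitrary tangent
  frame.\<close>

lemma gauss_curv_frame:
  assumes "frame3 x e1 e2" "grad3 f y = m *\<^sub>R x" "m > 0" "open U" "Ck 2 U f" "y \<in> U"
  defines "II \<equiv> \<lambda>v w. (v \<bullet> (hess3 f y *v w)) / m"
  shows "gauss_curv f y = II e1 e1 * II e2 e2 - (II e1 e2)\<^sup>2" "II e2 e1 = II e1 e2"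
proof -
  note i = frame3_inner[OF assms(1)]
  have "transpose (hess3 f y) = hess3 f y"
    using hess3_symmetric[OF assms(4-6)] by (simp add: vec_eq_iff transpose_def)
  then have sym: "v \<bullet> (hess3 f y *v w) = w \<bullet> (hess3 f y *v v)" for v w
    using dot_lmul_matrix[of v "hess3 f y" w] by (metis inner_commute transpose_matrix_vector)
  then show c: "II e2 e1 = II e1 e2" by (simp add: II_def)
  have m: "norm (grad3 f y) = m" using assms(1-3) by (simp add: frame3_def)
  have sff: "second_ff f y (c *\<^sub>R e1 + s *\<^sub>R e2) = II e1 e1 * c\<^sup>2 + 2 * II e1 e2 * c * s + II e2 e2 * s\<^sup>2" for c s
    unfolding second_ff_def m II_def using sym[of e2 e1]
    by (simp add: matrix_vector_right_distrib matrix_vector_mult_scaleR inner_add_left inner_add_right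
        power2_eq_square add_divide_distrib algebra_simps)
  have ut: "unit_tangents f y = {c *\<^sub>R e1 + s *\<^sub>R e2 | c s. c\<^sup>2 + s\<^sup>2 = 1}"
  proof (intro equalityI subsetI)
    fix v assume v: "v \<in> unit_tangents f y"
    then have "x \<bullet> v = 0" "norm v = 1" using assms(2,3) by (auto simp: unit_tangents_def inner_commute)
    then have "v = (e1 \<bullet> v) *\<^sub>R e1 + (e2 \<bullet> v) *\<^sub>R e2" "(e1 \<bullet> v)\<^sup>2 + (e2 \<bullet> v)\<^sup>2 = 1"
      using frame3_expansion[OF assms(1), of v] frame3_norm_sq[OF assms(1), of v] by simp_all
    then show "v \<in> {c *\<^sub>R e1 + s *\<^sub>R e2 | c s. c\<^sup>2 + s\<^sup>2 = 1}" by blast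
  next
    fix v assume "v \<in> {c *\<^sub>R e1 + s *\<^sub>R e2 | c s. c\<^sup>2 + s\<^sup>2 = 1}"
    then obtain c s where v: "v = c *\<^sub>R e1 + s *\<^sub>R e2" "c\<^sup>2 + s\<^sup>2 = 1" by blast
    have "v \<bullet> v = 1" unfolding v(1) using v(2) by (simp add: inner_add_left inner_add_right i power2_eq_square)
    moreover have "v \<bullet> grad3 f y = 0" unfolding v(1) assms(2) by (simp add: inner_add_left i)
    ultimately show "v \<in> unit_tangents f y" by (simp add: unit_tangents_def norm_eq_1)
  qed
  have "second_ff f y ` unit_tangents f y =
      {II e1 e1 * c\<^sup>2 + 2 * II e1 e2 * c * s + II e2 e2 * s\<^sup>2 | c s. c\<^sup>2 + s\<^sup>2 = 1}"
    unfolding ut by (force simp: sff)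
  then show "gauss_curv f y = II e1 e1 * II e2 e2 - (II e1 e2)\<^sup>2"
    unfolding gauss_curv_def kappa1_def kappa2_def by (simp only: quadratic_form_Sup_Inf)
qed

locale smooth_body =
  fixes K :: "(real^3) set"
  assumes compact: "compact K" and convex: "convex K" and int0: "0 \<in> interior K"
    and boundary: "Ck_boundary 4 K"
begin

abbreviation "h \<equiv> support_fn K"

lemma support_fn_attained: "\<exists>y\<in>K. h x = x \<bullet> y"
  and support_fn_ge: "y \<in> K \<Longrightarrow> x \<bullet> y \<le> h x"
proof -
  have ne: "K \<noteq> {}" using int0 interior_subset by blast
  have "continuous_on K (\<lambda>y. x \<bullet> y)" by (intro continuous_intros)
  then obtain y where y: "y \<in> K" "\<And>z. z \<in> K \<Longrightarrow> x \<bullet> z \<le> x \<bullet> y"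
    using continuous_attains_sup[OF compact ne] by blast
  have "h x = x \<bullet> y" unfolding support_fn_def by (rule cSup_eq_maximum) (use y in auto)
  then show "\<exists>y\<in>K. h x = x \<bullet> y" "y \<in> K \<Longrightarrow> x \<bullet> y \<le> h x" for y using y by auto
qed

lemma support_fn_eqI: "y \<in> K \<Longrightarrow> (\<And>z. z \<in> K \<Longrightarrow> x \<bullet> z \<le> x \<bullet> y) \<Longrightarrow> h x = x \<bullet> y"
  using support_fn_attained[of x] support_fn_ge[of y x] by force

lemma support_fn_scale: "t > 0 \<Longrightarrow> h (t *\<^sub>R x) = t * h x"
proof -
  assume t: "t > 0"
  obtain y where "y \<in> K" "h x = x \<bullet> y" using support_fn_attained by blast
  then show ?thesis using t support_fn_ge[of _ x] by (subst support_fn_eqI[of y]) auto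
qed

lemma support_fn_pos: "x \<noteq> 0 \<Longrightarrow> h x > 0"
proof -
  assume x: "x \<noteq> 0"
  obtain e where e: "e > 0" "cball 0 e \<subseteq> K" using int0 by (auto simp: mem_interior_cball)
  have "(e / norm x) *\<^sub>R x \<in> K" using e x by (intro subsetD[OF e(2)]) simp
  from support_fn_ge[OF this, of x] have "h x \<ge> (e / norm x) * (x \<bullet> x)" by simp
  moreover have "(e / norm x) * (x \<bullet> x) > 0" using e x by simp
  ultimately show ?thesis by simp
qed

lemma mem_iff_defining_fn: "local_defining_fn k K y U f \<Longrightarrow> z \<in> U \<Longrightarrow> z \<in> K \<longleftrightarrow> f z \<le> 0"
  unfolding local_defining_fn_def by blast

lemma defining_fn_zero:
  assumes "y \<in> frontier K" "local_defining_fn k K y U f"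
  shows "f y = 0"
proof (rule ccontr)
  assume ne: "f y \<noteq> 0"
  have U: "open U" "y \<in> U" "Ck k U f"
    using assms(2) by (simp_all add: local_defining_fn_def)
  note mem = mem_iff_defining_fn[OF assms(2)]
  have "y \<in> K" using assms(1) compact by (simp add: compact_imp_closed frontier_def closure_closed)
  then have "f y < 0" using mem[OF U(2)] ne by simp
  have "open (U \<inter> f -` {..<0})" using Ck_continuous_on[OF U(3)] U(1)
    by (rule continuous_open_preimage) simp
  moreover have "U \<inter> f -` {..<0} \<subseteq> K" using mem by fastforce
  moreover have "y \<in> U \<inter> f -` {..<0}" using U(2) \<open>f y < 0\<close> by simp
  ultimately have "y \<in> interior K" by (meson interiorI)
  then show False using assms(1) by (simp add: frontier_def)
qed

lemma differentiable_defining_fn: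
  assumes "local_defining_fn (Suc k) K y U f" "z \<in> U" shows "f differentiable (at z)"
  using assms by (auto simp: local_defining_fn_def)

text \<open>Otherwise \<open>f\<close> would become positive when leaving \<open>z\<close> along the
  segment to \<open>w\<close>, which by convexity stays in \<open>K\<close>.\<close>

lemma defining_fn_supporting:
  assumes f: "local_defining_fn (Suc k) K y U f" and z: "z \<in> U" "f z = 0" and w: "w \<in> K"
  shows "grad3 f z \<bullet> (w - z) \<le> 0"
proof (rule ccontr)
  assume neg: "\<not> grad3 f z \<bullet> (w - z) \<le> 0"
  have U: "open U" using f by (auto simp: local_defining_fn_def)
  have fd: "f differentiable (at z)" using differentiable_defining_fn[OF f z(1)] .
  have zK: "z \<in> K" using mem_iff_defining_fn[OF f z(1)] z(2) by simp
  have D: "((\<lambda>t. f (z + t *\<^sub>R (w - z))) has_real_derivative dd (w - z) f z) (at 0)"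
    using has_real_derivative_line[of f z 0 "w - z"] fd by simp
  have "dd (w - z) f z > 0" using neg by (simp add: dd_eq_grad3[OF fd] inner_commute)
  from DERIV_pos_inc_right[OF D this] obtain d where
    d: "d > 0" "\<And>t. 0 < t \<Longrightarrow> t < d \<Longrightarrow> f z < f (z + t *\<^sub>R (w - z))" by auto
  have "((\<lambda>t. z + t *\<^sub>R (w - z)) \<longlongrightarrow> z + 0 *\<^sub>R (w - z)) (nhds 0)"
    by (intro tendsto_intros filterlim_ident)
  then have "\<forall>\<^sub>F t in nhds 0. z + t *\<^sub>R (w - z) \<in> U" using U z(1) topological_tendstoD by fastforce
  then obtain e where e: "e > 0" "\<And>t. dist t 0 < e \<Longrightarrow> z + t *\<^sub>R (w - z) \<in> U"
    unfolding eventually_nhds_metric by blast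
  define t where "t = min (min d e) 1 / 2"
  have t: "0 < t" "t < d" "t < e" "t \<le> 1" using d e by (auto simp: t_def)
  have "z + t *\<^sub>R (w - z) = (1 - t) *\<^sub>R z + t *\<^sub>R w" by (simp add: algebra_simps)
  then have "z + t *\<^sub>R (w - z) \<in> K" using convexD_alt[OF convex zK w, of t] t by simp
  then have "f (z + t *\<^sub>R (w - z)) \<le> 0"
    using mem_iff_defining_fn[OF f e(2)[of t]] t by simp
  then show False using d(2)[of t] t z(2) by simp
qed

lemma support_fn_at_normal:
  assumes f: "local_defining_fn (Suc k) K y U f" and z: "z \<in> U" "f z = 0"
    and x: "x = c *\<^sub>R grad3 f z" "c \<ge> 0"
  shows "z \<in> K" "h x = x \<bullet> z"
proof -
  show zK: "z \<in> K" using mem_iff_defining_fn[OF f z(1)] z(2) by simp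
  show "h x = x \<bullet> z"
  proof (rule support_fn_eqI[OF zK])
    fix w assume "w \<in> K"
    from mult_left_mono[OF defining_fn_supporting[OF f z this] x(2)]
    show "x \<bullet> w \<le> x \<bullet> z" by (simp add: x(1) inner_diff_right algebra_simps)
  qed
qed

text \<open>At a point where x . y is maximal over \<open>K\<close>, every direction
  \<open>v\<close> with n . v < 0 enters \<open>K\<close> and so has x . v <= 0. One half space
  contained in the other forces x = n.\<close>

lemma normal_attained:
  assumes x: "norm x = 1"
  obtains y U f where "y \<in> frontier K" "local_defining_fn 4 K y U f" "outer_normal f y = x"
proof -
  obtain y where y: "y \<in> K" "h x = x \<bullet> y" using support_fn_attained by blast
  have "y \<notin> interior K"
  proof
    assume "y \<in> interior K"
    then obtain e where e: "e > 0" "cball y e \<subseteq> K" by (auto simp: mem_interior_cball)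
    then have "y + e *\<^sub>R x \<in> K" using x by (intro subsetD[OF e(2)]) (simp add: dist_norm)
    from support_fn_ge[OF this, of x] have "e * (x \<bullet> x) \<le> 0" using y by (simp add: inner_add_right)
    then show False using e x by (simp add: norm_eq_1)
  qed
  then have yf: "y \<in> frontier K" using y(1) closure_subset by (auto simp: frontier_def)
  then obtain U f where f: "local_defining_fn 4 K y U f" using boundary by (auto simp: Ck_boundary_def)
  then have U: "open U" "y \<in> U" "grad3 f y \<noteq> 0"
    by (simp_all add: local_defining_fn_def)
  have f0: "f y = 0" using defining_fn_zero[OF yf f] .
  have fd: "f differentiable (at y)" using differentiable_defining_fn[of 3 y U f y] f U(2) by simp
  define n where "n = outer_normal f y"
  have n: "norm n = 1" "grad3 f y = norm (grad3 f y) *\<^sub>R n" using U(3) by (simp_all add: n_def outer_normal_def)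
  then have nn: "n \<bullet> n = 1" by (simp add: norm_eq_1)
  have half: "x \<bullet> v \<le> 0" if "n \<bullet> v < 0" for v
  proof -
    have D: "((\<lambda>t. f (y + t *\<^sub>R v)) has_real_derivative dd v f y) (at 0)"
      using has_real_derivative_line[of f y 0 v] fd by simp
    have "norm (grad3 f y) * (n \<bullet> v) < 0" using that U(3) by (simp add: mult_pos_neg)
    then have "dd v f y < 0" unfolding dd_eq_grad3[OF fd]
      by (subst n(2)) (simp add: inner_commute)
    from DERIV_neg_dec_right[OF D this] obtain d where
      d: "d > 0" "\<And>t. 0 < t \<Longrightarrow> t < d \<Longrightarrow> f (y + t *\<^sub>R v) < f y" by auto
    have "((\<lambda>t. y + t *\<^sub>R v) \<longlongrightarrow> y + 0 *\<^sub>R v) (nhds 0)"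
      by (intro tendsto_intros filterlim_ident)
    then have "\<forall>\<^sub>F t in nhds 0. y + t *\<^sub>R v \<in> U" using U(1,2) topological_tendstoD by fastforce
    then obtain e where e: "e > 0" "\<And>t. dist t 0 < e \<Longrightarrow> y + t *\<^sub>R v \<in> U"
      unfolding eventually_nhds_metric by blast
    define t where "t = min d e / 2"
    have t: "0 < t" "t < d" "t < e" using d e by (auto simp: t_def)
    have "y + t *\<^sub>R v \<in> K" using mem_iff_defining_fn[OF f e(2)[of t]] d(2)[of t] t f0 by simp
    from support_fn_ge[OF this, of x] have "t * (x \<bullet> v) \<le> 0" using y by (simp add: inner_add_right)
    then show ?thesis using t by (simp add: mult_le_0_iff)
  qed
  have xx: "x \<bullet> x = 1" using x by (simp add: norm_eq_1)
  define s where "s = 1 - (x \<bullet> n)\<^sup>2"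
  have le1: "\<bar>x \<bullet> n\<bar> \<le> 1" using Cauchy_Schwarz_ineq2[of x n] x n by simp
  have "s \<le> 0"
  proof (rule ccontr)
    assume "\<not> s \<le> 0"
    then have s: "s > 0" by simp
    \<comment> \<open>The component of \<open>x\<close> orthogonal to \<open>n\<close>, tilted
      slightly inwards. Here \<open>s\<close> is the squared sine of the angle between
      \<open>x\<close> and \<open>n\<close>; the vector has inner product -s/2 with \<open>n\<close>
      but at least s/2 with \<open>x\<close>.\<close>
    have "x \<bullet> (x - (x \<bullet> n) *\<^sub>R n - (s/2) *\<^sub>R n) \<le> 0"
      by (rule half) (use s in \<open>simp add: inner_diff_right nn inner_commute\<close>)
    then have "s - (s/2) * (x \<bullet> n) \<le> 0" by (simp add: inner_diff_right xx s_def power2_eq_square)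
    moreover have "(s/2) * (x \<bullet> n) \<le> (s/2) * 1" using le1 s by (intro mult_left_mono) auto
    ultimately show False using s by linarith
  qed
  moreover have "x \<bullet> n \<ge> 0" using half[of "- n"] nn by simp
  ultimately have "x \<bullet> n = 1"
    using le1 abs_le_square_iff[of 1 "x \<bullet> n"] by (simp add: s_def)
  then have "x = n" using norm_cauchy_schwarz_eq[of x n] x n by simp
  then show thesis using that[OF yf f] by (simp add: n_def)
qed

end

section \<open>Regularity of the support function\<close>

lemma Ck_3_iff: "Ck 3 U g \<longleftrightarrow> Ck (Suc 2) U g" "Ck 4 U g \<longleftrightarrow> Ck (Suc 3) U g"
  by (rule arg_cong[of _ _ "\<lambda>k. Ck k U g"], simp)+

text \<open>Only continuity of the local inverse is kept; its higher regularity comes from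
  \<open>Ck_inverse_function\<close>.\<close>

lemma inverse_function_jac3:
  fixes G :: "real^3 \<Rightarrow> real^3"
  assumes "open U" "y0 \<in> U" "\<And>i. Ck (Suc k) U (\<lambda>y. G y $ i)"
    and det: "\<And>y. y \<in> U \<Longrightarrow> det (jac3 G y) \<noteq> 0"
  obtains V g where "open V" "G y0 \<in> V" "g ` V \<subseteq> U" "continuous_on V g" "g (G y0) = y0"
    "\<And>z. z \<in> V \<Longrightarrow> G (g z) = z"
proof -
  define G' where "G' y = Blinfun (\<lambda>v. jac3 G y *v v)" for y
  have G': "blinfun_apply (G' y) = (\<lambda>v. jac3 G y *v v)" for y
    unfolding G'_def by (rule bounded_linear_Blinfun_apply) (rule matrix_vector_mul_bounded_linear)
  have "(G has_derivative blinfun_apply (G' y)) (at y)" if "y \<in> U" for y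
    unfolding G' using assms(3) that by (intro has_derivative_jac3) auto
  moreover have "continuous_on U G'"
  proof (rule continuous_on_blinfun_componentwise)
    fix b :: "real^3" assume "b \<in> Basis"
    then obtain j where b: "b = axis j 1" by (auto simp: Basis_vec_def)
    have "continuous_on U (\<lambda>y. \<chi> i. pderiv3 (\<lambda>y. G y $ i) j y)"
      using assms(3) by (intro continuous_on_vec_lambda) (auto intro: Ck_continuous_on)
    then show "continuous_on U (\<lambda>y. blinfun_apply (G' y) b)"
      unfolding G' b by (simp add: matrix_vector_mult_basis column_def jac3_def)
  qed
  moreover have "Blinfun (\<lambda>v. matrix_inv (jac3 G y0) *v v) o\<^sub>L G' y0 = id_blinfun"
  proof (rule blinfun_eqI)
    fix v
    have "invertible (jac3 G y0)" using det[OF assms(2)] by (simp add: invertible_det_nz)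
    then show "blinfun_apply (Blinfun (\<lambda>v. matrix_inv (jac3 G y0) *v v) o\<^sub>L G' y0) v = blinfun_apply id_blinfun v"
      by (simp add: G' bounded_linear_Blinfun_apply matrix_vector_mul_bounded_linear
          matrix_vector_mul_assoc matrix_inv_inverse(1))
  qed
  ultimately obtain U' V g g' where *: "open U'" "U' \<subseteq> U" "y0 \<in> U'" "open V" "G y0 \<in> V" "homeomorphism U' V G g"
    using inverse_function_theorem[OF assms(1), of G G' y0] assms(2) by metis
  show thesis
  proof (rule that[OF *(4,5)])
    show "g ` V \<subseteq> U" "continuous_on V g" "g (G y0) = y0" "\<And>z. z \<in> V \<Longrightarrow> G (g z) = z"
      using * by (auto simp: homeomorphism_def)
  qed
qed

context smooth_body
begin

text \<open>\<open>Y\<close> is the inverse Gauss map extended to a conical neighbourhood by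
  homogeneity of degree 0; it will be the gradient of \<open>h\<close>. Its derivative on the
  tangent plane inverts the Weingarten map, whence the determinant 1/K.\<close>

lemma local_gradient_map:
  assumes x0: "norm x0 = 1" and y0: "y0 \<in> frontier K" and f: "local_defining_fn 4 K y0 U f"
    and normal: "outer_normal f y0 = x0" and curv: "gauss_curv f y0 \<noteq> 0"
  obtains W Y where "open W" "\<And>t. t > 0 \<Longrightarrow> t *\<^sub>R x0 \<in> W" "\<And>i. Ck 3 W (\<lambda>x. Y x $ i)"
    "\<And>x. x \<in> W \<Longrightarrow> Y x \<in> K" "\<And>x. x \<in> W \<Longrightarrow> h x = x \<bullet> Y x"
    "\<And>e1 e2. frame3 x0 e1 e2 \<Longrightarrow> \<exists>D. (Y has_derivative D) (at x0) \<and>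
       (e1 \<bullet> D e1) * (e2 \<bullet> D e2) - (e1 \<bullet> D e2)\<^sup>2 = 1 / gauss_curv f y0"
proof -
  have U: "open U" "y0 \<in> U" "Ck 4 U f" "grad3 f y0 \<noteq> 0"
    using f by (simp_all add: local_defining_fn_def)
  have f0: "f y0 = 0" using defining_fn_zero[OF y0 f] .
  have fC: "Ck 3 U (pderiv3 f i)" "Ck 3 U (dd v f)" "Ck 3 U f" "Ck 2 U f" for i v
    using U(3) Ck_dd[OF U(1), of 3 f] Ck_mono[OF U(3), of 3] Ck_mono[OF U(3), of 2]
    unfolding Ck_3_iff(2) pderiv3_eq_dd by simp_all
  define m where "m = norm (grad3 f y0)"
  have m: "m > 0" using U(4) by (simp add: m_def)
  have grad0: "grad3 f y0 = m *\<^sub>R x0" using normal U(4) by (auto simp: m_def outer_normal_def)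
  have x0x0: "x0 \<bullet> x0 = 1" using x0 by (simp add: norm_eq_1)
  define p where "p y = x0 \<bullet> grad3 f y" for y
  have fd: "f differentiable (at y)" if "y \<in> U" for y by (rule Ck_differentiable_at[OF U(3) _ that]) simp
  have pC: "Ck 3 U p"
    by (rule Ck_cong[OF U(1) _ fC(2)[of x0]]) (simp add: p_def dd_eq_grad3 fd)
  have p0: "p y0 = m" by (simp add: p_def grad0 x0x0)
  define U1 where "U1 = U \<inter> p -` {0<..}"
  have U1: "open U1" "y0 \<in> U1" "U1 \<subseteq> U" "\<And>y. y \<in> U1 \<Longrightarrow> p y > 0"
    using continuous_open_preimage[OF Ck_continuous_on[OF pC] U(1), of "{0<..}"] U(2) m p0
    by (auto simp: U1_def)
  \<comment> \<open>On the surface \<open>f = 0\<close> this is the Gauss map followed by central projection to the plane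
    \<open>x0 \<bullet> z = 1\<close>; the term \<open>f y *\<^sub>R x0\<close> extends it to a local diffeomorphism of space.\<close>
  define G where "G y = (1 / p y) *\<^sub>R grad3 f y + f y *\<^sub>R x0" for y
  have Gi: "(\<lambda>y. G y $ i) = (\<lambda>y. pderiv3 f i y / p y + f y * x0 $ i)" for i
    by (simp add: G_def grad3_def fun_eq_iff)
  have GC: "Ck 3 U1 (\<lambda>y. G y $ i)" for i
    unfolding Gi using U1(4) less_imp_neq
    by (intro Ck_add Ck_mult Ck_divide U1(1) Ck_const Ck_subset[OF fC(1) U1(3)] Ck_subset[OF fC(3) U1(3)]
        Ck_subset[OF pC U1(3)]) fastforce
  have xG: "x0 \<bullet> G y = 1 + f y" if "y \<in> U1" for y
    using U1(4)[OF that] by (simp add: G_def inner_add_right x0x0 flip: p_def)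
  have Gy0: "G y0 = x0" using m by (simp add: G_def grad0 p0 f0)
  define J where "J = jac3 G y0"
  define H where "H = hess3 f y0"
  have dG: "(G has_derivative (\<lambda>v. J *v v)) (at y0)"
    unfolding J_def by (intro has_derivative_jac3 Ck_differentiable_at[OF GC _ U1(2)]) simp
  have dgrad: "(grad3 f has_derivative (\<lambda>v. H *v v)) (at y0)"
  proof -
    have "jac3 (grad3 f) y0 = H"
      using hess3_symmetric[OF U(1) fC(4) U(2)] by (simp add: jac3_def H_def vec_eq_iff grad3_def hess3_def)
    moreover have "(\<lambda>y. grad3 f y $ j) differentiable (at y0)" for j
      using Ck_differentiable_at[OF fC(1) _ U(2), of j] by (simp add: grad3_def)
    ultimately show ?thesis using has_derivative_jac3[of "grad3 f" y0] by simp
  qed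
  have dp: "(p has_derivative (\<lambda>v. x0 \<bullet> (H *v v))) (at y0)"
    unfolding p_def using dgrad by (rule has_derivative_inner_right)
  have df: "(f has_derivative (\<lambda>v. m * (x0 \<bullet> v))) (at y0)"
    using has_derivative_dd[OF fd[OF U(2)]] by (simp add: dd_eq_grad3[OF fd[OF U(2)]] grad0 inner_commute)
  have "(G has_derivative (\<lambda>v. ((1 / p y0) *\<^sub>R (H *v v) + (- (x0 \<bullet> (H *v v)) / (p y0 * p y0)) *\<^sub>R grad3 f y0)
      + (m * (x0 \<bullet> v)) *\<^sub>R x0)) (at y0)"
    unfolding G_def using m p0
    by (intro has_derivative_add has_derivative_scaleR dgrad
        has_derivative_scaleR_left[OF df] has_derivative_eq_rhs[OF has_derivative_divide[OF has_derivative_const dp]])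
      (auto simp: fun_eq_iff divide_inverse)
  \<comment> \<open>On the tangent plane \<open>J\<close> is the tangential part of H/m, the
    Weingarten map, and the normal component of J v is m (x0 . v). So \<open>J\<close> is injective
    once the Gauss curvature is nonzero.\<close>
  then have Jv: "J *v v = (1/m) *\<^sub>R (H *v v) - (x0 \<bullet> (H *v v) / m) *\<^sub>R x0 + (m * (x0 \<bullet> v)) *\<^sub>R x0" for v
    using fun_cong[OF has_derivative_unique[OF dG], of _ v] m by (simp add: p0 grad0)
  have J_frame: "J *v e1 = (e1 \<bullet> (H *v e1) / m) *\<^sub>R e1 + (e2 \<bullet> (H *v e1) / m) *\<^sub>R e2"
    if "frame3 x0 e1 e2" for e1 e2
  proof -
    have "H *v e1 = (x0 \<bullet> (H *v e1)) *\<^sub>R x0 + (e1 \<bullet> (H *v e1)) *\<^sub>R e1 + (e2 \<bullet> (H *v e1)) *\<^sub>R e2"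
      by (rule frame3_expansion[OF that])
    then have "(1/m) *\<^sub>R (H *v e1) = (1/m) *\<^sub>R ((x0 \<bullet> (H *v e1)) *\<^sub>R x0 + (e1 \<bullet> (H *v e1)) *\<^sub>R e1 + (e2 \<bullet> (H *v e1)) *\<^sub>R e2)"
      by simp
    then show ?thesis using frame3_inner[OF that] by (simp add: Jv scaleR_add_right)
  qed
  define II where "II v w = (v \<bullet> (H *v w)) / m" for v w
  have curvII: "gauss_curv f y0 = II e1 e1 * II e2 e2 - (II e1 e2)\<^sup>2" "II e2 e1 = II e1 e2"
    if "frame3 x0 e1 e2" for e1 e2
    using gauss_curv_frame[OF that grad0 m U(1) fC(4) U(2)] by (simp_all add: II_def H_def)
  have J1: "J *v e1 = II e1 e1 *\<^sub>R e1 + II e1 e2 *\<^sub>R e2" "J *v e2 = II e1 e2 *\<^sub>R e1 + II e2 e2 *\<^sub>R e2"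
    if F: "frame3 x0 e1 e2" for e1 e2
    using J_frame[OF F] J_frame[OF frame3_swap[OF F]] curvII(2)[OF F] by (simp_all add: II_def)
  obtain a1 where "norm a1 = 1" "x0 \<bullet> a1 = 0" using unit_orthogonal_exists[of x0] by blast
  then obtain a2 where F0: "frame3 x0 a1 a2" using frame3_exists x0 by blast
  have inj: "v = 0" if v: "J *v v = 0" for v
  proof -
    note i = frame3_inner[OF F0]
    have "x0 \<bullet> (J *v v) = m * (x0 \<bullet> v)" by (simp add: Jv inner_add_right inner_diff_right x0x0)
    then have xv: "x0 \<bullet> v = 0" using v m by simp
    define s t where "s = a1 \<bullet> v" "t = a2 \<bullet> v"
    have vv: "v = s *\<^sub>R a1 + t *\<^sub>R a2" using frame3_expansion[OF F0, of v] xv by (simp add: s_t_def)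
    have "J *v v = s *\<^sub>R (J *v a1) + t *\<^sub>R (J *v a2)"
      unfolding vv by (simp add: matrix_vector_right_distrib matrix_vector_mult_scaleR)
    then have z: "s *\<^sub>R (II a1 a1 *\<^sub>R a1 + II a1 a2 *\<^sub>R a2) + t *\<^sub>R (II a1 a2 *\<^sub>R a1 + II a2 a2 *\<^sub>R a2) = 0"
      using v J1[OF F0] by simp
    have 1: "s * II a1 a1 + t * II a1 a2 = 0" using arg_cong[OF z, of "\<lambda>w. a1 \<bullet> w"] by (simp add: inner_add_right i)
    have 2: "s * II a1 a2 + t * II a2 a2 = 0" using arg_cong[OF z, of "\<lambda>w. a2 \<bullet> w"] by (simp add: inner_add_right i)
    have "s * gauss_curv f y0 = II a2 a2 * (s * II a1 a1 + t * II a1 a2) - II a1 a2 * (s * II a1 a2 + t * II a2 a2)"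
      by (simp add: curvII(1)[OF F0] algebra_simps power2_eq_square)
    then have "s = 0" using 1 2 curv by simp
    have "t * gauss_curv f y0 = II a1 a1 * (s * II a1 a2 + t * II a2 a2) - II a1 a2 * (s * II a1 a1 + t * II a1 a2)"
      by (simp add: curvII(1)[OF F0] algebra_simps power2_eq_square)
    then have "t = 0" using 1 2 curv by simp
    with \<open>s = 0\<close> show "v = 0" by (simp add: vv)
  qed
  have invJ: "invertible J"
    using inj matrix_left_invertible_ker[of J] invertible_left_inverse by blast
  have detC: "continuous_on U1 (\<lambda>y. det (jac3 G y))"
  proof (rule Ck_continuous_on[of 2], rule Ck_det[OF U1(1)])
    show "Ck 2 U1 (\<lambda>y. jac3 G y $ i $ j)" for i j
      using GC[of i, unfolded Ck_3_iff(1) Ck.simps(2)] by (simp add: jac3_def)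
  qed
  define U2 where "U2 = U1 \<inter> (\<lambda>y. det (jac3 G y)) -` (- {0})"
  have U2: "open U2" "y0 \<in> U2" "U2 \<subseteq> U1" "\<And>y. y \<in> U2 \<Longrightarrow> det (jac3 G y) \<noteq> 0"
    using continuous_open_preimage[OF detC U1(1), of "- {0}"] U1(2) invJ
    by (auto simp: U2_def J_def invertible_det_nz open_Compl)
  have GC2: "\<And>i. Ck (Suc 2) U2 (\<lambda>y. G y $ i)"
    using Ck_subset[OF GC U2(3)] by (simp only: Ck_3_iff(1))
  obtain V g where V: "open V" "G y0 \<in> V" "g ` V \<subseteq> U2" "continuous_on V g" "g (G y0) = y0"
    "\<And>z. z \<in> V \<Longrightarrow> G (g z) = z"
    using inverse_function_jac3[OF U2(1,2) GC2 U2(4)] by blast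
  have gC: "Ck 3 V (\<lambda>z. g z $ i)" for i
    unfolding Ck_3_iff(1) by (rule Ck_inverse_function(1)[OF U2(1) V(1) GC2 U2(4) V(3,4,6)])
  have gD: "(g has_derivative (\<lambda>v. matrix_inv J *v v)) (at x0)"
    using Ck_inverse_function(2)[OF U2(1) V(1) GC2 U2(4) V(3,4,6) V(2)] by (simp add: Gy0 J_def V(5)[unfolded Gy0])
  \<comment> \<open>Central projection onto the plane x0 . z = 1. As x0 . G y = 1 + f y, solving G
    (Y x) = q x forces f (Y x) = 0, so \<open>Y x\<close> lies on the surface and its normal is a
    positive multiple of \<open>x\<close>.\<close>
  define q where "q x = (1 / (x0 \<bullet> x)) *\<^sub>R x" for x
  define S where "S = {x. x0 \<bullet> x > 0}"
  have S: "open S" unfolding S_def by (intro open_Collect_less continuous_intros)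
  have qC: "Ck k S (\<lambda>x. q x $ i)" for k i
  proof -
    have "Ck k S (\<lambda>x. x $ i / (x0 \<bullet> x))"
      by (intro Ck_divide S Ck_component Ck_bounded_linear bounded_linear_inner_right) (auto simp: S_def)
    then show ?thesis by (simp add: q_def)
  qed
  have "continuous_on S q"
    using Ck_continuous_on[OF qC[of 0]] continuous_on_componentwise[of S q] by (auto simp: Basis_vec_def inner_axis)
  define W where "W = S \<inter> q -` V"
  have W: "open W" unfolding W_def by (rule continuous_open_preimage) fact+
  define Y where "Y x = g (q x)" for x
  have qx0: "q x0 = x0" by (simp add: q_def x0x0)
  have props: "Y x \<in> K \<and> h x = x \<bullet> Y x" if x: "x \<in> W" for x
  proof -
    have xs: "x0 \<bullet> x > 0" "q x \<in> V" using x by (auto simp: W_def S_def)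
    then have Yx: "Y x \<in> U1" using V(3) U2(3) by (auto simp: Y_def)
    have GY: "G (Y x) = q x" using V(6)[OF xs(2)] by (simp add: Y_def)
    have "x0 \<bullet> q x = 1" using xs by (simp add: q_def)
    then have fY: "f (Y x) = 0" using xG[OF Yx] GY by simp
    have "q x = (1 / p (Y x)) *\<^sub>R grad3 f (Y x)" using GY fY by (simp add: G_def)
    then have "(x0 \<bullet> x) *\<^sub>R q x = (x0 \<bullet> x / p (Y x)) *\<^sub>R grad3 f (Y x)" by simp
    then have "x = (x0 \<bullet> x / p (Y x)) *\<^sub>R grad3 f (Y x)" using xs by (simp add: q_def)
    moreover have "x0 \<bullet> x / p (Y x) \<ge> 0" using xs U1(4)[OF Yx] by simp
    ultimately show ?thesis
      using support_fn_at_normal[of 3 y0 U f "Y x" x "x0 \<bullet> x / p (Y x)"] f fY Yx U1(3) by auto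
  qed
  show thesis
  proof (rule that[OF W])
    show "t *\<^sub>R x0 \<in> W" if "t > 0" for t
    proof -
      have "q (t *\<^sub>R x0) = x0" using that by (simp add: q_def x0x0)
      then show ?thesis using that V(2) Gy0 by (simp add: W_def S_def x0x0)
    qed
    show "Ck 3 W (\<lambda>x. Y x $ i)" for i
      unfolding Y_def
      by (rule Ck_compose[OF W V(1) gC Ck_subset[OF qC]]) (auto simp: W_def)
    show "Y x \<in> K" "h x = x \<bullet> Y x" if "x \<in> W" for x using props[OF that] by auto
    fix e1 e2 assume F: "frame3 x0 e1 e2"
    note i = frame3_inner[OF F]
    have "(q has_derivative (\<lambda>v. (1 / (x0 \<bullet> x0)) *\<^sub>R v + (- (x0 \<bullet> v) / ((x0 \<bullet> x0) * (x0 \<bullet> x0))) *\<^sub>R x0)) (at x0)"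
      unfolding q_def
      by (intro has_derivative_scaleR has_derivative_ident has_derivative_eq_rhs[OF has_derivative_divide[OF has_derivative_const
         has_derivative_inner_right[OF has_derivative_ident]]]) (auto simp: x0x0 fun_eq_iff)
    then have "(q has_derivative (\<lambda>v. v - (x0 \<bullet> v) *\<^sub>R x0)) (at x0)" by (simp add: x0x0)
    then have D: "(Y has_derivative (\<lambda>v. matrix_inv J *v (v - (x0 \<bullet> v) *\<^sub>R x0))) (at x0)"
      unfolding Y_def by (rule has_derivative_compose) (simp add: qx0 gD)
    define \<Delta> where "\<Delta> = gauss_curv f y0"
    have \<Delta>: "\<Delta> \<noteq> 0" "\<Delta> = II e1 e1 * II e2 e2 - (II e1 e2)\<^sup>2" using curv curvII(1)[OF F] by (simp_all add: \<Delta>_def)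
    have Jinv: "matrix_inv J *v (J *v v) = v" for v
      by (simp add: matrix_vector_mul_assoc matrix_inv_inverse(1)[OF invJ])
    have "J *v ((II e2 e2 / \<Delta>) *\<^sub>R e1 + (- II e1 e2 / \<Delta>) *\<^sub>R e2) = ((II e1 e1 * II e2 e2 - (II e1 e2)\<^sup>2) / \<Delta>) *\<^sub>R e1"
      by (simp add: matrix_vector_right_distrib matrix_vector_mult_scaleR J1[OF F] scaleR_add_right power2_eq_square
          diff_divide_distrib scaleR_diff_left mult.commute del: scaleR_minus_left)
        (simp add: algebra_simps)
    then have e1: "matrix_inv J *v e1 = (II e2 e2 / \<Delta>) *\<^sub>R e1 + (- II e1 e2 / \<Delta>) *\<^sub>R e2"
      using \<Delta> Jinv by (metis divide_self scaleR_one)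
    have "J *v ((- II e1 e2 / \<Delta>) *\<^sub>R e1 + (II e1 e1 / \<Delta>) *\<^sub>R e2) = ((II e1 e1 * II e2 e2 - (II e1 e2)\<^sup>2) / \<Delta>) *\<^sub>R e2"
      by (simp add: matrix_vector_right_distrib matrix_vector_mult_scaleR J1[OF F] scaleR_add_right power2_eq_square
          diff_divide_distrib scaleR_diff_left mult.commute del: scaleR_minus_left)
        (simp add: algebra_simps)
    then have e2: "matrix_inv J *v e2 = (- II e1 e2 / \<Delta>) *\<^sub>R e1 + (II e1 e1 / \<Delta>) *\<^sub>R e2"
      using \<Delta> Jinv by (metis divide_self scaleR_one)
    have "(II e2 e2 / \<Delta>) * (II e1 e1 / \<Delta>) - (- II e1 e2 / \<Delta>)\<^sup>2 = (II e1 e1 * II e2 e2 - (II e1 e2)\<^sup>2) / (\<Delta> * \<Delta>)"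
      by (simp add: power2_eq_square diff_divide_distrib)
    also have "\<dots> = 1 / \<Delta>" using \<Delta>(1) by (simp flip: \<Delta>(2))
    finally have "(e1 \<bullet> (matrix_inv J *v e1)) * (e2 \<bullet> (matrix_inv J *v e2)) - (e1 \<bullet> (matrix_inv J *v e2))\<^sup>2 = 1 / \<Delta>"
      unfolding e1 e2 by (simp add: inner_add_right inner_diff_right i)
    then show "\<exists>D. (Y has_derivative D) (at x0) \<and>
       (e1 \<bullet> D e1) * (e2 \<bullet> D e2) - (e1 \<bullet> D e2)\<^sup>2 = 1 / gauss_curv f y0"
      using D i by (intro exI[of _ "\<lambda>v. matrix_inv J *v (v - (x0 \<bullet> v) *\<^sub>R x0)"]) (simp add: \<Delta>_def)
  qed
qed

text \<open>Envelope argument: maximality at \<open>x\<close> and at \<open>y\<close> squeezes the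
  first-order error between 0 and (y - x) . (Y y - Y x). Continuity of \<open>Y\<close> alone
  suffices, so \<open>h\<close> is one order smoother than \<open>Y\<close>.\<close>

lemma support_fn_has_derivative:
  assumes W: "open W" and YC: "\<And>i. continuous_on W (\<lambda>x. Y x $ i)"
    and Y: "\<And>x. x \<in> W \<Longrightarrow> Y x \<in> K" "\<And>x. x \<in> W \<Longrightarrow> h x = x \<bullet> Y x" and x: "x \<in> W"
  shows "(h has_derivative (\<lambda>v. v \<bullet> Y x)) (at x)"
  unfolding has_derivative_at_alt
proof (intro conjI allI impI)
  show "bounded_linear (\<lambda>v. v \<bullet> Y x)" by (rule bounded_linear_inner_left)
  fix e :: real assume e: "e > 0"
  have "continuous_on W Y"
    using YC continuous_on_componentwise[of W Y] by (auto simp: Basis_vec_def inner_axis)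
  then have "isCont Y x" using W x by (simp add: continuous_on_eq_continuous_at)
  then obtain d1 where d1: "d1 > 0" "\<And>x'. dist x' x < d1 \<Longrightarrow> dist (Y x') (Y x) < e"
    using e unfolding continuous_within_eps_delta by auto
  obtain d2 where d2: "d2 > 0" "ball x d2 \<subseteq> W" using W x open_contains_ball by metis
  show "\<exists>d>0. \<forall>y. norm (y - x) < d \<longrightarrow> norm (h y - h x - (y - x) \<bullet> Y x) \<le> e * norm (y - x)"
  proof (intro exI[of _ "min d1 d2"] conjI allI impI)
    fix y assume "norm (y - x) < min d1 d2"
    then have y: "dist y x < d1" "y \<in> W" using d2 by (auto simp: dist_norm norm_minus_commute)
    have "h y - h x - (y - x) \<bullet> Y x = y \<bullet> (Y y - Y x)"
      by (simp add: Y(2)[OF x] Y(2)[OF y(2)] inner_diff_left inner_diff_right)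
    moreover have "y \<bullet> (Y y - Y x) \<ge> 0"
      using support_fn_ge[OF Y(1)[OF x], of y] Y(2)[OF y(2)] by (simp add: inner_diff_right)
    moreover have "x \<bullet> (Y y - Y x) \<le> 0"
      using support_fn_ge[OF Y(1)[OF y(2)], of x] Y(2)[OF x] by (simp add: inner_diff_right)
    then have "y \<bullet> (Y y - Y x) \<le> (y - x) \<bullet> (Y y - Y x)" by (simp add: inner_diff_left)
    moreover have "(y - x) \<bullet> (Y y - Y x) \<le> norm (y - x) * norm (Y y - Y x)" by (rule norm_cauchy_schwarz)
    moreover have "norm (y - x) * norm (Y y - Y x) \<le> norm (y - x) * e"
      using d1(2)[OF y(1)] by (intro mult_left_mono) (auto simp: dist_norm)
    ultimately show "norm (h y - h x - (y - x) \<bullet> Y x) \<le> e * norm (y - x)"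
      by (simp add: mult.commute)
  qed (use d1 d2 in auto)
qed

end

section \<open>The support function as a solution, and the conclusion\<close>

locale lp_body = smooth_body +
  fixes a C :: real
  assumes a: "0 < a" "a \<le> 2" and C: "C > 0"
    and curv_eq: "\<And>x y U f. norm x = 1 \<Longrightarrow> y \<in> frontier K \<Longrightarrow> local_defining_fn 4 K y U f \<Longrightarrow>
      outer_normal f y = x \<Longrightarrow> support_fn K x powr a / gauss_curv f y = C"
begin

lemma gradient_map:
  assumes x0: "norm x0 = 1"
  obtains W Y where "open W" "\<And>t. t > 0 \<Longrightarrow> t *\<^sub>R x0 \<in> W" "\<And>i. Ck 3 W (\<lambda>x. Y x $ i)"
    "\<And>x. x \<in> W \<Longrightarrow> Y x \<in> K" "\<And>x. x \<in> W \<Longrightarrow> h x = x \<bullet> Y x"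
    "\<And>x. x \<in> W \<Longrightarrow> (h has_derivative (\<lambda>v. v \<bullet> Y x)) (at x)"
    "\<And>e1 e2. frame3 x0 e1 e2 \<Longrightarrow> \<exists>D. (Y has_derivative D) (at x0) \<and>
       (e1 \<bullet> D e1) * (e2 \<bullet> D e2) - (e1 \<bullet> D e2)\<^sup>2 = C * h x0 powr (- a)"
proof -
  obtain y U f where y: "y \<in> frontier K" "local_defining_fn 4 K y U f" "outer_normal f y = x0"
    using normal_attained[OF x0] by blast
  have c: "h x0 powr a / gauss_curv f y = C" by (rule curv_eq[OF x0 y])
  \<comment> \<open>Division by zero yields 0 in HOL, so C > 0 excludes vanishing curvature.\<close>
  then have nz: "gauss_curv f y \<noteq> 0" using C by auto
  have "x0 \<noteq> 0" using x0 by auto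
  then have "h x0 > 0" by (rule support_fn_pos)
  then have inv: "1 / gauss_curv f y = C * h x0 powr (- a)" using c nz C by (simp add: powr_minus field_simps)
  show thesis
  proof (rule local_gradient_map[OF x0 y nz])
    fix W Y
    assume *: "open W" "\<And>t. t > 0 \<Longrightarrow> t *\<^sub>R x0 \<in> W" "\<And>i. Ck 3 W (\<lambda>x. Y x $ i)"
    "\<And>x. x \<in> W \<Longrightarrow> Y x \<in> K" "\<And>x. x \<in> W \<Longrightarrow> h x = x \<bullet> Y x"
    "\<And>e1 e2. frame3 x0 e1 e2 \<Longrightarrow> \<exists>D. (Y has_derivative D) (at x0) \<and>
       (e1 \<bullet> D e1) * (e2 \<bullet> D e2) - (e1 \<bullet> D e2)\<^sup>2 = 1 / gauss_curv f y"
    show thesis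
      by (rule that[OF *(1-5) support_fn_has_derivative[OF *(1) Ck_continuous_on[OF *(3)] *(4,5)] *(6)[unfolded inv]])
  qed
qed

lemma smooth_support_fn: "Ck 4 (- {0}) h"
proof (rule Ck_local)
  fix x :: "real^3" assume "x \<in> - {0}"
  then have x: "norm x > 0" by simp
  define x0 where "x0 = (1 / norm x) *\<^sub>R x"
  have x0: "norm x0 = 1" "x = norm x *\<^sub>R x0" using x by (simp_all add: x0_def)
  obtain W Y where W: "open W" "\<And>t. t > 0 \<Longrightarrow> t *\<^sub>R x0 \<in> W" "\<And>i. Ck 3 W (\<lambda>x. Y x $ i)"
    "\<And>x. x \<in> W \<Longrightarrow> (h has_derivative (\<lambda>v. v \<bullet> Y x)) (at x)"
    using gradient_map[OF x0(1)] by metis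
  have "Ck 3 W (pderiv3 h i)" for i
  proof (rule Ck_cong[OF W(1) _ W(3)[of i]])
    show "Y x $ i = pderiv3 h i x" if "x \<in> W" for x
      unfolding pderiv3_eq_dd using dd_eqI[OF W(4)[OF that], of "axis i 1"] by (simp add: inner_axis')
  qed
  moreover have "\<forall>x\<in>W. h differentiable (at x)" using W(4) by (auto intro: differentiableI)
  ultimately have "Ck 4 W h" unfolding Ck_3_iff(2) Ck.simps(2) by blast
  then show "\<exists>V. open V \<and> x \<in> V \<and> Ck 4 V h" using W(1) W(2)[OF x] x0(2) by auto
qed

lemma subgradient: "x \<noteq> 0 \<Longrightarrow> h x + dd v h x \<le> h (x + v)"
proof -
  assume x: "x \<noteq> 0"
  define x0 where "x0 = (1 / norm x) *\<^sub>R x"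
  have x0: "norm x0 = 1" "x = norm x *\<^sub>R x0" using x by (simp_all add: x0_def)
  obtain W Y where W: "\<And>t. t > 0 \<Longrightarrow> t *\<^sub>R x0 \<in> W"
    "\<And>x. x \<in> W \<Longrightarrow> Y x \<in> K" "\<And>x. x \<in> W \<Longrightarrow> h x = x \<bullet> Y x"
    "\<And>x. x \<in> W \<Longrightarrow> (h has_derivative (\<lambda>v. v \<bullet> Y x)) (at x)"
    using gradient_map[OF x0(1)] by metis
  have xW: "x \<in> W" using W(1)[of "norm x"] x x0(2) by simp
  show ?thesis
    using support_fn_ge[OF W(2)[OF xW], of "x + v"] W(3)[OF xW] dd_eqI[OF W(4)[OF xW], of v]
    by (simp add: inner_add_left)
qed

text \<open>By the subgradient inequality the tangent line minus \<open>h\<close> has a maximum at t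
  = 0 along every line, and \<open>jet2_max\<close> applies.\<close>

lemma hess_nonneg:
  assumes "x \<noteq> 0" shows "dd v (dd v h) x \<ge> 0"
proof -
  have P: "open (- {0 :: real^3})" by (intro open_Compl closed_singleton)
  have "jet2 (\<lambda>t. h (x + t *\<^sub>R v)) (h x) (dd v h x) (dd v (dd v h) x)"
    using assms Ck_mono[OF smooth_support_fn, of 2] by (intro jet2_line[OF P]) auto
  from jet2_add[OF jet2_mult[OF jet2_const[of "-1"] this]
      jet2_add[OF jet2_const[of "h x"] jet2_mult[OF jet2_ident jet2_const[of "dd v h x"]]]]
  have j: "jet2 (\<lambda>t. - 1 * h (x + t *\<^sub>R v) + (h x + t * dd v h x)) 0 0 (- dd v (dd v h) x)"
    by simp
  have "- 1 * h (x + t *\<^sub>R v) + (h x + t * dd v h x) \<le> - 1 * h (x + 0 *\<^sub>R v) + (h x + 0 * dd v h x)" for t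
  proof -
    have "linear (\<lambda>v. dd v h x)"
      using Ck_differentiable_at[OF smooth_support_fn, of x] assms by (intro linear_dd) simp
    then show ?thesis using subgradient[OF assms, of "t *\<^sub>R v"] linear_cmul by fastforce
  qed
  from jet2_max(2)[OF j this] show ?thesis by simp
qed

text \<open>Near \<open>x\<close> the gradient of \<open>h\<close> is \<open>Y\<close>, so the
  Hessian is the derivative of \<open>Y\<close>, whose determinant on the tangent plane is known
  from \<open>gradient_map\<close>.\<close>

lemma monge_ampere:
  assumes F: "frame3 x e f"
  shows "dd e (dd e h) x * dd f (dd f h) x - (dd f (dd e h) x)\<^sup>2 = C * h x powr (- a)"
proof -
  have x: "norm x = 1" using F by (simp add: frame3_def)
  obtain W Y where W: "open W" "\<And>t. t > 0 \<Longrightarrow> t *\<^sub>R x \<in> W"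
    "\<And>i. Ck 3 W (\<lambda>x. Y x $ i)" "\<And>x. x \<in> W \<Longrightarrow> Y x \<in> K" "\<And>x. x \<in> W \<Longrightarrow> h x = x \<bullet> Y x"
    "\<And>x. x \<in> W \<Longrightarrow> (h has_derivative (\<lambda>v. v \<bullet> Y x)) (at x)"
    "\<And>e1 e2. frame3 x e1 e2 \<Longrightarrow> \<exists>D. (Y has_derivative D) (at x) \<and>
       (e1 \<bullet> D e1) * (e2 \<bullet> D e2) - (e1 \<bullet> D e2)\<^sup>2 = C * h x powr (- a)"
    by (rule gradient_map[OF x]) (rule that)
  obtain D where D: "(Y has_derivative D) (at x)"
    "(e \<bullet> D e) * (f \<bullet> D f) - (e \<bullet> D f)\<^sup>2 = C * h x powr (- a)" using W(7)[OF F] by blast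
  have xW: "x \<in> W" using W(2)[of 1] by simp
  have "dd v (dd w h) x = w \<bullet> D v" for v w
  proof (rule dd_eqI, rule has_derivative_transform_within_open[OF _ W(1) xW])
    show "((\<lambda>x. w \<bullet> Y x) has_derivative (\<lambda>v. w \<bullet> D v)) (at x)"
      using D(1) by (rule has_derivative_inner_right)
    show "w \<bullet> Y z = dd w h z" if "z \<in> W" for z using dd_eqI[OF W(6)[OF that]] by simp
  qed
  then show ?thesis using D(2) by simp
qed

sublocale lp_solution h a "1 - a / 2" C
proof
  show "0 < a" "a \<le> 2" "C > 0" using a C by auto
qed (auto simp: smooth_support_fn support_fn_pos support_fn_scale monge_ampere hess_nonneg)

text \<open>A compact convex set is recovered from its support function: a ball point outside
  \<open>K\<close> could be strictly separated from it, and the support function in direction -w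
  would then be below r |w|.\<close>

theorem support_fn_constant: "\<exists>r>0. (\<forall>x. norm x = 1 \<longrightarrow> h x = r) \<and> K = cball 0 r"
proof -
  obtain r where r: "\<And>x. x \<noteq> 0 \<Longrightarrow> h x = r * norm x" using h_eq_norm by blast
  have u: "h x = r" if "norm x = 1" for x using r[of x] that by fastforce
  have "norm (axis 1 1 :: real^3) = 1" by simp
  then have r0: "r > 0" using u support_fn_pos by (metis norm_zero zero_neq_one)
  have "K = cball 0 r"
  proof (intro equalityI subsetI)
    fix y assume y: "y \<in> K"
    show "y \<in> cball 0 r"
    proof (cases "y = 0")
      case False
      then have "y \<bullet> y \<le> r * norm y" using support_fn_ge[OF y, of y] r[of y] by simp
      then show ?thesis using False by (simp add: power2_norm_eq_inner[symmetric] power2_eq_square)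
    qed (use r0 in simp)
  next
    fix z :: "real^3" assume z: "z \<in> cball 0 r"
    show "z \<in> K"
    proof (rule ccontr)
      assume "z \<notin> K"
      then obtain w b where wb: "w \<bullet> z < b" "\<forall>y\<in>K. w \<bullet> y > b"
        using separating_hyperplane_closed_point[OF convex compact_imp_closed[OF compact]] by blast
      obtain y where y: "y \<in> K" "h (- w) = (- w) \<bullet> y" using support_fn_attained by blast
      have "w \<noteq> 0" using wb y by auto
      then have "(- w) \<bullet> y = r * norm w" using r[of "- w"] y by simp
      moreover have "(- w) \<bullet> y < (- w) \<bullet> z" using wb y by force
      moreover have "(- w) \<bullet> z \<le> norm w * norm z" using norm_cauchy_schwarz[of "- w" z] by simp
      moreover have "norm w * norm z \<le> norm w * r" using z by (intro mult_left_mono) auto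
      ultimately show False by (simp add: mult.commute)
    qed
  qed
  then show ?thesis using r0 u by blast
qed

end

theorem theorem1p1:
  fixes K :: "(real^3) set" and p C :: real
  assumes "compact K" and "convex K" and "0 \<in> interior K"
    and "Ck_boundary 4 K"
    and "C > 0"
    and curv_eq: "\<forall>x y U f. norm x = 1 \<and> y \<in> frontier K \<and> local_defining_fn 4 K y U f
              \<and> outer_normal f y = x
              \<longrightarrow> support_fn K x powr (1 - p) / gauss_curv f y = C"
    and cases: "(-1 \<le> p \<and> p \<le> 0) \<or>
       (0 < p \<and> p < 1 \<and>
        (\<forall>y U f. y \<in> frontier K \<and> local_defining_fn 4 K y U f
            \<longrightarrow> kappa2 f y \<ge> beta_p p * kappa1 f y))"
  shows "(\<exists>r. \<forall>x. norm x = 1 \<longrightarrow> support_fn K x = r) \<and> (\<exists>r>0. K = cball 0 r)"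
proof -
  interpret lp_body K "1 - p" C
    by unfold_locales (use assms(1-5) curv_eq cases in auto)
  show ?thesis using support_fn_constant by blast
qed

end
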